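(* For $n \ge 2$, let $h(n)$ be the minimum integer such that every complete $n$-vertex simple topological graph contains an edge that crosses at most $h(n)$ other edges. Then $h(n) = O(n^{7/4})$; that is, there is an absolute constant $C > 0$ such that for every integer $n \ge 2$ we have $h(n) \le C n^{7/4}$.
   Context: A topological graph is a graph drawn in the plane such that its vertices are represented by (distinct) points and its edges are represented by non-self-intersecting arcs connecting the corresponding points. The edges are allowed to intersect, but they may not intersect vertices except for their endpoints. Furthermore, no two edges are tangent, i.e., if two edges share an interior point in common, then they must properly cross at that point. Two edges of a topological graph cross if their interiors share a point. A topological graph is simple if every pair of its edges intersect at most once, either at a common endpoint or at a proper crossing point. A topological graph is complete if its underlying abstract graph is complete, i.e., every pair of distinct vertices is joined by exactly one edge. *)

theory Defs
  imports "HOL-Analysis.Analysis"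
begin

text \<open>
  The plane is \<^typ>\<open>complex\<close>.  The vertices of a topological graph are identified with the
  points representing them, and its edges with parametrised arcs \<^typ>\<open>real \<Rightarrow> complex\<close> on the
  unit interval, so the endpoints of an edge are part of the data.  A priori this allows parallel
  edges, but not loops, because \<^const>\<open>arc\<close> requires injectivity on the closed interval.
\<close>

type_synonym plane_arc = "real \<Rightarrow> complex"

definition endpoints :: "plane_arc \<Rightarrow> complex set" where
  "endpoints e = {pathstart e, pathfinish e}"

definition arc_interior :: "plane_arc \<Rightarrow> complex set" where
  "arc_interior e = path_image e - endpoints e"

text \<open>
  Arcs are only continuous, so a proper crossing is a topological notion: some homeomorphism from
  a neighbourhood of the point onto the plane turns the two arcs into the two coordinate axes.
  This rules out touching points and forces the point to be an isolated common interior point.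
\<close>

definition properly_cross_at :: "plane_arc \<Rightarrow> plane_arc \<Rightarrow> complex \<Rightarrow> bool" where
  "properly_cross_at e f p \<longleftrightarrow>
     (\<exists>U h k. open U \<and> p \<in> U \<and> homeomorphism U UNIV h k \<and> h p = 0 \<and>
        h ` (path_image e \<inter> U) = {z. Im z = 0} \<and>
        h ` (path_image f \<inter> U) = {z. Re z = 0})"

text \<open>
  The last condition also excludes two distinct members of \<^term>\<open>E\<close> that parametrise the same
  point set, so counting parametrised arcs is counting edges.
\<close>

definition topological_graph :: "complex set \<Rightarrow> plane_arc set \<Rightarrow> bool" where
  "topological_graph V E \<longleftrightarrow>
     finite V \<and>
     (\<forall>e\<in>E. arc e \<and> endpoints e \<subseteq> V \<and> arc_interior e \<inter> V = {}) \<and>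
     (\<forall>e\<in>E. \<forall>f\<in>E. e \<noteq> f \<longrightarrow>
        (\<forall>p \<in> arc_interior e \<inter> arc_interior f. properly_cross_at e f p))"

definition edges_cross :: "plane_arc \<Rightarrow> plane_arc \<Rightarrow> bool" where
  "edges_cross e f \<longleftrightarrow> arc_interior e \<inter> arc_interior f \<noteq> {}"

definition simple_topological_graph :: "complex set \<Rightarrow> plane_arc set \<Rightarrow> bool" where
  "simple_topological_graph V E \<longleftrightarrow>
     topological_graph V E \<and>
     (\<forall>e\<in>E. \<forall>f\<in>E. e \<noteq> f \<longrightarrow>
        (\<forall>p \<in> path_image e \<inter> path_image f. \<forall>q \<in> path_image e \<inter> path_image f. p = q) \<and>
        (\<forall>p \<in> path_image e \<inter> path_image f.
            p \<in> endpoints e \<inter> endpoints f \<or> properly_cross_at e f p))"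

definition complete_topological_graph :: "complex set \<Rightarrow> plane_arc set \<Rightarrow> bool" where
  "complete_topological_graph V E \<longleftrightarrow>
     topological_graph V E \<and>
     (\<forall>u\<in>V. \<forall>v\<in>V. u \<noteq> v \<longrightarrow> (\<exists>!e. e \<in> E \<and> endpoints e = {u, v}))"

definition num_edges_crossing :: "plane_arc set \<Rightarrow> plane_arc \<Rightarrow> nat" where
  "num_edges_crossing E e = card {f \<in> E. f \<noteq> e \<and> edges_cross e f}"

definition light_edge_bound :: "nat \<Rightarrow> nat \<Rightarrow> bool" where
  "light_edge_bound n k \<longleftrightarrow>
     (\<forall>V E. complete_topological_graph V E \<and> simple_topological_graph V E \<and> card V = n
        \<longrightarrow> (\<exists>e\<in>E. num_edges_crossing E e \<le> k))"

definition h :: "nat \<Rightarrow> nat" where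
  "h n = (LEAST k. light_edge_bound n k)"

lemma complete_topological_graph_finite_edges:
  assumes "complete_topological_graph V E"
  shows "finite E" and "card E \<le> 2 ^ card V"
proof -
  have V: "finite V"
    and arcs: "\<And>e. e \<in> E \<Longrightarrow> arc e \<and> endpoints e \<subseteq> V"
    and uniq: "\<And>u v. u \<in> V \<Longrightarrow> v \<in> V \<Longrightarrow> u \<noteq> v \<Longrightarrow> \<exists>!e. e \<in> E \<and> endpoints e = {u, v}"
    using assms by (auto simp: complete_topological_graph_def topological_graph_def)
  have inj: "inj_on endpoints E"
  proof (rule inj_onI)
    fix e f assume ef: "e \<in> E" "f \<in> E" "endpoints e = endpoints f"
    have ne: "pathstart e \<noteq> pathfinish e"
      using arcs[OF ef(1)] arc_distinct_ends by metis
    have "pathstart e \<in> V" "pathfinish e \<in> V"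
      using arcs[OF ef(1)] by (auto simp: endpoints_def)
    from uniq[OF this ne] have "\<exists>!g. g \<in> E \<and> endpoints g = endpoints e"
      by (simp add: endpoints_def)
    with ef show "e = f" by metis
  qed
  have sub: "endpoints ` E \<subseteq> Pow V" using arcs by blast
  show "finite E" using inj_on_finite[OF inj sub] V by simp
  show "card E \<le> 2 ^ card V"
    using card_inj_on_le[OF inj sub] V by (simp add: card_Pow)
qed

text \<open>The minimum defining \<^const>\<open>h\<close> exists, so \<^const>\<open>Least\<close> is not applied to an empty set.\<close>

lemma light_edge_bound_h:
  assumes "n \<ge> 2"
  shows "light_edge_bound n (h n)"
proof -
  have "light_edge_bound n (2 ^ n)"
    unfolding light_edge_bound_def
  proof (intro allI impI, elim conjE)
    fix V E assume G: "complete_topological_graph V E" and n: "card V = n"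
    note fin = complete_topological_graph_finite_edges[OF G]
    have "\<not> card V \<le> Suc 0" using n assms by simp
    then obtain u v where "u \<in> V" "v \<in> V" "u \<noteq> v"
      using G card_le_Suc0_iff_eq[of V]
      by (auto simp: complete_topological_graph_def topological_graph_def)
    then obtain e where e: "e \<in> E"
      using G unfolding complete_topological_graph_def by blast
    have "num_edges_crossing E e \<le> card E"
      unfolding num_edges_crossing_def by (rule card_mono[OF fin(1)]) auto
    with fin(2) n e show "\<exists>e\<in>E. num_edges_crossing E e \<le> 2 ^ n"
      by (auto intro: order_trans)
  qed
  then show ?thesis unfolding h_def by (rule LeastI)
qed

end

theory Submission
  imports Defs
begin

text \<open>
  Fix a vertex \<open>a\<close> and regard the edges at \<open>a\<close> as rays and the edges \<open>uv\<close> between the remaining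
  vertices \<open>U\<close> as spanning triangles \<open>auv\<close>, which are Jordan curves.  Each triangle defines two
  ranges on \<open>U\<close>: the vertices inside it, and the vertices whose rays start inside it.  The ray to \<open>x\<close>
  crosses \<open>uv\<close> iff \<open>x\<close> is in exactly one of them, and the parity of the number of edges among
  \<open>au\<close>, \<open>av\<close>, \<open>uv\<close> crossed by \<open>xy\<close> tells whether the triangle separates \<open>x\<close> from \<open>y\<close>.
  Counting cells of arrangements of \<open>k\<close> triangles shows that the ranges have a cubic shatter function.

  With \<open>N = |U|\<close>, Haussler's packing argument and iterative reweighting give a matching \<open>M\<close> of almost
  all of \<open>U\<close> such that \<open>O(N\<^sup>7\<^sup>/\<^sup>4)\<close> ranges separate the two vertices of a pair and every range
  separates \<open>O(N\<^sup>3\<^sup>/\<^sup>4)\<close> pairs.  If \<open>uv\<close> crosses the edge \<open>xy\<close> of a pair, then \<open>auv\<close> separates \<open>x\<close>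
  from \<open>y\<close> or exactly one of the rays to \<open>u\<close> and \<open>v\<close> crosses \<open>xy\<close>, so it suffices to find a pair
  whose edge is crossed by \<open>O(N\<^sup>3\<^sup>/\<^sup>4)\<close> rays.  Choose \<open>M\<close> to maximise the least number of rays crossing
  a pair, choose \<open>M'\<close> relative to \<open>M\<close>, and let \<open>j\<close> be a pair of \<open>M'\<close> crossed by the fewest rays.
  Almost all pairs of \<open>M\<close> whose rays cross \<open>j\<close> are crossed by nearly the same rays as \<open>j\<close>, so almost
  any two of them cross each other's rays; but if \<open>p\<close>, \<open>q\<close> have rays crossing \<open>xy\<close> and the ray to \<open>x\<close>
  crosses \<open>pq\<close>, then \<open>xy\<close> and \<open>pq\<close> cross, which is rare.  Hence few rays cross \<open>j\<close>.
\<close>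

section \<open>Haussler's packing lemma\<close>

text \<open>The exponents come from one balance, up to constants. Among \<open>N^b\<close> points
  some pair is separated by a fraction \<open>N^(-b/3)\<close> of any weighted family of ranges with
  cubic shatter function. Pairing until \<open>N^b\<close> points are left therefore allows
  \<open>N^(2-b/3)\<close> separating ranges per pair and stabbing number \<open>N^(1-b/3)\<close>,
  while the unpaired points may contribute \<open>N^b\<close> rays across an edge and hence
  \<open>N^(1+b)\<close> edges. The two costs agree at \<open>b = 3/4\<close>, where both are
  \<open>N^(7/4)\<close>.

  The cubic bound is a product: \<open>k\<close> edges with the rays to their ends cut the plane
  into \<open>O(k^2)\<close> cells for the vertices, and near the centre these rays leave
  \<open>O(k)\<close> slots for the starts.

  The obstacle is that a triangle sees crossings only modulo 2. A pair separated by few triangles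
  may still be crossed by many edges if many rays cross it, so the rays have to be bounded by a
  separate argument.\<close>

definition cube_edges :: "'a set \<Rightarrow> 'a set set \<Rightarrow> ('a \<times> 'a set) set" where
  "cube_edges T F = {(t, q). t \<in> T \<and> t \<notin> q \<and> q \<in> F \<and> insert t q \<in> F}"

lemma finite_cube_edges: "finite T \<Longrightarrow> finite F \<Longrightarrow> finite (cube_edges T F)"
  by (rule finite_subset[of _ "T \<times> F"]) (auto simp: cube_edges_def)

text \<open>\<open>cube_edges T F\<close> is the edge set of the one-inclusion graph of
  \<open>F\<close>, each edge named by its direction and its lower end, and \<open>d\<close> bounds
  the VC dimension. Split \<open>F\<close> at \<open>a\<close>: edges in direction \<open>a\<close>
  correspond to \<open>F0 \<inter> F1\<close>, all others are edges of \<open>F0\<close> or of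
  \<open>F1\<close>. Whatever \<open>F0 \<inter> F1\<close> shatters can be enlarged by
  \<open>a\<close>, so its dimension is at most \<open>d - 1\<close>, and this deficit pays for the
  edges in direction \<open>a\<close>.\<close>

lemma card_cube_edges_le:
  assumes "finite T" "F \<subseteq> Pow T" "\<And>X. X \<subseteq> T \<Longrightarrow> Pow X \<subseteq> (\<lambda>q. q \<inter> X) ` F \<Longrightarrow> card X \<le> d"
  shows "card (cube_edges T F) \<le> d * card F"
  using assms
proof (induction T arbitrary: F d rule: finite_induct)
  case empty
  then show ?case by (simp add: cube_edges_def)
next
  case (insert a T F d)
  define F0 where "F0 = {q \<in> F. a \<notin> q}"
  define F1 where "F1 = (\<lambda>q. q - {a}) ` {q \<in> F. a \<in> q}"
  have finF: "finite F"
    using insert.prems(1) insert.hyps(1) by (meson finite_Pow_iff finite_insert finite_subset)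
  have fin: "finite F0" "finite F1" using finF by (auto simp: F0_def F1_def)
  have inj1: "inj_on (\<lambda>q. q - {a}) {q \<in> F. a \<in> q}"
    by (auto simp: inj_on_def)
  have F1_iff: "q \<in> F1 \<longleftrightarrow> a \<notin> q \<and> insert a q \<in> F" for q
    unfolding F1_def by (auto simp: image_iff insert_absorb intro!: bexI[of _ "insert a q"])
  have cardF: "card F = card F0 + card F1"
  proof -
    have "F = F0 \<union> {q \<in> F. a \<in> q}" by (auto simp: F0_def)
    then have "card F = card F0 + card {q \<in> F. a \<in> q}"
      using finF by (metis (no_types, lifting) F0_def card_Un_disjoint disjoint_iff finite_Un mem_Collect_eq)
    then show ?thesis by (simp add: F1_def card_image inj1)
  qed
  have sub: "F0 \<union> F1 \<subseteq> Pow T"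
    using insert.prems(1) insert.hyps by (auto simp: F0_def F1_def)
  have IH1: "card (cube_edges T (F0 \<union> F1)) \<le> d * card (F0 \<union> F1)"
  proof (rule insert.IH[OF sub])
    fix X assume X: "X \<subseteq> T" "Pow X \<subseteq> (\<lambda>q. q \<inter> X) ` (F0 \<union> F1)"
    have "Pow X \<subseteq> (\<lambda>q. q \<inter> X) ` F"
    proof
      fix Y assume "Y \<in> Pow X"
      then obtain q where q: "q \<in> F0 \<union> F1" "Y = q \<inter> X" using X(2) by blast
      have e: "Y = insert a q \<inter> X" using X(1) insert.hyps(2) q(2) by auto
      show "Y \<in> (\<lambda>q. q \<inter> X) ` F"
      proof (cases "q \<in> F")
        case True
        then show ?thesis using q(2) by blast
      next
        case False
        then have "insert a q \<in> F" using q(1) by (simp add: F0_def F1_iff)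
        then show ?thesis using e by blast
      qed
    qed
    then show "card X \<le> d" using insert.prems(2)[of X] X(1) by auto
  qed
  have IH2: "card (cube_edges T (F0 \<inter> F1)) + card (F0 \<inter> F1) \<le> d * card (F0 \<inter> F1)"
  proof (cases "F0 \<inter> F1 = {}")
    case True
    then show ?thesis by (simp add: cube_edges_def)
  next
    case False
    have shat: "card X + 1 \<le> d" if X: "X \<subseteq> T" "Pow X \<subseteq> (\<lambda>q. q \<inter> X) ` (F0 \<inter> F1)" for X
    proof -
      have "Pow (insert a X) \<subseteq> (\<lambda>q. q \<inter> insert a X) ` F"
      proof
        fix Y assume Y: "Y \<in> Pow (insert a X)"
        then have "Y - {a} \<in> Pow X" by auto
        then obtain q where q: "q \<in> F0 \<inter> F1" "Y - {a} = q \<inter> X" using X(2) by blast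
        have "a \<notin> q" "q \<in> F" "insert a q \<in> F" using q by (auto simp: F0_def F1_iff)
        show "Y \<in> (\<lambda>q. q \<inter> insert a X) ` F"
        proof (cases "a \<in> Y")
          case True
          then have "Y = insert a q \<inter> insert a X" using q(2) by auto
          then show ?thesis using \<open>insert a q \<in> F\<close> by blast
        next
          case False
          then have "Y = q \<inter> insert a X" using q(2) \<open>a \<notin> q\<close> by auto
          then show ?thesis using \<open>q \<in> F\<close> by blast
        qed
      qed
      then have "card (insert a X) \<le> d" using insert.prems(2)[of "insert a X"] X(1) by auto
      moreover have "a \<notin> X" "finite X" using X(1) insert.hyps finite_subset by auto
      ultimately show ?thesis by simp
    qed
    have "1 \<le> d" using shat[of "{}"] False by auto
    moreover have "card (cube_edges T (F0 \<inter> F1)) \<le> (d - 1) * card (F0 \<inter> F1)"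
    proof (rule insert.IH)
      show "F0 \<inter> F1 \<subseteq> Pow T" using sub by blast
      fix X assume "X \<subseteq> T" "Pow X \<subseteq> (\<lambda>q. q \<inter> X) ` (F0 \<inter> F1)"
      from shat[OF this] show "card X \<le> d - 1" by linarith
    qed
    ultimately show ?thesis by (cases d) auto
  qed
  define A where "A = {(t, q). t \<in> T \<and> t \<notin> q \<and> q \<in> F0 \<and> insert t q \<in> F0}"
  define B where "B = {(t, q). t \<in> T \<and> t \<notin> q \<and> q \<in> F1 \<and> insert t q \<in> F1}"
  have finAB: "finite A" "finite B"
    using finite_cube_edges[OF insert.hyps(1) fin(1)] finite_cube_edges[OF insert.hyps(1) fin(2)]
    by (simp_all add: A_def B_def cube_edges_def)
  have subE: "cube_edges (insert a T) F \<subseteq> Pair a ` (F0 \<inter> F1) \<union> A \<union> (\<lambda>(t, q). (t, insert a q)) ` B"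
  proof (clarsimp simp: cube_edges_def)
    fix t q
    assume h: "t = a \<or> t \<in> T" "t \<notin> q" "q \<in> F" "insert t q \<in> F" "(t, q) \<notin> (\<lambda>(t, q). (t, insert a q)) ` B"
      "(t, q) \<notin> A"
    have ta: "t \<in> T \<Longrightarrow> t \<noteq> a" using insert.hyps(2) by auto
    show "(t, q) \<in> Pair a ` (F0 \<inter> F1)"
    proof (cases "t = a")
      case True
      then show ?thesis using h by (auto simp: F0_def F1_iff)
    next
      case False
      then have tT: "t \<in> T" using h by auto
      show ?thesis
      proof (cases "a \<in> q")
        case True
        have e: "insert a (insert t (q - {a})) = insert t q" "insert a (q - {a}) = q" using True by auto
        have "(t, q - {a}) \<in> B"
          unfolding B_def using tT h True False e by (auto simp: F1_iff)
        then have "(t, q) \<in> (\<lambda>(t, q). (t, insert a q)) ` B"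
          using e(2) by (auto simp: image_iff intro!: bexI[of _ "(t, q - {a})"])
        then show ?thesis using h by simp
      next
        case False': False
        have "(t, q) \<in> A" unfolding A_def F0_def using tT h False False' by auto
        then show ?thesis using h by simp
      qed
    qed
  qed
  have "card (cube_edges (insert a T) F) \<le> card (Pair a ` (F0 \<inter> F1)) + card A + card ((\<lambda>(t, q). (t, insert a q)) ` B)"
    using card_mono[OF _ subE] finAB fin
    by (meson card_Un_le finite_Int finite_UnI finite_imageI le_trans add_le_mono order_refl)
  also have "\<dots> \<le> card (F0 \<inter> F1) + (card A + card B)"
    using card_image_le[of "F0 \<inter> F1" "Pair a"] card_image_le[of B "\<lambda>(t, q). (t, insert a q)"] fin finAB by auto
  \<comment> \<open>An edge of \<open>F0\<close> or of \<open>F1\<close> is one of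
    \<open>F0 \<union> F1\<close>, and an edge of both is one of \<open>F0 \<inter> F1\<close>; this
    matches \<open>card F = card (F0 \<union> F1) + card (F0 \<inter> F1)\<close>.\<close>
  also have "card A + card B = card (A \<union> B) + card (A \<inter> B)"
    using finAB by (rule card_Un_Int)
  also have "\<dots> \<le> card (cube_edges T (F0 \<union> F1)) + card (cube_edges T (F0 \<inter> F1))"
    using insert.hyps(1) fin
    by (intro add_mono card_mono finite_cube_edges) (auto simp: A_def B_def cube_edges_def)
  finally have "card (cube_edges (insert a T) F) \<le> d * card (F0 \<union> F1) + d * card (F0 \<inter> F1)"
    using IH1 IH2 by linarith
  also have "\<dots> = d * card F"
    using card_Un_Int[OF fin] cardF by (simp add: distrib_left[symmetric])
  finally show ?case .
qed

text \<open>Layer-cake decomposition: at each level \<open>i\<close> the sets of weight above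
  \<open>i\<close> form a family to which the edge bound applies, and the smaller of two weights
  counts the levels at which both ends of an edge survive.\<close>

lemma sum_min_cube_le:
  fixes w :: "'a set \<Rightarrow> nat"
  assumes T: "finite T"
    and shat: "\<And>X. X \<subseteq> T \<Longrightarrow> Pow X \<subseteq> (\<lambda>q. q \<inter> X) ` {q \<in> Pow T. w q > 0} \<Longrightarrow> card X \<le> d"
  shows "(\<Sum>t\<in>T. \<Sum>q\<in>Pow (T - {t}). min (w q) (w (insert t q))) \<le> d * (\<Sum>q\<in>Pow T. w q)"
proof -
  define n where "n = (\<Sum>q\<in>Pow T. w q)"
  define F where "F i = {q \<in> Pow T. i < w q}" for i
  have finP: "finite (Pow T)" using T by simp
  have wn: "w q \<le> n" if "q \<in> Pow T" for q unfolding n_def by (rule member_le_sum) (use that finP in auto)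
  have layer: "m = (\<Sum>i<n. of_bool (i < m))" if "m \<le> n" for m
  proof -
    have "{..<n} \<inter> {i. i < m} = {..<m}" using that by auto
    then show ?thesis by (simp add: of_bool_def sum.If_cases)
  qed
  have "(\<Sum>t\<in>T. \<Sum>q\<in>Pow (T - {t}). min (w q) (w (insert t q)))
      = (\<Sum>t\<in>T. \<Sum>q\<in>Pow (T - {t}). \<Sum>i<n. of_bool (q \<in> F i \<and> insert t q \<in> F i))"
  proof (intro sum.cong refl)
    fix t q assume tq: "t \<in> T" "q \<in> Pow (T - {t})"
    then have P: "q \<in> Pow T" "insert t q \<in> Pow T" by auto
    have "min (w q) (w (insert t q)) = (\<Sum>i<n. of_bool (i < min (w q) (w (insert t q))))"
      by (rule layer) (use wn[OF P(1)] in auto)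
    also have "\<dots> = (\<Sum>i<n. of_bool (q \<in> F i \<and> insert t q \<in> F i))"
      using P by (intro sum.cong) (auto simp: F_def)
    finally show "min (w q) (w (insert t q)) = \<dots>" .
  qed
  also have "\<dots> = (\<Sum>t\<in>T. \<Sum>i<n. \<Sum>q\<in>Pow (T - {t}). of_bool (q \<in> F i \<and> insert t q \<in> F i))"
    by (intro sum.cong refl sum.swap)
  also have "\<dots> = (\<Sum>i<n. \<Sum>t\<in>T. \<Sum>q\<in>Pow (T - {t}). of_bool (q \<in> F i \<and> insert t q \<in> F i))"
    by (rule sum.swap)
  also have "\<dots> = (\<Sum>i<n. card (cube_edges T (F i)))"
  proof (intro sum.cong refl)
    fix i
    have eq: "cube_edges T (F i) = Sigma T (\<lambda>t. {q \<in> Pow (T - {t}). q \<in> F i \<and> insert t q \<in> F i})"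
      by (auto simp: cube_edges_def F_def)
    have "card (cube_edges T (F i)) = (\<Sum>t\<in>T. card {q \<in> Pow (T - {t}). q \<in> F i \<and> insert t q \<in> F i})"
      unfolding eq using T by (intro card_SigmaI) auto
    also have "\<dots> = (\<Sum>t\<in>T. \<Sum>q\<in>Pow (T - {t}). of_bool (q \<in> F i \<and> insert t q \<in> F i))"
      using T by (intro sum.cong refl) (simp add: of_bool_def sum.If_cases Int_def)
    finally show "(\<Sum>t\<in>T. \<Sum>q\<in>Pow (T - {t}). of_bool (q \<in> F i \<and> insert t q \<in> F i)) = card (cube_edges T (F i))"
      by simp
  qed
  also have "\<dots> \<le> (\<Sum>i<n. d * card (F i))"
  proof (intro sum_mono card_cube_edges_le T)
    fix i X assume X: "X \<subseteq> T" "Pow X \<subseteq> (\<lambda>q. q \<inter> X) ` F i"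
    have "F i \<subseteq> {q \<in> Pow T. w q > 0}" by (auto simp: F_def)
    from X(2) image_mono[OF this] have "Pow X \<subseteq> (\<lambda>q. q \<inter> X) ` {q \<in> Pow T. w q > 0}"
      by (rule order_trans)
    from shat[OF X(1) this] show "card X \<le> d" .
  qed (auto simp: F_def)
  also have "\<dots> = d * (\<Sum>i<n. \<Sum>q\<in>Pow T. of_bool (i < w q))"
    using finP by (simp add: F_def sum_distrib_left of_bool_def sum.If_cases Int_def)
  also have "\<dots> = d * (\<Sum>q\<in>Pow T. \<Sum>i<n. of_bool (i < w q))"
    by (subst sum.swap) simp
  also have "\<dots> = d * (\<Sum>q\<in>Pow T. w q)"
    using layer wn by (metis (no_types, lifting) sum.cong)
  finally show ?thesis .
qed

text \<open>Fubini for independent samples: the coordinate \<open>t\<close> is drawn last.\<close>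

lemma sum_PiE_insert:
  fixes F :: "('i \<Rightarrow> 'r) \<Rightarrow> 'b::comm_monoid_add"
  assumes "t \<notin> T"
  shows "(\<Sum>f\<in>PiE (insert t T) (\<lambda>_. R). F f) = (\<Sum>g\<in>PiE T (\<lambda>_. R). \<Sum>r\<in>R. F (g(t := r)))"
proof -
  have "(\<Sum>f\<in>PiE (insert t T) (\<lambda>_. R). F f) = (\<Sum>(r, g)\<in>R \<times> PiE T (\<lambda>_. R). F (g(t := r)))"
  proof (rule sum.reindex_cong)
    show "inj_on (\<lambda>(r, g). g(t := r)) (R \<times> PiE T (\<lambda>_. R))"
      using inj_combinator[OF assms] .
    show "PiE (insert t T) (\<lambda>_. R) = (\<lambda>(r, g). g(t := r)) ` (R \<times> PiE T (\<lambda>_. R))"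
      by (rule PiE_insert_eq)
  qed auto
  also have "\<dots> = (\<Sum>r\<in>R. \<Sum>g\<in>PiE T (\<lambda>_. R). F (g(t := r)))"
    by (rule sum.cartesian_product[symmetric])
  also have "\<dots> = (\<Sum>g\<in>PiE T (\<lambda>_. R). \<Sum>r\<in>R. F (g(t := r)))"
    by (rule sum.swap)
  finally show ?thesis .
qed

section \<open>Random samples of ranges and the packing bound\<close>

definition sep_weight :: "('r \<Rightarrow> 'p \<Rightarrow> bool) \<Rightarrow> 'r set \<Rightarrow> ('r \<Rightarrow> real) \<Rightarrow> 'p \<Rightarrow> 'p \<Rightarrow> real" where
  "sep_weight s R w x y = (\<Sum>r\<in>R. w r * of_bool (s r x \<noteq> s r y))"

text \<open>Double counting of separated ordered pairs: a range that splits \<open>S\<close> into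
  parts of sizes \<open>m\<close> and \<open>l\<close> separates \<open>2 * m * l\<close> of them,
  and \<open>m * l\<close> is at most \<open>card S\<close> times the smaller part.\<close>

lemma sum_min_split_ge:
  assumes S: "finite S" "S \<noteq> {}" and w: "\<And>r. r \<in> R \<Longrightarrow> 0 \<le> w r"
    and sep: "\<And>x y. x \<in> S \<Longrightarrow> y \<in> S \<Longrightarrow> x \<noteq> y \<Longrightarrow> \<delta> \<le> sep_weight s R w x y"
  shows "(real (card S) - 1) * \<delta> / 2
    \<le> (\<Sum>r\<in>R. w r * real (min (card {x \<in> S. \<not> s r x}) (card {x \<in> S. s r x})))"
proof -
  define b where "b = real (card S)"
  have b: "b > 0" using S by (simp add: b_def card_gt_0_iff)
  have two: "2 * (real (card {x \<in> S. \<not> s r x}) * real (card {x \<in> S. s r x}))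
      = (\<Sum>x\<in>S. \<Sum>y\<in>S. of_bool (s r x \<noteq> s r y))" for r
  proof -
    have 1: "(\<Sum>y\<in>S. of_bool (s r x \<noteq> s r y)) =
       (if s r x then real (card {x \<in> S. \<not> s r x}) else real (card {x \<in> S. s r x}))" for x
      using S by (simp add: of_bool_def sum.If_cases Int_def)
    have "(\<Sum>x\<in>S. \<Sum>y\<in>S. of_bool (s r x \<noteq> s r y)) =
       real (card {x \<in> S. s r x}) * real (card {x \<in> S. \<not> s r x}) + real (card {x \<in> S. \<not> s r x}) * real (card {x \<in> S. s r x})"
      unfolding 1 using S by (simp add: sum.If_cases Int_def)
    then show ?thesis by simp
  qed
  have split: "b = real (card {x \<in> S. \<not> s r x}) + real (card {x \<in> S. s r x})" for r
  proof -
    have "S = {x \<in> S. \<not> s r x} \<union> {x \<in> S. s r x}" by auto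
    then have "card S = card {x \<in> S. \<not> s r x} + card {x \<in> S. s r x}"
      using S by (subst card_Un_disjoint[symmetric]) auto
    then show ?thesis by (simp add: b_def)
  qed
  have mn: "real (card {x \<in> S. \<not> s r x}) * real (card {x \<in> S. s r x})
     \<le> b * real (min (card {x \<in> S. \<not> s r x}) (card {x \<in> S. s r x}))" for r
    unfolding split[of r] by (auto simp: min_def algebra_simps mult_mono)
  have "b * (b - 1) * \<delta> = (\<Sum>x\<in>S. \<Sum>y\<in>S - {x}. \<delta>)"
    using S b by (simp add: b_def)
  also have "\<dots> \<le> (\<Sum>x\<in>S. \<Sum>y\<in>S - {x}. sep_weight s R w x y)"
    by (intro sum_mono sep) auto
  also have "\<dots> = (\<Sum>x\<in>S. \<Sum>y\<in>S. sep_weight s R w x y)"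
    using S by (intro sum.cong refl sum.mono_neutral_left) (auto simp: sep_weight_def)
  also have "\<dots> = (\<Sum>x\<in>S. \<Sum>r\<in>R. \<Sum>y\<in>S. w r * of_bool (s r x \<noteq> s r y))"
    unfolding sep_weight_def by (intro sum.cong refl sum.swap)
  also have "\<dots> = (\<Sum>r\<in>R. \<Sum>x\<in>S. \<Sum>y\<in>S. w r * of_bool (s r x \<noteq> s r y))"
    by (rule sum.swap)
  also have "\<dots> = (\<Sum>r\<in>R. w r * (2 * (real (card {x \<in> S. \<not> s r x}) * real (card {x \<in> S. s r x}))))"
    unfolding two by (simp add: sum_distrib_left)
  also have "\<dots> \<le> (\<Sum>r\<in>R. w r * (2 * (b * real (min (card {x \<in> S. \<not> s r x}) (card {x \<in> S. s r x})))))"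
    by (intro sum_mono mult_left_mono mn w) auto
  also have "\<dots> = 2 * b * (\<Sum>r\<in>R. w r * real (min (card {x \<in> S. \<not> s r x}) (card {x \<in> S. s r x})))"
    by (simp add: sum_distrib_left mult_ac)
  finally have "b * ((b - 1) * \<delta>) \<le> b * (2 * (\<Sum>r\<in>R. w r * real (min (card {x \<in> S. \<not> s r x}) (card {x \<in> S. s r x}))))"
    by (simp add: mult_ac)
  then show ?thesis using b by (simp add: b_def)
qed

text \<open>Draw \<open>k\<close> ranges independently with distribution \<open>w\<close> and weight
  each pattern on the sample by the number of points showing it. The weighted edge bound gives at
  most \<open>d * card P\<close> for every sample. Conversely, fix all coordinates but one: the
  points fall into at most \<open>B k\<close> classes of equal pattern, and since distinct points
  are \<open>\<delta>\<close>-separated, the last range on average cuts off a proportional share of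
  each class. Summing over the \<open>k\<close> directions compares the two.\<close>

lemma separated_points_bound:
  fixes B :: "nat \<Rightarrow> nat"
  assumes R: "finite R" "\<And>r. r \<in> R \<Longrightarrow> 0 \<le> w r" "sum w R = 1"
    and P: "finite P"
    and shat: "\<And>I. I \<subseteq> R \<Longrightarrow> card ((\<lambda>x. {r \<in> I. s r x}) ` P) \<le> B (card I)"
    and B: "mono B" and d: "\<And>m. 2 ^ m \<le> B m \<Longrightarrow> m \<le> d"
    and sep: "\<And>x y. x \<in> P \<Longrightarrow> y \<in> P \<Longrightarrow> x \<noteq> y \<Longrightarrow> \<delta> \<le> sep_weight s R w x y"
    and \<delta>: "0 \<le> \<delta>"
  shows "real k * (real (card P) - real (B k)) * \<delta> \<le> 2 * real d * real (card P)"
proof -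
  define T where "T = {..<k}"
  have T: "finite T" "card T = k" by (auto simp: T_def)
  define Q where "Q I f x = {i \<in> I. s (f i) x}" for I and f :: "nat \<Rightarrow> 'a" and x
  define wt where "wt I f q = card {x \<in> P. Q I f x = q}" for I f q
  define pr where "pr I f = (\<Prod>i\<in>I. w (f i))" for I and f :: "nat \<Rightarrow> 'a"
  define W where "W f t = (\<Sum>q\<in>Pow (T - {t}). min (wt T f q) (wt T f (insert t q)))" for f t
  \<comment> \<open>A sample may repeat ranges, so the shatter bound holds for the set of sampled
    ranges and passes to the index set by monotonicity of \<open>B\<close>.\<close>
  have patterns: "card (Q I f ` P) \<le> B (card I)" if f: "f \<in> I \<rightarrow> R" and I: "finite I" for I f
  proof -
    have "Q I f ` P = (\<lambda>A. {i \<in> I. f i \<in> A}) ` ((\<lambda>x. {r \<in> f ` I. s r x}) ` P)"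
      unfolding image_image by (intro image_cong refl) (auto simp: Q_def)
    then have "card (Q I f ` P) \<le> card ((\<lambda>x. {r \<in> f ` I. s r x}) ` P)"
      using P by (simp add: card_image_le)
    also have "\<dots> \<le> B (card (f ` I))" by (rule shat) (use f in auto)
    also have "\<dots> \<le> B (card I)" using B I by (simp add: card_image_le monoD)
    finally show ?thesis .
  qed
  have Qsub: "Q I f x \<in> Pow I" for I f x by (auto simp: Q_def)
  have sum_wt: "(\<Sum>q\<in>Pow I. wt I f q) = card P" if "finite I" for I f
  proof -
    have "card P = card (\<Union>q\<in>Pow I. {x \<in> P. Q I f x = q})"
      using Qsub[of I f] by (intro arg_cong[of _ _ card]) auto
    also have "\<dots> = (\<Sum>q\<in>Pow I. wt I f q)"
      unfolding wt_def using that P by (intro card_UN_disjoint) auto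
    finally show ?thesis by simp
  qed
  have upper: "(\<Sum>t\<in>T. W f t) \<le> d * card P" if f: "f \<in> T \<rightarrow> R" for f
  proof -
    have "(\<Sum>t\<in>T. \<Sum>q\<in>Pow (T - {t}). min (wt T f q) (wt T f (insert t q))) \<le> d * (\<Sum>q\<in>Pow T. wt T f q)"
    proof (rule sum_min_cube_le[OF T(1), of "wt T f" d])
      fix X assume X: "X \<subseteq> T" "Pow X \<subseteq> (\<lambda>q. q \<inter> X) ` {q \<in> Pow T. wt T f q > 0}"
      have finX: "finite X" using finite_subset[OF X(1) T(1)] .
      have "{q \<in> Pow T. wt T f q > 0} \<subseteq> Q T f ` P"
        by (auto simp: wt_def card_gt_0_iff)
      then have "Pow X \<subseteq> (\<lambda>q. q \<inter> X) ` Q T f ` P" using X(2) by (meson image_mono order_trans)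
      also have "\<dots> = Q X f ` P" unfolding image_image using X(1) by (intro image_cong refl) (auto simp: Q_def)
      finally have "card (Pow X) \<le> card (Q X f ` P)" using P by (intro card_mono) auto
      then have "2 ^ card X \<le> B (card X)"
        using patterns[of f X] f X(1) finX by (simp add: card_Pow Pi_iff subset_iff)
      from d[OF this] show "card X \<le> d" .
    qed
    then show ?thesis by (simp add: W_def sum_wt T)
  qed
  have lower: "(real (card P) - real (B k)) * \<delta> / 2 \<le> (\<Sum>f\<in>PiE T (\<lambda>_. R). pr T f * real (W f t))" if t: "t \<in> T" for t
  proof -
    define T' where "T' = T - {t}"
    have T': "T = insert t T'" "t \<notin> T'" "finite T'" "card T' \<le> k"
      using t T by (auto simp: T'_def card_gt_0_iff)
    have inner: "(real (card P) - real (B k)) * \<delta> / 2 \<le> (\<Sum>r\<in>R. w r * real (W (g(t := r)) t))"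
      if g: "g \<in> PiE T' (\<lambda>_. R)" for g
    proof -
      define S where "S q = {x \<in> P. Q T' g x = q}" for q
      have c0: "wt T (g(t := r)) q = card {x \<in> S q. \<not> s r x}" if "q \<subseteq> T'" for q r
        unfolding wt_def S_def using that T'(2)
        by (intro arg_cong[of _ _ card]) (auto simp: Q_def T'(1) split: if_splits)
      have c1: "wt T (g(t := r)) (insert t q) = card {x \<in> S q. s r x}" if "q \<subseteq> T'" for q r
        unfolding wt_def S_def using that T'(2)
        by (intro arg_cong[of _ _ card]) (auto simp: Q_def T'(1) split: if_splits)
      have finS: "finite (S q)" for q using P by (simp add: S_def)
      \<comment> \<open>The splitting bound loses one point per class; only nonempty classes pay,
        which produces the term \<open>B k\<close>.\<close>
      have one: "(real (card (S q)) - of_bool (S q \<noteq> {})) * \<delta> / 2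
          \<le> (\<Sum>r\<in>R. w r * real (min (card {x \<in> S q. \<not> s r x}) (card {x \<in> S q. s r x})))" for q
      proof (cases "S q = {}")
        case True
        then show ?thesis by simp
      next
        case False
        then show ?thesis
          using sum_min_split_ge[where S = "S q" and R = R and w = w and \<delta> = \<delta> and s = s] finS R(2) sep
          by (simp add: S_def)
      qed
      have nonempty: "(\<Sum>q\<in>Pow T'. of_bool (S q \<noteq> {})) \<le> real (B k)"
      proof -
        have "(\<Sum>q\<in>Pow T'. of_bool (S q \<noteq> {})) = real (card {q \<in> Pow T'. S q \<noteq> {}})"
          using T' by (simp add: of_bool_def sum.If_cases Int_def)
        also have "{q \<in> Pow T'. S q \<noteq> {}} = Q T' g ` P" using Qsub[of T' g] by (auto simp: S_def)
        also have "card (Q T' g ` P) \<le> B k"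
          using patterns[of g T'] g T' B by (meson PiE_iff Pi_I le_trans monoD)
        finally show ?thesis by simp
      qed
      have "(real (card P) - real (B k)) * \<delta> / 2 \<le> ((\<Sum>q\<in>Pow T'. real (card (S q))) - (\<Sum>q\<in>Pow T'. of_bool (S q \<noteq> {}))) * \<delta> / 2"
        using nonempty sum_wt[OF T'(3), of g] \<delta>
        by (simp add: wt_def S_def mult_right_mono flip: of_nat_sum)
      also have "\<dots> = (\<Sum>q\<in>Pow T'. (real (card (S q)) - of_bool (S q \<noteq> {})) * \<delta> / 2)"
        by (simp add: sum_subtractf sum_divide_distrib sum_distrib_right left_diff_distrib diff_divide_distrib)
      also have "\<dots> \<le> (\<Sum>q\<in>Pow T'. \<Sum>r\<in>R. w r * real (min (card {x \<in> S q. \<not> s r x}) (card {x \<in> S q. s r x})))"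
        by (intro sum_mono one)
      also have "\<dots> = (\<Sum>r\<in>R. \<Sum>q\<in>Pow T'. w r * real (min (card {x \<in> S q. \<not> s r x}) (card {x \<in> S q. s r x})))"
        by (rule sum.swap)
      also have "\<dots> = (\<Sum>r\<in>R. w r * real (W (g(t := r)) t))"
        by (simp add: W_def T'_def[symmetric] c0 c1 sum_distrib_left)
      finally show ?thesis .
    qed
    have "(\<Sum>g\<in>PiE T' (\<lambda>_. R). pr T' g) = 1"
      unfolding pr_def using prod_sum_PiE[of T' "\<lambda>_. R" "\<lambda>_. w"] T' R by simp
    then have "(real (card P) - real (B k)) * \<delta> / 2 = (\<Sum>g\<in>PiE T' (\<lambda>_. R). pr T' g * ((real (card P) - real (B k)) * \<delta> / 2))"
      by (simp only: sum_distrib_right[symmetric] mult_1_left)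
    also have "\<dots> \<le> (\<Sum>g\<in>PiE T' (\<lambda>_. R). pr T' g * (\<Sum>r\<in>R. w r * real (W (g(t := r)) t)))"
      using R(2) by (intro sum_mono mult_left_mono inner) (auto simp: pr_def PiE_iff intro!: prod_nonneg)
    also have "\<dots> = (\<Sum>f\<in>PiE T (\<lambda>_. R). pr T f * real (W f t))"
      unfolding T'(1) sum_PiE_insert[OF T'(2)]
    proof (intro sum.cong refl)
      fix g
      have "pr T' (g(t := r)) = pr T' g" for r
        unfolding pr_def using T'(2) by (intro prod.cong) auto
      then show "pr T' g * (\<Sum>r\<in>R. w r * real (W (g(t := r)) t)) =
          (\<Sum>r\<in>R. pr (insert t T') (g(t := r)) * real (W (g(t := r)) t))"
        using T' by (simp add: pr_def sum_distrib_left mult_ac)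
    qed
    finally show ?thesis .
  qed
  have pr1: "(\<Sum>f\<in>PiE T (\<lambda>_. R). pr T f) = 1"
    unfolding pr_def using prod_sum_PiE[of T "\<lambda>_. R" "\<lambda>_. w"] T R by simp
  have "real k * ((real (card P) - real (B k)) * \<delta> / 2) = (\<Sum>t\<in>T. (real (card P) - real (B k)) * \<delta> / 2)"
    by (simp add: T)
  also have "\<dots> \<le> (\<Sum>t\<in>T. \<Sum>f\<in>PiE T (\<lambda>_. R). pr T f * real (W f t))"
    by (intro sum_mono lower)
  also have "\<dots> = (\<Sum>f\<in>PiE T (\<lambda>_. R). \<Sum>t\<in>T. pr T f * real (W f t))"
    by (rule sum.swap)
  also have "\<dots> = (\<Sum>f\<in>PiE T (\<lambda>_. R). pr T f * real (\<Sum>t\<in>T. W f t))"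
    by (simp add: sum_distrib_left)
  also have "\<dots> \<le> (\<Sum>f\<in>PiE T (\<lambda>_. R). pr T f * real (d * card P))"
  proof (intro sum_mono mult_left_mono)
    fix f assume f: "f \<in> PiE T (\<lambda>_. R)"
    then show "0 \<le> pr T f" using R(2) by (auto simp: pr_def PiE_iff intro!: prod_nonneg)
    show "real (\<Sum>t\<in>T. W f t) \<le> real (d * card P)"
      using upper[of f] f by (simp only: of_nat_le_iff PiE_iff Pi_iff) auto
  qed
  also have "\<dots> = real (d * card P)" using pr1 by (simp flip: sum_distrib_right)
  finally show ?thesis by (simp add: field_simps)
qed

text \<open>Otherwise all points are far apart, and a sample of about
  \<open>(N / (2 * C)) powr (1/3)\<close> ranges, so small that its patterns number at most half of
  the points, violates the packing inequality.\<close>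

lemma exists_close_pair:
  fixes C d :: nat
  assumes R: "finite R" "\<And>r. r \<in> R \<Longrightarrow> 0 \<le> w r" "sum w R = 1"
    and P: "finite P" "card P \<ge> 2"
    and shat: "\<And>I. I \<subseteq> R \<Longrightarrow> card ((\<lambda>x. {r \<in> I. s r x}) ` P) \<le> C * (card I + 1) ^ 3"
    and d: "\<And>m. 2 ^ m \<le> C * (m + 1) ^ 3 \<Longrightarrow> m \<le> d"
  shows "\<exists>x\<in>P. \<exists>y\<in>P. x \<noteq> y \<and>
    sep_weight s R w x y \<le> (12 * real d + 3) * (2 * real C) powr (1/3) * real (card P) powr (-1/3)"
proof (rule ccontr)
  define N where "N = real (card P)"
  define z where "z = (N / (2 * real C)) powr (1/3)"
  assume "\<not> ?thesis"
  then have far: "\<And>x y. x \<in> P \<Longrightarrow> y \<in> P \<Longrightarrow> x \<noteq> y \<Longrightarrow>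
      (12 * real d + 3) * (2 * real C) powr (1/3) * N powr (-1/3) < sep_weight s R w x y"
    by (auto simp: not_le N_def)
  have N: "N \<ge> 2" using P by (simp add: N_def)
  have C: "C \<ge> 1"
  proof -
    have "card ((\<lambda>x. {r \<in> {}. s r x}) ` P) \<le> C * (card ({}::'a set) + 1) ^ 3" by (rule shat) auto
    moreover have "P \<noteq> {}" using P by auto
    ultimately show ?thesis by (simp add: image_constant_conv)
  qed
  have z: "z > 0" using N C by (simp add: z_def)
  have zinv: "(2 * real C) powr (1/3) * N powr (-1/3) = 1 / z"
    using N C by (simp add: z_def powr_divide powr_minus field_simps)
  \<comment> \<open>No separation exceeds 1, so the 3 in the numerator forces \<open>z > 3\<close>,
    which makes \<open>k\<close> at least \<open>z / 3\<close>. It also makes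
    \<open>z / 3 * \<delta>\<close> equal to \<open>4 * d + 1\<close>, just above the
    \<open>4 * d\<close> that the packing inequality allows.\<close>
  define \<delta> where "\<delta> = (12 * real d + 3) / z"
  have far': "\<delta> < sep_weight s R w x y" if "x \<in> P" "y \<in> P" "x \<noteq> y" for x y
    using far[OF that] zinv by (simp add: \<delta>_def mult.assoc)
  obtain x y where xy: "x \<in> P" "y \<in> P" "x \<noteq> y"
    using P by (metis card_le_Suc0_iff_eq not_less_eq_eq numeral_2_eq_2)
  have "sep_weight s R w x y \<le> sum w R"
    unfolding sep_weight_def using R by (intro sum_mono) auto
  then have "\<delta> < 1" using far'[OF xy] R by simp
  then have "12 * real d + 3 < z" using z by (simp add: \<delta>_def)
  then have z3: "z > 3" by (smt (verit) of_nat_0_le_iff)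
  \<comment> \<open>One below the integer part of \<open>z\<close>, because the shatter bound is a
    cube of \<open>k + 1\<close>.\<close>
  define k where "k = nat \<lfloor>z\<rfloor> - 1"
  have k: "real (k + 1) \<le> z" "z / 3 \<le> real k" "k \<ge> 1"
    using z3 unfolding k_def by linarith+
  have "real (C * (k + 1) ^ 3) \<le> real C * z ^ 3"
    using k power_mono[of "real (k + 1)" z 3] by (simp add: mult_left_mono add.commute)
  also have "z ^ 3 = N / (2 * real C)"
    using N C by (simp add: z_def powr_power)
  finally have half: "real (C * (k + 1) ^ 3) \<le> N / 2" using C by simp
  have "real k * (N - real (C * (k + 1) ^ 3)) * \<delta> \<le> 2 * real d * N"
    unfolding N_def
  proof (rule separated_points_bound[where B = "\<lambda>m. C * (m + 1) ^ 3" and w = w and s = s])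
    show "mono (\<lambda>m. C * (m + 1) ^ 3)" by (intro monoI mult_le_mono power_mono) auto
    show "0 \<le> \<delta>" using z by (simp add: \<delta>_def)
  qed (use assms far' in \<open>auto intro: less_imp_le\<close>)
  moreover have "real k * (N / 2) * \<delta> \<le> real k * (N - real (C * (k + 1) ^ 3)) * \<delta>"
    using half z by (intro mult_right_mono mult_left_mono) (auto simp: \<delta>_def)
  ultimately have "real k * (N / 2) * \<delta> \<le> 2 * real d * N" by linarith
  then have "real k * \<delta> \<le> 4 * real d" using N by (simp add: field_simps)
  moreover have "z / 3 * \<delta> \<le> real k * \<delta>"
    using k z by (intro mult_right_mono) (auto simp: \<delta>_def)
  moreover have "z / 3 * \<delta> = 4 * real d + 1" using z by (simp add: \<delta>_def)
  ultimately show False by linarith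
qed

section \<open>Matchings of low stabbing number\<close>

definition pair_set :: "'p \<times> 'p \<Rightarrow> 'p set" where
  "pair_set i = {fst i, snd i}"

definition matching_on :: "'p set \<Rightarrow> ('p \<times> 'p) set \<Rightarrow> bool" where
  "matching_on U M \<longleftrightarrow> M \<subseteq> U \<times> U \<and> (\<forall>i\<in>M. fst i \<noteq> snd i) \<and>
     (\<forall>i\<in>M. \<forall>j\<in>M. i \<noteq> j \<longrightarrow> pair_set i \<inter> pair_set j = {})"

definition stabbing :: "('r \<Rightarrow> 'p \<Rightarrow> bool) \<Rightarrow> ('p \<times> 'p) set \<Rightarrow> 'r \<Rightarrow> nat" where
  "stabbing s M r = card {i \<in> M. s r (fst i) \<noteq> s r (snd i)}"

lemma matching_on_finite: "finite U \<Longrightarrow> matching_on U M \<Longrightarrow> finite M"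
  unfolding matching_on_def by (meson finite_SigmaI finite_subset)

lemma matching_on_choice_inj:
  assumes "matching_on U M" "\<And>i. i \<in> M \<Longrightarrow> g i \<in> pair_set i"
  shows "inj_on g M"
proof (rule inj_onI)
  fix i j assume "i \<in> M" "j \<in> M" "g i = g j"
  then have "g i \<in> pair_set i \<inter> pair_set j" using assms(2)[of i] assms(2)[of j] by auto
  then show "i = j" using assms(1) \<open>i \<in> M\<close> \<open>j \<in> M\<close> unfolding matching_on_def by blast
qed

lemma matching_on_card_le:
  assumes "finite U" "matching_on U M" shows "card M \<le> card U"
proof (rule card_inj_on_le)
  show "inj_on fst M" using matching_on_choice_inj[OF assms(2)] by (auto simp: pair_set_def)
qed (use assms in \<open>auto simp: matching_on_def\<close>)

lemma sep_weight_mix: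
  "sep_weight s R (\<lambda>r. (w1 r + w2 r + w3 r) / 3) x y =
    (sep_weight s R w1 x y + sep_weight s R w2 x y + sep_weight s R w3 x y) / 3"
  unfolding sep_weight_def sum.distrib[symmetric] sum_divide_distrib
  by (intro sum.cong refl) (simp add: algebra_simps)

lemma sep_weight_nonneg: "(\<And>r. r \<in> R \<Longrightarrow> 0 \<le> w r) \<Longrightarrow> 0 \<le> sep_weight s R w x y"
  unfolding sep_weight_def by (intro sum_nonneg) auto

text \<open>Each range carries the weight \<open>2 ^ stabbing\<close> when the next pair is chosen, so that no range
  can separate many pairs of the matching.\<close>

lemma exists_low_stabbing_matching:
  fixes s :: "'r \<Rightarrow> 'p \<Rightarrow> bool"
  assumes R: "finite R" "R \<noteq> {}" and U: "finite U"
    and w1: "\<And>r. r \<in> R \<Longrightarrow> 0 \<le> w1 r" "sum w1 R = 1"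
    and w2: "\<And>r. r \<in> R \<Longrightarrow> 0 \<le> w2 r" "sum w2 R = 1"
    and close: "\<And>P w. P \<subseteq> U \<Longrightarrow> d0 \<le> card P \<Longrightarrow> (\<And>r. r \<in> R \<Longrightarrow> 0 \<le> w r) \<Longrightarrow> sum w R = 1 \<Longrightarrow>
       \<exists>x\<in>P. \<exists>y\<in>P. x \<noteq> y \<and> sep_weight s R w x y \<le> \<epsilon>"
  shows "\<exists>M. matching_on U M \<and> card (U - \<Union>(pair_set ` M)) < d0 \<and>
    (\<forall>i\<in>M. sep_weight s R w1 (fst i) (snd i) \<le> 3 * \<epsilon> \<and> sep_weight s R w2 (fst i) (snd i) \<le> 3 * \<epsilon>) \<and>
    (\<Sum>r\<in>R. 2 ^ stabbing s M r) \<le> real (card R) * (1 + 3 * \<epsilon>) ^ card M"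
proof -
  define good where "good M \<longleftrightarrow> matching_on U M \<and>
    (\<forall>i\<in>M. sep_weight s R w1 (fst i) (snd i) \<le> 3 * \<epsilon> \<and> sep_weight s R w2 (fst i) (snd i) \<le> 3 * \<epsilon>) \<and>
    (\<Sum>r\<in>R. 2 ^ stabbing s M r) \<le> real (card R) * (1 + 3 * \<epsilon>) ^ card M" for M
  have "good {}" by (simp add: good_def matching_on_def stabbing_def)
  moreover have "card M < Suc (card U)" if "good M" for M
    using matching_on_card_le[OF U, of M] that by (auto simp: good_def)
  ultimately obtain M where M: "good M" and max: "\<And>M'. good M' \<Longrightarrow> card M' \<le> card M"
    using ex_has_greatest_nat[of good "{}" card "Suc (card U)"] by (metis less_imp_le)
  have match: "matching_on U M" using M by (simp add: good_def)
  have finM: "finite M" using matching_on_finite[OF U match] .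
  define P where "P = U - \<Union>(pair_set ` M)"
  have "card P < d0"
  proof (rule ccontr)
    assume "\<not> card P < d0"
    then have P: "d0 \<le> card P" "P \<subseteq> U" by (auto simp: P_def)
    define S where "S = (\<Sum>r\<in>R. 2 ^ stabbing s M r :: real)"
    have S: "S > 0" unfolding S_def using R by (intro sum_pos) auto
    define w3 where "w3 r = 2 ^ stabbing s M r / S" for r
    \<comment> \<open>A pair close for the average of three weights is close for each of them at the
      cost of a factor 3: \<open>w1\<close> and \<open>w2\<close> are prescribed, \<open>w3\<close>
      is the normalised exponential weight.\<close>
    define w where "w r = (w1 r + w2 r + w3 r) / 3" for r
    have w3: "0 \<le> w3 r" "sum w3 R = 1" for r
      using S by (auto simp: w3_def S_def simp flip: sum_divide_distrib)
    have w: "\<And>r. r \<in> R \<Longrightarrow> 0 \<le> w r" using w1 w2 w3 by (auto simp: w_def)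
    have "sum w R = 1"
      using w1 w2 w3 by (simp add: w_def sum.distrib flip: sum_divide_distrib)
    from close[OF P(2,1) w this]
    obtain x y where xy: "x \<in> P" "y \<in> P" "x \<noteq> y" "sep_weight s R w x y \<le> \<epsilon>"
      by auto
    have nonneg: "0 \<le> sep_weight s R w1 x y" "0 \<le> sep_weight s R w2 x y" "0 \<le> sep_weight s R w3 x y"
      using w1 w2 w3 by (auto intro!: sep_weight_nonneg)
    have "sep_weight s R w1 x y + sep_weight s R w2 x y + sep_weight s R w3 x y \<le> 3 * \<epsilon>"
      using xy(4) unfolding w_def sep_weight_mix by simp
    then have sep: "sep_weight s R w1 x y \<le> 3 * \<epsilon>" "sep_weight s R w2 x y \<le> 3 * \<epsilon>" "sep_weight s R w3 x y \<le> 3 * \<epsilon>"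
      using nonneg by linarith+
    have notin: "(x, y) \<notin> M" using xy(1) by (auto simp: P_def pair_set_def)
    have new: "pair_set i \<inter> pair_set (x, y) = {}" if "i \<in> M" for i
    proof -
      have "pair_set i \<inter> P = {}" using that by (auto simp: P_def)
      then show ?thesis using xy by (auto simp: pair_set_def)
    qed
    have "matching_on U (insert (x, y) M)"
      unfolding matching_on_def
    proof (intro conjI ballI impI)
      show "insert (x, y) M \<subseteq> U \<times> U" using match xy P(2) by (auto simp: matching_on_def)
      fix i assume i: "i \<in> insert (x, y) M"
      then show "fst i \<noteq> snd i" using match xy by (auto simp: matching_on_def)
      fix j assume j: "j \<in> insert (x, y) M" "i \<noteq> j"
      show "pair_set i \<inter> pair_set j = {}"
      proof (cases "i \<in> M \<and> j \<in> M")
        case True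
        then show ?thesis using match j by (simp add: matching_on_def)
      next
        case False
        then show ?thesis using i j new[of i] new[of j] by (metis Int_commute insertE)
      qed
    qed
    moreover have "(\<Sum>r\<in>R. 2 ^ stabbing s (insert (x, y) M) r) \<le> real (card R) * (1 + 3 * \<epsilon>) ^ card (insert (x, y) M)"
    proof -
      have st: "stabbing s (insert (x, y) M) r = stabbing s M r + of_bool (s r x \<noteq> s r y)" for r
      proof (cases "s r x \<noteq> s r y")
        case True
        then have "{i \<in> insert (x, y) M. s r (fst i) \<noteq> s r (snd i)} = insert (x, y) {i \<in> M. s r (fst i) \<noteq> s r (snd i)}"
          by auto
        then show ?thesis using True finM notin by (simp add: stabbing_def)
      next
        case False
        then have "{i \<in> insert (x, y) M. s r (fst i) \<noteq> s r (snd i)} = {i \<in> M. s r (fst i) \<noteq> s r (snd i)}"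
          by auto
        then show ?thesis using False by (simp add: stabbing_def)
      qed
      \<comment> \<open>The new pair doubles the weight of exactly the ranges that separate it, so
        the total grows by the factor \<open>1 + sep_weight s R w3 x y\<close>.\<close>
      have "(\<Sum>r\<in>R. 2 ^ stabbing s (insert (x, y) M) r) = (\<Sum>r\<in>R. S * (w3 r + w3 r * of_bool (s r x \<noteq> s r y)))"
        using S by (intro sum.cong refl) (auto simp: st w3_def)
      also have "\<dots> = S * (1 + sep_weight s R w3 x y)"
        unfolding sum_distrib_left[symmetric] sum.distrib w3(2) sep_weight_def ..
      also have "\<dots> \<le> S * (1 + 3 * \<epsilon>)" using sep S by (intro mult_left_mono) auto
      also have "\<dots> \<le> (real (card R) * (1 + 3 * \<epsilon>) ^ card M) * (1 + 3 * \<epsilon>)"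
        using M sep nonneg unfolding good_def S_def by (intro mult_right_mono) linarith+
      finally show ?thesis using finM notin by (simp add: mult_ac)
    qed
    ultimately have "good (insert (x, y) M)" using M sep by (auto simp: good_def)
    then show False using max[of "insert (x, y) M"] finM notin by simp
  qed
  then have c: "card (U - \<Union>(pair_set ` M)) < d0" unfolding P_def .
  note m = M[unfolded good_def]
  show ?thesis
    by (intro exI[of _ M] conjI c m[THEN conjunct1] m[THEN conjunct2, THEN conjunct1]
        m[THEN conjunct2, THEN conjunct2])
qed

section \<open>Star systems\<close>

text \<open>
  The abstract record of a drawing with respect to the star at a fixed vertex: \<open>U\<close> is the set of the
  other vertices, \<open>inn u v x\<close> and \<open>st u v x\<close> tell whether the vertex \<open>x\<close> and the beginning of the ray
  to \<open>x\<close> lie inside the triangle spanned by the star centre and \<open>u\<close>, \<open>v\<close>, \<open>c x u v\<close> tells whether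
  the ray to \<open>x\<close> crosses the edge \<open>uv\<close>, and \<open>cr u v x y\<close> whether the edges \<open>uv\<close> and \<open>xy\<close> cross.
\<close>

locale star_system =
  fixes U :: "'p set" and inn st c :: "'p \<Rightarrow> 'p \<Rightarrow> 'p \<Rightarrow> bool"
    and cr :: "'p \<Rightarrow> 'p \<Rightarrow> 'p \<Rightarrow> 'p \<Rightarrow> bool" and C d :: nat
  assumes finU: "finite U"
    and c_sym: "c x u v = c x v u"
    and cr_sym: "cr u v x y = cr x y u v" "cr u v x y = cr u v y x"
    and ray_parity: "\<lbrakk>u \<in> U; v \<in> U; x \<in> U; distinct [u, v, x]\<rbrakk> \<Longrightarrow> c x u v = (st u v x \<noteq> inn u v x)"
    and edge_parity: "\<lbrakk>u \<in> U; v \<in> U; x \<in> U; y \<in> U; distinct [u, v, x, y]\<rbrakk> \<Longrightarrow>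
       (inn u v x \<noteq> inn u v y) = (c u x y \<noteq> (c v x y \<noteq> cr u v x y))"
    and ray_side: "\<lbrakk>x \<in> U; y \<in> U; p \<in> U; q \<in> U; u \<in> U; distinct [x, y, p, q, u]; c u p q; \<not> c u x y;
       \<not> c x p q; \<not> c y p q; \<not> cr x y p q\<rbrakk> \<Longrightarrow> inn x y u = inn x y p"
    and mutual_crossing: "\<lbrakk>x \<in> U; y \<in> U; p \<in> U; q \<in> U; distinct [x, y, p, q]; c p x y; c q x y; c x p q\<rbrakk>
       \<Longrightarrow> cr x y p q"
    and shatter: "\<And>J. finite J \<Longrightarrow> J \<subseteq> {(u, v). u \<in> U \<and> v \<in> U \<and> u \<noteq> v} \<Longrightarrow>
       card ((\<lambda>x. ({(u, v) \<in> J. inn u v x}, {(u, v) \<in> J. st u v x})) ` U) \<le> C * (card J + 1) ^ 3"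
    and growth: "\<And>m. 2 ^ m \<le> C * (m + 1) ^ 3 \<Longrightarrow> m \<le> d"
begin

definition N :: real where "N = real (card U)"
text \<open>The number of points at which pairing stops: among at least \<open>L\<close> points the
  closest pair is at distance at most \<open>c0 * L powr (-1/3)\<close>, and this is
  \<open>\<epsilon>\<close>.\<close>

definition L :: real where "L = N powr (3/4)"
definition c0 :: real where "c0 = (12 * real d + 3) * (2 * real C) powr (1/3)"
definition \<epsilon> :: real where "\<epsilon> = c0 * N powr (-1/4)"
definition d0 :: nat where "d0 = nat \<lceil>L\<rceil>"

definition offdiag :: "('p \<times> 'p) set" where
  "offdiag = {(u, v). u \<in> U \<and> v \<in> U \<and> u \<noteq> v}"

text \<open>Vertices inside and starts inside are ranges of one family, so that a single matching
  controls both. A triangle is indexed by both orders of its pair, as \<open>inn\<close> and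
  \<open>st\<close> carry no symmetry here.\<close>

definition Rng :: "(bool \<times> 'p \<times> 'p) set" where
  "Rng = UNIV \<times> offdiag"

definition sgn :: "bool \<times> 'p \<times> 'p \<Rightarrow> 'p \<Rightarrow> bool" where
  "sgn r x = (if fst r then inn (fst (snd r)) (snd (snd r)) x else st (fst (snd r)) (snd (snd r)) x)"

definition A :: "'p \<times> 'p \<Rightarrow> 'p set" where
  "A j = {u \<in> U. u \<noteq> fst j \<and> u \<noteq> snd j \<and> c u (fst j) (snd j)}"

lemma finR: "finite Rng"
proof -
  have "offdiag \<subseteq> U \<times> U" by (auto simp: offdiag_def)
  then have "finite offdiag" using finU by (meson finite_SigmaI finite_subset)
  then show ?thesis by (simp add: Rng_def)
qed

lemma card_Rng_le: "real (card Rng) \<le> 2 * N\<^sup>2"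
proof -
  have "offdiag \<subseteq> U \<times> U" by (auto simp: offdiag_def)
  then have "card offdiag \<le> card U * card U"
    using finU by (metis card_cartesian_product card_mono finite_SigmaI)
  then have "card Rng \<le> 2 * (card U * card U)" by (simp add: Rng_def card_cartesian_product)
  then have "real (card Rng) \<le> real (2 * (card U * card U))" by (rule of_nat_mono)
  then show ?thesis by (simp add: N_def power2_eq_square)
qed

lemma finA: "finite (A j)" using finU by (simp add: A_def)

lemma c0_nonneg: "c0 \<ge> 0" by (simp add: c0_def)

text \<open>The pattern of a point on \<open>I\<close> is a function of its two patterns on the
  triangles underlying \<open>I\<close>, and there are at most \<open>card I\<close> of
  these.\<close>

lemma shatter_Rng:
  assumes "P \<subseteq> U" "I \<subseteq> Rng"
  shows "card ((\<lambda>x. {r \<in> I. sgn r x}) ` P) \<le> C * (card I + 1) ^ 3"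
proof -
  define J where "J = snd ` I"
  have finI: "finite I" using finite_subset[OF assms(2) finR] .
  then have J: "finite J" "J \<subseteq> {(u, v). u \<in> U \<and> v \<in> U \<and> u \<noteq> v}" "card J \<le> card I"
    using assms(2) by (auto simp: J_def Rng_def offdiag_def card_image_le)
  define f where "f = (\<lambda>(X, Y). {r \<in> I. if fst r then snd r \<in> X else snd r \<in> Y})"
  define g where "g x = ({(u, v) \<in> J. inn u v x}, {(u, v) \<in> J. st u v x})" for x
  have "sgn r x = (if fst r then snd r \<in> fst (g x) else snd r \<in> snd (g x))" if "r \<in> I" for r x
  proof -
    have "snd r \<in> J" using that by (simp add: J_def)
    then show ?thesis by (cases r) (auto simp: sgn_def g_def)
  qed
  then have "{r \<in> I. sgn r x} = f (g x)" for x
    by (auto simp: f_def split_beta)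
  then have "(\<lambda>x. {r \<in> I. sgn r x}) ` P \<subseteq> f ` g ` U" using assms(1) by auto
  then have "card ((\<lambda>x. {r \<in> I. sgn r x}) ` P) \<le> card (f ` g ` U)"
    using finU by (intro card_mono) auto
  also have "\<dots> \<le> card (g ` U)" using finU by (intro card_image_le) auto
  also have "\<dots> \<le> C * (card J + 1) ^ 3" unfolding g_def by (rule shatter[OF J(1,2)])
  also have "\<dots> \<le> C * (card I + 1) ^ 3" using J(3) by (intro mult_le_mono power_mono) auto
  finally show ?thesis .
qed

text \<open>The 6 is the factor 3 from mixing weights times the 2 in
  \<open>card Rng \<le> 2 * N\<^sup>2\<close>. The last bound is what the total exponential weight
  yields after taking logarithms.\<close>

definition good_matching :: "('p \<times> 'p) set \<Rightarrow> bool" where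
  "good_matching M \<longleftrightarrow> matching_on U M \<and> card (U - \<Union>(pair_set ` M)) < d0 \<and>
     (\<forall>i\<in>M. real (card {r \<in> Rng. sgn r (fst i) \<noteq> sgn r (snd i)}) \<le> 6 * \<epsilon> * N\<^sup>2) \<and>
     (\<forall>r\<in>Rng. real (stabbing sgn M r) \<le> 5 * L + 5 * c0 * L)"

context
  assumes N4: "N \<ge> 4"
begin

lemma N_pos: "N > 0" using N4 by linarith

lemma L_ge1: "L \<ge> 1" using N4 by (simp add: L_def ge_one_powr_ge_zero)

lemma L_le_N: "L \<le> N" unfolding L_def using N4 powr_mono[of "3/4" 1 N] by simp

lemma eps_N: "\<epsilon> * N = c0 * L"
proof -
  have "N powr (-1/4) * N = N powr (3/4)"
    using N_pos powr_add[of N "-1/4" 1] by simp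
  then show ?thesis by (simp add: \<epsilon>_def L_def mult.assoc)
qed

lemma eps_nonneg: "\<epsilon> \<ge> 0" by (simp add: \<epsilon>_def c0_nonneg)

lemma d0_ge2: "d0 \<ge> 2"
proof -
  have "(2::real) \<le> 4 powr (3/4)"
  proof -
    have "(2::real) = 4 powr (1/2)" by (simp add: powr_half_sqrt)
    also have "\<dots> \<le> 4 powr (3/4)" by (rule powr_mono) auto
    finally show ?thesis .
  qed
  also have "\<dots> \<le> L" unfolding L_def using N4 by (intro powr_mono2) auto
  finally show ?thesis unfolding d0_def by linarith
qed

lemma d0_le: "real d0 \<le> 2 * L" using L_ge1 unfolding d0_def by linarith

lemma close_pair:
  assumes P: "P \<subseteq> U" "d0 \<le> card P" and w: "\<And>r. r \<in> Rng \<Longrightarrow> 0 \<le> w r" "sum w Rng = 1"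
  shows "\<exists>x\<in>P. \<exists>y\<in>P. x \<noteq> y \<and> sep_weight sgn Rng w x y \<le> \<epsilon>"
proof -
  have "\<exists>x\<in>P. \<exists>y\<in>P. x \<noteq> y \<and>
    sep_weight sgn Rng w x y \<le> (12 * real d + 3) * (2 * real C) powr (1/3) * real (card P) powr (-1/3)"
  proof (rule exists_close_pair[OF finR w])
    show "finite P" using P(1) finU by (rule finite_subset)
    show "2 \<le> card P" using P(2) d0_ge2 by linarith
  qed (use shatter_Rng[OF P(1)] growth in auto)
  moreover have "c0 * real (card P) powr (-1/3) \<le> \<epsilon>"
  proof -
    have "L \<le> real (card P)" using P(2) unfolding d0_def by linarith
    then have "real (card P) powr (-1/3) \<le> L powr (-1/3)"
      using L_ge1 by (intro powr_mono2') auto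
    also have "\<dots> = N powr (-1/4)" by (simp add: L_def powr_powr)
    finally show ?thesis using c0_nonneg by (simp add: \<epsilon>_def mult_left_mono)
  qed
  ultimately show ?thesis unfolding c0_def by fastforce
qed

lemma Rng_nonempty: "Rng \<noteq> {}"
proof -
  have "\<not> card U \<le> Suc 0" using N4 by (simp add: N_def)
  then obtain u v where "u \<in> U" "v \<in> U" "u \<noteq> v" using card_le_Suc0_iff_eq[OF finU] by auto
  then show ?thesis by (auto simp: Rng_def offdiag_def)
qed

text \<open>The weight of one range is at most the total weight, hence at most
  \<open>2 * N\<^sup>2 * exp (3 * c0 * L)\<close>. Its logarithm is of order \<open>L\<close>,
  because \<open>ln N\<close> is bounded by a multiple of \<open>ln L \<le> L - 1\<close>.\<close>

lemma stabbing_bound: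
  assumes "finite M" "card M \<le> card U" "(\<Sum>r\<in>Rng. 2 ^ stabbing sgn M r) \<le> real (card Rng) * (1 + 3 * \<epsilon>) ^ card M"
    and r: "r \<in> Rng"
  shows "real (stabbing sgn M r) \<le> 5 * L + 5 * c0 * L"
proof -
  define k where "k = real (stabbing sgn M r)"
  have "2 ^ stabbing sgn M r \<le> (\<Sum>r\<in>Rng. 2 ^ stabbing sgn M r :: real)"
    by (rule member_le_sum[OF r]) (use finR in auto)
  also have "\<dots> \<le> real (card Rng) * (1 + 3 * \<epsilon>) ^ card M" by fact
  also have "\<dots> \<le> 2 * N\<^sup>2 * exp (3 * c0 * L)"
  proof (rule mult_mono)
    show "real (card Rng) \<le> 2 * N\<^sup>2" by (rule card_Rng_le)
    have "(1 + 3 * \<epsilon>) ^ card M \<le> exp (3 * \<epsilon>) ^ card M"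
      using eps_nonneg by (intro power_mono exp_ge_add_one_self) auto
    also have "\<dots> = exp (real (card M) * (3 * \<epsilon>))" by (simp add: exp_of_nat_mult)
    also have "\<dots> \<le> exp (N * (3 * \<epsilon>))"
      using assms(2) eps_nonneg by (simp add: N_def mult_right_mono)
    also have "N * (3 * \<epsilon>) = 3 * c0 * L" using eps_N by (simp add: mult_ac)
    finally show "(1 + 3 * \<epsilon>) ^ card M \<le> exp (3 * c0 * L)" .
  qed (use eps_nonneg in auto)
  finally have "ln (2 ^ stabbing sgn M r) \<le> ln (2 * N\<^sup>2 * exp (3 * c0 * L))"
    using N_pos by (subst ln_le_cancel_iff) auto
  then have "k * ln 2 \<le> ln 2 + 2 * ln N + 3 * c0 * L"
    using N_pos by (simp add: k_def ln_realpow ln_mult)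
  moreover have "ln N \<le> 4/3 * L - 4/3"
  proof -
    have "ln L \<le> L - 1" using L_ge1 by (intro ln_le_minus_one) auto
    moreover have "ln L = 3/4 * ln N" using N_pos by (simp add: L_def ln_powr)
    ultimately show ?thesis by simp
  qed
  ultimately have "k * ln 2 \<le> ln 2 + 8/3 * L - 8/3 + 3 * c0 * L" by linarith
  moreover have ln2: "ln 2 \<ge> (2/3::real)" "ln 2 \<le> (1::real)"
    using ln2_ge_two_thirds ln_le_minus_one[of 2] by auto
  ultimately have "k * ln 2 \<le> 8/3 * L + 3 * c0 * L" by linarith
  moreover have "k * (2/3) \<le> k * ln 2" using ln2 by (intro mult_left_mono) (auto simp: k_def)
  ultimately have "k \<le> 4 * L + 9/2 * (c0 * L)" by linarith
  moreover have "0 \<le> c0 * L" using c0_nonneg L_ge1 by simp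
  ultimately show ?thesis using L_ge1 by (simp add: k_def)
qed

lemma exists_good_matching:
  assumes w2: "\<And>r. r \<in> Rng \<Longrightarrow> 0 \<le> w2 r" "sum w2 Rng = 1"
  shows "\<exists>M. good_matching M \<and> (\<forall>i\<in>M. sep_weight sgn Rng w2 (fst i) (snd i) \<le> 3 * \<epsilon>)"
proof -
  define w1 where "w1 = (\<lambda>_::bool \<times> 'p \<times> 'p. 1 / real (card Rng))"
  have cR: "real (card Rng) > 0" using finR Rng_nonempty by (simp add: card_gt_0_iff)
  obtain M where M: "matching_on U M" "card (U - \<Union>(pair_set ` M)) < d0"
    "\<forall>i\<in>M. sep_weight sgn Rng w1 (fst i) (snd i) \<le> 3 * \<epsilon> \<and> sep_weight sgn Rng w2 (fst i) (snd i) \<le> 3 * \<epsilon>"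
    "(\<Sum>r\<in>Rng. 2 ^ stabbing sgn M r) \<le> real (card Rng) * (1 + 3 * \<epsilon>) ^ card M"
    using exists_low_stabbing_matching[OF finR Rng_nonempty finU, of w1 w2 d0 sgn \<epsilon>] close_pair w2 cR
    by (auto simp: w1_def)
  have "real (card {r \<in> Rng. sgn r (fst i) \<noteq> sgn r (snd i)}) \<le> 6 * \<epsilon> * N\<^sup>2" if "i \<in> M" for i
  proof -
    have "sep_weight sgn Rng w1 (fst i) (snd i) = real (card {r \<in> Rng. sgn r (fst i) \<noteq> sgn r (snd i)}) / real (card Rng)"
      using finR by (simp add: sep_weight_def w1_def of_bool_def sum.If_cases Int_def flip: sum_divide_distrib)
    then have "real (card {r \<in> Rng. sgn r (fst i) \<noteq> sgn r (snd i)}) \<le> 3 * \<epsilon> * real (card Rng)"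
      using M(3) that cR by (auto simp: pos_divide_le_eq)
    also have "\<dots> \<le> 3 * \<epsilon> * (2 * N\<^sup>2)"
      using card_Rng_le eps_nonneg by (intro mult_left_mono) auto
    finally show ?thesis by simp
  qed
  moreover have "\<forall>r\<in>Rng. real (stabbing sgn M r) \<le> 5 * L + 5 * c0 * L"
    using stabbing_bound[OF matching_on_finite[OF finU M(1)] matching_on_card_le[OF finU M(1)] M(4)] by blast
  ultimately have "good_matching M" using M(1,2) by (simp add: good_matching_def)
  then show ?thesis using M(3) by blast
qed

lemma matching_on_nonempty: assumes "good_matching M" shows "M \<noteq> {}"
proof
  assume "M = {}"
  then have "card U < d0" using assms by (simp add: good_matching_def)
  then have "N < L" unfolding d0_def N_def by linarith
  then show False using L_le_N by simp
qed

text \<open>The second prescribed weight is uniform on the ranges indexed by pairs of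
  \<open>M\<close>; closeness for it says that few triangles over pairs of \<open>M\<close> separate
  the two ends of a pair of \<open>M'\<close>.\<close>

lemma exists_relative_matching:
  assumes M: "good_matching M"
  shows "\<exists>M'. good_matching M' \<and>
    (\<forall>j\<in>M'. real (card {i \<in> M. \<exists>b. sgn (b, i) (fst j) \<noteq> sgn (b, i) (snd j)}) \<le> 6 * c0 * L)"
proof -
  have match: "matching_on U M" using M by (simp add: good_matching_def)
  have finM: "finite M" and cM: "card M \<le> card U" "card M > 0"
    using matching_on_finite[OF finU match] matching_on_card_le[OF finU match] matching_on_nonempty[OF M]
    by (auto simp: card_gt_0_iff)
  have sub: "M \<subseteq> offdiag" using match by (auto simp: matching_on_def offdiag_def)
  define w2 where "w2 = (\<lambda>r::bool \<times> 'p \<times> 'p. of_bool (snd r \<in> M) / (2 * real (card M)))"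
  have eq: "{r \<in> Rng. snd r \<in> M} = UNIV \<times> M" using sub by (auto simp: Rng_def)
  have "sum w2 Rng = real (card {r \<in> Rng. snd r \<in> M}) / (2 * real (card M))"
    using finR by (simp add: w2_def of_bool_def sum.If_cases Int_def flip: sum_divide_distrib)
  also have "\<dots> = 1" using cM by (simp add: eq card_cartesian_product)
  finally have "sum w2 Rng = 1" .
  moreover have "0 \<le> w2 r" for r by (simp add: w2_def)
  ultimately obtain M' where M': "good_matching M'" "\<forall>j\<in>M'. sep_weight sgn Rng w2 (fst j) (snd j) \<le> 3 * \<epsilon>"
    using exists_good_matching[of w2] by blast
  have "real (card {i \<in> M. \<exists>b. sgn (b, i) (fst j) \<noteq> sgn (b, i) (snd j)}) \<le> 6 * c0 * L" if j: "j \<in> M'" for j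
  proof -
    define S where "S = {r \<in> UNIV \<times> M. sgn r (fst j) \<noteq> sgn r (snd j)}"
    have finS: "finite S" using finM by (simp add: S_def)
    have "{i \<in> M. \<exists>b. sgn (b, i) (fst j) \<noteq> sgn (b, i) (snd j)} = snd ` S"
      by (force simp: S_def image_iff)
    then have "card {i \<in> M. \<exists>b. sgn (b, i) (fst j) \<noteq> sgn (b, i) (snd j)} \<le> card S"
      using finS by (simp add: card_image_le)
    moreover have "sep_weight sgn Rng w2 (fst j) (snd j) = real (card S) / (2 * real (card M))"
    proof -
      have "sep_weight sgn Rng w2 (fst j) (snd j) = (\<Sum>r\<in>Rng. of_bool (r \<in> S) / (2 * real (card M)))"
        unfolding sep_weight_def w2_def S_def by (intro sum.cong refl) auto
      also have "\<dots> = real (card (Rng \<inter> S)) / (2 * real (card M))"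
        using finR by (simp add: of_bool_def sum.If_cases flip: sum_divide_distrib)
      also have "Rng \<inter> S = S" using eq by (auto simp: S_def)
      finally show ?thesis .
    qed
    then have "real (card S) \<le> 3 * \<epsilon> * (2 * real (card M))"
      using M'(2) j cM by (auto simp: pos_divide_le_eq)
    moreover have "3 * \<epsilon> * (2 * real (card M)) \<le> 3 * \<epsilon> * (2 * N)"
      using cM eps_nonneg by (intro mult_left_mono) (auto simp: N_def)
    ultimately show ?thesis using eps_N by (simp add: algebra_simps)
  qed
  then show ?thesis using M'(1) by blast
qed

text \<open>Modulo 2 both sides equal the sum of the four ray crossings and of
  \<open>cr u v x y\<close>, an expression symmetric in the two pairs.\<close>

lemma st_sym:
  assumes "u \<in> U" "v \<in> U" "x \<in> U" "y \<in> U" "distinct [u, v, x, y]"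
  shows "(st u v x \<noteq> st u v y) = (st x y u \<noteq> st x y v)"
proof -
  have "c x u v = (st u v x \<noteq> inn u v x)" "c y u v = (st u v y \<noteq> inn u v y)"
    "c u x y = (st x y u \<noteq> inn x y u)" "c v x y = (st x y v \<noteq> inn x y v)"
    by (rule ray_parity; use assms in auto)+
  moreover have "(inn u v x \<noteq> inn u v y) = (c u x y \<noteq> (c v x y \<noteq> cr u v x y))"
    by (rule edge_parity) (use assms in auto)
  moreover have "(inn x y u \<noteq> inn x y v) = (c x u v \<noteq> (c y u v \<noteq> cr x y u v))"
    by (rule edge_parity) (use assms in auto)
  ultimately show ?thesis using cr_sym(1)[of u v x y] by argo
qed

text \<open>The triangle over \<open>xy\<close> separates the starts of the rays to \<open>u\<close> and \<open>v\<close> iff the triangle over \<open>uv\<close>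
  separates those of the rays to \<open>x\<close> and \<open>y\<close>, so for a pair separated by few ranges it contains few or
  almost all starts.\<close>

lemma minority_starts:
  assumes M: "good_matching M" and j: "(x, y) \<in> M"
  shows "\<exists>maj. real (card {u \<in> U. u \<noteq> x \<and> u \<noteq> y \<and> st x y u \<noteq> maj}) \<le> 12 * c0 * L"
proof -
  have xy: "x \<in> U" "y \<in> U" "x \<noteq> y" using M j by (auto simp: good_matching_def matching_on_def)
  define K1 where "K1 = {u \<in> U. u \<noteq> x \<and> u \<noteq> y \<and> st x y u \<noteq> False}"
  define K0 where "K0 = {u \<in> U. u \<noteq> x \<and> u \<noteq> y \<and> st x y u \<noteq> True}"
  have fin: "finite K0" "finite K1" using finU by (auto simp: K0_def K1_def)
  have "U = insert x (insert y (K0 \<union> K1))" using xy by (auto simp: K0_def K1_def)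
  moreover have "x \<notin> insert y (K0 \<union> K1)" "y \<notin> K0 \<union> K1" using xy by (auto simp: K0_def K1_def)
  moreover have "card (K0 \<union> K1) = card K0 + card K1"
    by (rule card_Un_disjoint[OF fin]) (auto simp: K0_def K1_def)
  ultimately have "card U = Suc (Suc (card K0 + card K1))"
    using fin by (metis card_insert_disjoint finite_UnI finite_insert)
  then have sum: "real (card K0) + real (card K1) = N - 2" by (simp add: N_def)
  have "(\<lambda>(u, v). (False, u, v)) ` (K0 \<times> K1) \<union> (\<lambda>(u, v). (False, v, u)) ` (K0 \<times> K1)
     \<subseteq> {r \<in> Rng. sgn r x \<noteq> sgn r y}"
  proof -
    have "sgn (False, u, v) x \<noteq> sgn (False, u, v) y \<and> sgn (False, v, u) x \<noteq> sgn (False, v, u) y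
       \<and> u \<in> U \<and> v \<in> U \<and> u \<noteq> v" if "u \<in> K0" "v \<in> K1" for u v
    proof -
      have uv: "u \<in> U" "v \<in> U" "distinct [u, v, x, y]" "distinct [v, u, x, y]" "st x y u \<noteq> st x y v"
        using that xy by (auto simp: K0_def K1_def)
      then show ?thesis using st_sym[of u v x y] st_sym[of v u x y] xy by (simp add: sgn_def)
    qed
    note sepd = this
    show ?thesis
    proof
      fix r assume "r \<in> (\<lambda>(u, v). (False, u, v)) ` (K0 \<times> K1) \<union> (\<lambda>(u, v). (False, v, u)) ` (K0 \<times> K1)"
      then obtain u v where "u \<in> K0" "v \<in> K1" "r = (False, u, v) \<or> r = (False, v, u)" by auto
      then show "r \<in> {r \<in> Rng. sgn r x \<noteq> sgn r y}"
        using sepd[of u v] by (auto simp: Rng_def offdiag_def)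
    qed
  qed
  then have "card ((\<lambda>(u, v). (False, u, v)) ` (K0 \<times> K1) \<union> (\<lambda>(u, v). (False, v, u)) ` (K0 \<times> K1))
     \<le> card {r \<in> Rng. sgn r x \<noteq> sgn r y}"
    using finR by (intro card_mono) auto
  moreover have "card ((\<lambda>(u, v). (False, u, v)) ` (K0 \<times> K1) \<union> (\<lambda>(u, v). (False, v, u)) ` (K0 \<times> K1))
      = 2 * (card K0 * card K1)"
  proof -
    have "(\<lambda>(u, v). (False, u, v)) ` (K0 \<times> K1) \<inter> (\<lambda>(u, v). (False, v, u)) ` (K0 \<times> K1) = {}"
      by (auto simp: K0_def K1_def)
    then have "card ((\<lambda>(u, v). (False, u, v)) ` (K0 \<times> K1) \<union> (\<lambda>(u, v). (False, v, u)) ` (K0 \<times> K1))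
      = card ((\<lambda>(u, v). (False, u, v)) ` (K0 \<times> K1)) + card ((\<lambda>(u, v). (False, v, u)) ` (K0 \<times> K1))"
      using fin by (intro card_Un_disjoint) auto
    also have "\<dots> = card (K0 \<times> K1) + card (K0 \<times> K1)"
      by (intro arg_cong2[of _ _ _ _ "(+)"] card_image) (auto simp: inj_on_def)
    finally show ?thesis by (simp add: card_cartesian_product)
  qed
  moreover have "real (card {r \<in> Rng. sgn r x \<noteq> sgn r y}) \<le> 6 * \<epsilon> * N\<^sup>2"
    using M j unfolding good_matching_def by fastforce
  ultimately have "real (2 * (card K0 * card K1)) \<le> 6 * \<epsilon> * N\<^sup>2"
    by (simp only: of_nat_le_iff[symmetric, where 'a = real])
  then have prod: "real (card K0) * real (card K1) \<le> 3 * (c0 * L) * N"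
  proof -
    have "6 * \<epsilon> * N\<^sup>2 = 6 * (\<epsilon> * N) * N" by (simp add: power2_eq_square)
    also have "\<dots> = 6 * (c0 * L) * N" by (simp only: eps_N)
    finally show ?thesis using \<open>real (2 * (card K0 * card K1)) \<le> 6 * \<epsilon> * N\<^sup>2\<close> by simp
  qed
  \<comment> \<open>The larger of the two classes has at least
    \<open>(N - 2) / 2 \<ge> N / 4\<close> members, since \<open>N \<ge> 4\<close>; dividing the
    product bound by this gives the 12.\<close>
  define m where "m = min (real (card K0)) (real (card K1))"
  have "m * (N / 4) \<le> m * max (real (card K0)) (real (card K1))"
    using sum N4 by (intro mult_left_mono) (auto simp: m_def)
  also have "\<dots> = real (card K0) * real (card K1)" by (auto simp: m_def min_def max_def)
  also note prod
  finally have "m \<le> 12 * (c0 * L)" using N_pos by (simp add: field_simps)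
  then have "real (card K0) \<le> 12 * c0 * L \<or> real (card K1) \<le> 12 * c0 * L"
    by (auto simp: m_def min_def mult.assoc split: if_splits)
  then show ?thesis
    unfolding K0_def K1_def by blast
qed

end

end

section \<open>A pair crossed by few rays\<close>

context star_system
begin

lemma pair_members:
  assumes "good_matching M" "i \<in> M"
  shows "fst i \<in> U" "snd i \<in> U" "fst i \<noteq> snd i"
proof -
  have M: "M \<subseteq> U \<times> U" and "fst i \<noteq> snd i"
    using assms unfolding good_matching_def matching_on_def by simp_all
  from M assms(2) have "i \<in> U \<times> U" by blast
  then show "fst i \<in> U" "snd i \<in> U" unfolding mem_Times_iff by blast+
  show "fst i \<noteq> snd i" by fact
qed

lemma card_meeting_pairs_le:
  assumes M: "matching_on U M" and B: "finite B" and K: "\<And>i. i \<in> K \<Longrightarrow> i \<in> M \<and> pair_set i \<inter> B \<noteq> {}"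
  shows "card K \<le> card B"
proof -
  define g where "g i = (SOME z. z \<in> pair_set i \<inter> B)" for i
  have g: "g i \<in> pair_set i \<inter> B" if "i \<in> K" for i
    using K[OF that] unfolding g_def some_in_eq by blast
  have "inj_on g K"
  proof (rule inj_onI)
    fix i j assume ij: "i \<in> K" "j \<in> K" "g i = g j"
    then have "g i \<in> pair_set i \<inter> pair_set j" using g[of i] g[of j] by auto
    then show "i = j" using M K[OF ij(1)] K[OF ij(2)] unfolding matching_on_def by blast
  qed
  then show ?thesis using g B by (intro card_inj_on_le[of g]) auto
qed

text \<open>If all four rays cross the opposite edges, the edges cross as well, so the three terms
  of the edge parity are all true and their sum is odd. Mutually crossing pairs are thereby bounded
  by the stabbing number.\<close>

lemma mutual_separation:
  assumes "x \<in> U" "y \<in> U" "p \<in> U" "q \<in> U" "distinct [x, y, p, q]"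
    and "c p x y" "c q x y" "c x p q" "c y p q"
  shows "inn x y p \<noteq> inn x y q"
proof -
  have "cr x y p q" by (rule mutual_crossing) (use assms in auto)
  moreover have "(inn x y p \<noteq> inn x y q) = (c x p q \<noteq> (c y p q \<noteq> cr x y p q))"
    by (rule edge_parity) (use assms in auto)
  ultimately show ?thesis using assms by simp
qed

text \<open>The rays to \<open>x\<close> and \<open>y\<close> agree at \<open>pq\<close>, and the
  triangle over \<open>xy\<close> does not separate \<open>p\<close> from \<open>q\<close>, so by
  parity the two edges do not cross. Then neither ray to \<open>x\<close> or \<open>y\<close>
  crosses \<open>pq\<close>, since that would force a crossing. Hence a ray crossing
  \<open>pq\<close> but not \<open>xy\<close> ends on the same side of the triangle over
  \<open>xy\<close> as \<open>p\<close>; it also starts on that side, whereas the ray to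
  \<open>p\<close>, which crosses \<open>xy\<close>, starts on the other.\<close>

lemma subset_crossing_rays:
  assumes U: "x \<in> U" "y \<in> U" "p \<in> U" "q \<in> U" "distinct [x, y, p, q]"
    and c: "c p x y" "c q x y" and inn: "inn x y p = inn x y q"
    and sep: "inn p q x = inn p q y" "st p q x = st p q y"
    and u: "u \<in> U" "u \<noteq> p" "u \<noteq> q" "c u p q"
  shows "u \<noteq> x \<and> u \<noteq> y \<and> (c u x y \<or> st x y u \<noteq> st x y p)"
proof -
  have "c x p q = (st p q x \<noteq> inn p q x)" "c y p q = (st p q y \<noteq> inn p q y)"
    by (rule ray_parity; use U in auto)+
  then have cxy: "c x p q = c y p q" using sep by simp
  have "(inn x y p \<noteq> inn x y q) = (c x p q \<noteq> (c y p q \<noteq> cr x y p q))"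
    by (rule edge_parity) (use U in auto)
  then have ncr: "\<not> cr x y p q" using cxy inn by argo
  then have nc: "\<not> c x p q" using mutual_crossing[OF U c] by blast
  then have xy: "u \<noteq> x" "u \<noteq> y" using u(4) cxy by auto
  have "st x y u \<noteq> st x y p" if "\<not> c u x y"
  proof -
    have "inn x y u = inn x y p"
      by (rule ray_side[of x y p q u]) (use U u xy that nc cxy ncr in auto)
    moreover have "c u x y = (st x y u \<noteq> inn x y u)" "c p x y = (st x y p \<noteq> inn x y p)"
      by (rule ray_parity; use U u xy in auto)+
    ultimately show ?thesis using that c by auto
  qed
  then show ?thesis using xy by blast
qed

context
  assumes N4: "N \<ge> 4"
begin

lemmas N4_facts = N_pos[OF N4] L_ge1[OF N4] L_le_N[OF N4] eps_N[OF N4] eps_nonneg[OF N4] d0_le[OF N4]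

text \<open>
  \<open>K\<close> collects the pairs of \<open>M\<close> whose rays both cross the edge of \<open>j\<close> and which do not interfere with \<open>j\<close>.
  By minimality of \<open>j\<close> each of their edges is crossed by almost all rays that cross \<open>j\<close>, in particular
  by those of almost all other members of \<open>K\<close>; as two pairs rarely cross each other's rays, \<open>K\<close> is small.
\<close>

lemma minimal_pair_few_rays:
  assumes M: "good_matching M" and M': "good_matching M'" and j: "j \<in> M'"
    and rel: "real (card {i \<in> M. \<exists>b. sgn (b, i) (fst j) \<noteq> sgn (b, i) (snd j)}) \<le> 6 * c0 * L"
    and min: "\<And>i. i \<in> M \<Longrightarrow> card (A j) \<le> card (A i)"
  shows "real (card (A j)) \<le> (46 + 130 * c0) * L"
proof -
  obtain x y where jxy: "j = (x, y)" by (cases j)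
  have xy: "x \<in> U" "y \<in> U" "x \<noteq> y" using pair_members[OF M' j] by (auto simp: jxy)
  have match: "matching_on U M" using M by (simp add: good_matching_def)
  have finM: "finite M" using matching_on_finite[OF finU match] .
  obtain maj where maj: "real (card {u \<in> U. u \<noteq> x \<and> u \<noteq> y \<and> st x y u \<noteq> maj}) \<le> 12 * c0 * L"
    using minority_starts[OF N4 M'] j by (auto simp: jxy)
  define B where "B = {u \<in> U. u \<noteq> x \<and> u \<noteq> y \<and> st x y u \<noteq> maj}"
  define \<kappa> where "\<kappa> = 5 * L + 5 * c0 * L"
  have finB: "finite B" using finU by (simp add: B_def)
  have stab: "real (card {i \<in> M. sgn (b, u, v) (fst i) \<noteq> sgn (b, u, v) (snd i)}) \<le> \<kappa>"
    if "u \<in> U" "v \<in> U" "u \<noteq> v" for b u v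
    using M that unfolding good_matching_def stabbing_def \<kappa>_def by (auto simp: Rng_def offdiag_def)
  \<comment> \<open>The interfering pairs: those meeting \<open>j\<close>, those whose vertices or
    starts are separated by the triangle over \<open>j\<close>, those whose own triangle separates
    \<open>x\<close> from \<open>y\<close> or their starts, and those containing a vertex whose ray
    has a minority start.\<close>
  define X1 where "X1 = {i \<in> M. pair_set i \<inter> {x, y} \<noteq> {}}"
  define X2 where "X2 = {i \<in> M. sgn (True, x, y) (fst i) \<noteq> sgn (True, x, y) (snd i)}"
  define X3 where "X3 = {i \<in> M. sgn (False, x, y) (fst i) \<noteq> sgn (False, x, y) (snd i)}"
  define X4 where "X4 = {i \<in> M. \<exists>b. sgn (b, i) x \<noteq> sgn (b, i) y}"
  define X5 where "X5 = {i \<in> M. pair_set i \<inter> B \<noteq> {}}"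
  define K where "K = {i \<in> M. fst i \<in> A j \<and> snd i \<in> A j} - (X2 \<union> X3 \<union> X4 \<union> X5)"
  have fins: "finite X1" "finite X2" "finite X3" "finite X4" "finite X5" "finite K"
    using finM by (auto simp: X1_def X2_def X3_def X4_def X5_def K_def)
  have cX1: "real (card X1) \<le> 2"
  proof -
    have "card X1 \<le> card {x, y}" by (rule card_meeting_pairs_le[OF match]) (auto simp: X1_def)
    also have "\<dots> \<le> 2" using xy by simp
    finally show ?thesis by simp
  qed
  have cX2: "real (card X2) \<le> \<kappa>" unfolding X2_def by (rule stab[OF xy])
  have cX3: "real (card X3) \<le> \<kappa>" unfolding X3_def by (rule stab[OF xy])
  have cX4: "real (card X4) \<le> 6 * c0 * L" using rel by (simp add: X4_def jxy)
  have "card X5 \<le> card B" by (rule card_meeting_pairs_le[OF match finB]) (auto simp: X5_def)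
  then have cX5: "real (card X5) \<le> 12 * c0 * L" using maj unfolding B_def[symmetric] by linarith
  have Aj: "A j = {u \<in> U. u \<noteq> x \<and> u \<noteq> y \<and> c u x y}" by (simp add: A_def jxy)
  define Y where "Y = K \<union> (X1 \<union> (X2 \<union> (X3 \<union> (X4 \<union> X5))))"
  \<comment> \<open>Outside \<open>X1\<close>, \<open>X2\<close> and \<open>X3\<close> both ranges
    of the triangle over \<open>xy\<close> agree on the pair, so by the ray parity its two rays
    cross \<open>xy\<close> together or not at all.\<close>
  have cover: "i \<in> Y" if i: "i \<in> M" "pair_set i \<inter> A j \<noteq> {}" for i
  proof (rule ccontr)
    assume n: "i \<notin> Y"
    define p q where "p = fst i" and "q = snd i"
    have pq: "p \<in> U" "q \<in> U" "p \<noteq> q" using pair_members[OF M i(1)] by (auto simp: p_def q_def)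
    have d: "distinct [x, y, p, q]"
      using n i(1) xy pq by (auto simp: Y_def X1_def pair_set_def p_def q_def)
    have "inn x y p = inn x y q" "st x y p = st x y q"
      using n i(1) by (auto simp: Y_def X2_def X3_def sgn_def p_def q_def)
    moreover have "c p x y = (st x y p \<noteq> inn x y p)" "c q x y = (st x y q \<noteq> inn x y q)"
      by (rule ray_parity; use xy pq d in auto)+
    ultimately have "c p x y = c q x y" by simp
    then have "p \<in> A j \<and> q \<in> A j" using i(2) pq d by (auto simp: Aj pair_set_def p_def q_def)
    then show False using n i(1) by (auto simp: Y_def K_def p_def q_def)
  qed
  have "A j \<subseteq> (U - \<Union>(pair_set ` M)) \<union> fst ` Y \<union> snd ` Y"
  proof
    fix u assume u: "u \<in> A j"
    show "u \<in> (U - \<Union>(pair_set ` M)) \<union> fst ` Y \<union> snd ` Y"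
    proof (cases "\<exists>i\<in>M. u \<in> pair_set i")
      case True
      then obtain i where i: "i \<in> M" "u \<in> pair_set i" by blast
      then have "i \<in> Y" using cover[of i] u by auto
      then show ?thesis using i(2) by (auto simp: pair_set_def)
    next
      case False
      then show ?thesis using u by (auto simp: A_def)
    qed
  qed
  moreover have finY: "finite Y" using fins by (simp add: Y_def)
  ultimately have "card (A j) \<le> card ((U - \<Union>(pair_set ` M)) \<union> fst ` Y \<union> snd ` Y)"
    using finU by (intro card_mono) auto
  also have "\<dots> \<le> card (U - \<Union>(pair_set ` M)) + card (fst ` Y) + card (snd ` Y)"
    using card_Un_le[of "(U - \<Union>(pair_set ` M)) \<union> fst ` Y" "snd ` Y"]
      card_Un_le[of "U - \<Union>(pair_set ` M)" "fst ` Y"] by linarith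
  also have "\<dots> \<le> card (U - \<Union>(pair_set ` M)) + card Y + card Y"
    using card_image_le[OF finY, of fst] card_image_le[OF finY, of snd] by linarith
  finally have "card (A j) \<le> card (U - \<Union>(pair_set ` M)) + card Y + card Y" .
  moreover have "card Y \<le> card K + (card X1 + (card X2 + (card X3 + (card X4 + card X5))))"
    unfolding Y_def
    using card_Un_le[of K "X1 \<union> (X2 \<union> (X3 \<union> (X4 \<union> X5)))"] card_Un_le[of X1 "X2 \<union> (X3 \<union> (X4 \<union> X5))"]
      card_Un_le[of X2 "X3 \<union> (X4 \<union> X5)"] card_Un_le[of X3 "X4 \<union> X5"] card_Un_le[of X4 X5]
    by linarith
  moreover have "card (U - \<Union>(pair_set ` M)) \<le> d0" using M by (simp add: good_matching_def)
  ultimately have "card (A j) \<le> d0 + 2 * (card K + (card X1 + (card X2 + (card X3 + (card X4 + card X5)))))"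
    by presburger
  then have "real (card (A j)) \<le> real (d0 + 2 * (card K + (card X1 + (card X2 + (card X3 + (card X4 + card X5))))))"
    by (rule of_nat_mono)
  also have "\<dots> = real d0 + 2 * (real (card K) + (real (card X1) + (real (card X2) + (real (card X3) +
      (real (card X4) + real (card X5))))))" by simp
  also have "\<dots> \<le> real d0 + 2 * (real (card K) + (2 + (\<kappa> + (\<kappa> + (6 * c0 * L + 12 * c0 * L)))))"
    by (intro add_mono mult_left_mono order_refl cX1 cX2 cX3 cX4 cX5) auto
  finally have f_le: "real (card (A j)) \<le> real d0 + 2 * (real (card K) + (2 + (\<kappa> + (\<kappa> + (6 * c0 * L + 12 * c0 * L)))))" .
  have K_facts: "fst i \<in> U \<and> snd i \<in> U \<and> distinct [x, y, fst i, snd i] \<and> c (fst i) x y \<and> c (snd i) x y \<and>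
     inn x y (fst i) = inn x y (snd i) \<and> inn (fst i) (snd i) x = inn (fst i) (snd i) y \<and>
     st (fst i) (snd i) x = st (fst i) (snd i) y \<and> st x y (fst i) = maj \<and> i \<in> M" if "i \<in> K" for i
  proof -
    have i: "i \<in> M" "fst i \<in> A j" "snd i \<in> A j" "i \<notin> X2" "i \<notin> X4" "i \<notin> X5"
      using that by (auto simp: K_def)
    have "sgn (True, i) x = sgn (True, i) y" "sgn (False, i) x = sgn (False, i) y"
      using i by (auto simp: X4_def)
    moreover have "fst i \<notin> B" using i by (auto simp: X5_def pair_set_def)
    ultimately show ?thesis
      using i pair_members[OF M i(1)] xy by (auto simp: Aj X2_def sgn_def B_def)
  qed
  have A_sub: "A i \<subseteq> A j \<union> B" if i: "i \<in> K" for i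
  proof
    fix u assume u: "u \<in> A i"
    note k = K_facts[OF i]
    have "u \<noteq> x \<and> u \<noteq> y \<and> (c u x y \<or> st x y u \<noteq> st x y (fst i))"
      by (rule subset_crossing_rays[of x y "fst i" "snd i" u]) (use k xy u in \<open>auto simp: A_def\<close>)
    moreover have "u \<in> U" using u by (simp add: A_def)
    moreover have "st x y (fst i) = maj" using k by blast
    ultimately show "u \<in> A j \<union> B" unfolding Aj B_def by auto
  qed
  \<comment> \<open>Since \<open>A i\<close> is contained in \<open>A j\<close> up to
    \<open>B\<close> and is no smaller than \<open>A j\<close>, it conversely misses at most
    \<open>card B\<close> elements of \<open>A j\<close>; distinct pairs of \<open>K\<close> use
    distinct elements.\<close>
  have missing: "real (card {k \<in> K. \<not> (fst k \<in> A i \<and> snd k \<in> A i)}) \<le> 12 * c0 * L" if i: "i \<in> K" for i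
  proof -
    have "card (A j) \<le> card (A i)" using min K_facts[OF i] by blast
    also have "card (A i) \<le> card ((A i \<inter> A j) \<union> B)"
      using A_sub[OF i] finA finB by (intro card_mono) auto
    also have "\<dots> \<le> card (A i \<inter> A j) + card B" by (rule card_Un_le)
    finally have "card (A j) \<le> card (A i \<inter> A j) + card B" .
    moreover have "card (A j) = card (A i \<inter> A j) + card (A j - A i)"
      using finA[of j] by (metis Int_commute card_Int_Diff)
    ultimately have "card (A j - A i) \<le> card B" by linarith
    moreover have "card {k \<in> K. \<not> (fst k \<in> A i \<and> snd k \<in> A i)} \<le> card (A j - A i)"
      by (rule card_meeting_pairs_le[OF match]) (use finA in \<open>auto simp: K_def pair_set_def\<close>)
    ultimately show ?thesis using maj unfolding B_def[symmetric] by linarith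
  qed
  \<comment> \<open>A digraph on \<open>K\<close>: an arrow from \<open>i\<close> to
    \<open>k\<close> if both rays of \<open>k\<close> cross the edge of \<open>i\<close>. It is
    almost complete, but opposite arrows are rare, because the triangle over either pair would
    separate the other. Comparing \<open>E\<close> and its converse with \<open>K \<times> K\<close>
    bounds \<open>card K\<close>.\<close>
  define E where "E = {(i, k) \<in> K \<times> K. fst k \<in> A i \<and> snd k \<in> A i}"
  have finE: "finite E" using fins by (auto simp: E_def intro: finite_subset[of _ "K \<times> K"])
  have E_ge: "real (card K) * (real (card K) - 12 * c0 * L) \<le> real (card E)"
  proof -
    have E_Sig: "E = Sigma K (\<lambda>i. {k \<in> K. fst k \<in> A i \<and> snd k \<in> A i})" by (auto simp: E_def)
    have "real (card K) - 12 * c0 * L \<le> real (card {k \<in> K. fst k \<in> A i \<and> snd k \<in> A i})" if "i \<in> K" for i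
    proof -
      have "card K = card {k \<in> K. fst k \<in> A i \<and> snd k \<in> A i} + card {k \<in> K. \<not> (fst k \<in> A i \<and> snd k \<in> A i)}"
        using fins by (subst card_Un_disjoint[symmetric]) (auto intro: arg_cong[of _ _ card])
      then show ?thesis using missing[OF that] by linarith
    qed
    then have "(\<Sum>i\<in>K. real (card K) - 12 * c0 * L) \<le> (\<Sum>i\<in>K. real (card {k \<in> K. fst k \<in> A i \<and> snd k \<in> A i}))"
      by (intro sum_mono)
    then show ?thesis unfolding E_Sig using fins by (simp add: card_SigmaI)
  qed
  have two: "real (card (E \<inter> E\<inverse>)) \<le> real (card K) * \<kappa>"
  proof -
    have "E \<inter> E\<inverse> \<subseteq> Sigma K (\<lambda>k. {i \<in> M. sgn (True, fst k, snd k) (fst i) \<noteq> sgn (True, fst k, snd k) (snd i)})"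
    proof clarify
      fix i k assume ik: "(i, k) \<in> E" "(k, i) \<in> E"
      then have K: "i \<in> K" "k \<in> K" by (auto simp: E_def)
      note Ki = K_facts[OF K(1)] and Kk = K_facts[OF K(2)]
      have "inn (fst i) (snd i) (fst k) \<noteq> inn (fst i) (snd i) (snd k)"
        by (rule mutual_separation) (use ik Ki Kk in \<open>auto simp: E_def A_def\<close>)
      then show "i \<in> K \<and> k \<in> {ia \<in> M. sgn (True, fst i, snd i) (fst ia) \<noteq> sgn (True, fst i, snd i) (snd ia)}"
        using K Kk by (auto simp: sgn_def)
    qed
    then have "card (E \<inter> E\<inverse>) \<le> card (Sigma K (\<lambda>k. {i \<in> M. sgn (True, fst k, snd k) (fst i) \<noteq> sgn (True, fst k, snd k) (snd i)}))"
      using fins finM by (intro card_mono) auto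
    then have "real (card (E \<inter> E\<inverse>)) \<le> (\<Sum>k\<in>K. real (card {i \<in> M. sgn (True, fst k, snd k) (fst i) \<noteq> sgn (True, fst k, snd k) (snd i)}))"
      using fins finM by (simp add: card_SigmaI flip: of_nat_sum)
    also have "\<dots> \<le> (\<Sum>k\<in>K. \<kappa>)"
      using K_facts by (intro sum_mono stab) auto
    finally show ?thesis by simp
  qed
  have "card (E \<union> E\<inverse>) \<le> card (K \<times> K)"
    using fins by (intro card_mono) (auto simp: E_def)
  moreover have "card E + card (E\<inverse>) = card (E \<union> E\<inverse>) + card (E \<inter> E\<inverse>)"
    using finE by (intro card_Un_Int) auto
  ultimately have "2 * card E \<le> card K * card K + card (E \<inter> E\<inverse>)"
    using fins by (simp add: card_cartesian_product card_inverse)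
  then have "2 * real (card E) \<le> real (card K) * real (card K) + real (card (E \<inter> E\<inverse>))"
    by (simp only: of_nat_le_iff[symmetric, where 'a = real] of_nat_mult of_nat_add of_nat_numeral)
  then have "2 * (real (card K) * (real (card K) - 12 * c0 * L)) \<le> real (card K) * real (card K) + real (card K) * \<kappa>"
    using E_ge two by linarith
  then have "real (card K) * real (card K) \<le> real (card K) * (\<kappa> + 24 * c0 * L)"
    by (simp add: algebra_simps)
  moreover have nonneg: "0 \<le> \<kappa> + 24 * c0 * L"
    using c0_nonneg N4_facts by (simp add: \<kappa>_def)
  ultimately have cK: "real (card K) \<le> \<kappa> + 24 * c0 * L"
    by (cases "card K = 0") (auto simp: mult_le_cancel_left)
  have "real (card (A j)) \<le> 2 * L + 2 * (\<kappa> + 24 * c0 * L + (2 * L + (\<kappa> + (\<kappa> + (6 * c0 * L + 12 * c0 * L)))))"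
    by (rule order_trans[OF f_le], intro add_mono mult_left_mono order_refl cK N4_facts(6))
      (use N4_facts(2) in auto)
  also have "\<dots> = (36 + 114 * c0) * L" by (simp add: \<kappa>_def algebra_simps)
  also have "\<dots> \<le> (46 + 130 * c0) * L" using c0_nonneg N4_facts by (intro mult_right_mono) auto
  finally show ?thesis .
qed

text \<open>The constants are three times those of the ray bound, twice for edges with an end in
  \<open>A j\<close> and once for the rays themselves (using \<open>1 \<le> N\<close>), plus
  \<open>6 * c0\<close> for the triangles separating \<open>x\<close> from \<open>y\<close>.\<close>

lemma exists_light_pair:
  "\<exists>x\<in>U. \<exists>y\<in>U. x \<noteq> y \<and>
     real (card (A (x, y))) + real (card {(u, v). u \<in> U \<and> v \<in> U \<and> distinct [u, v, x, y] \<and> cr u v x y})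
       \<le> (138 + 396 * c0) * N powr (7/4)"
proof -
  define mn where "mn M = Min ((\<lambda>i. card (A i)) ` M)" for M
  have fin_good: "finite {M. good_matching M}"
    by (rule finite_subset[of _ "Pow (U \<times> U)"]) (use finU in \<open>auto simp: good_matching_def matching_on_def\<close>)
  have finM: "finite M" if "good_matching M" for M
    using that matching_on_finite[OF finU] by (auto simp: good_matching_def)
  have "\<exists>M. good_matching M"
  proof -
    have "sum (\<lambda>_. 1 / real (card Rng)) Rng = 1" using finR Rng_nonempty[OF N4] by simp
    then show ?thesis using exists_good_matching[OF N4, of "\<lambda>_. 1 / real (card Rng)"] by auto
  qed
  then have "{M. good_matching M} \<noteq> {}" by blast
  then have "Max (mn ` {M. good_matching M}) \<in> mn ` {M. good_matching M}"
    using fin_good by (intro Max_in) auto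
  then obtain M where M: "good_matching M" and mnM: "Max (mn ` {M. good_matching M}) = mn M" by auto
  have max: "mn M' \<le> mn M" if "good_matching M'" for M'
    unfolding mnM[symmetric] using fin_good that by (intro Max_ge) auto
  obtain M' where M': "good_matching M'" and
    rel: "\<And>j. j \<in> M' \<Longrightarrow> real (card {i \<in> M. \<exists>b. sgn (b, i) (fst j) \<noteq> sgn (b, i) (snd j)}) \<le> 6 * c0 * L"
    using exists_relative_matching[OF N4 M] by blast
  have ne: "M' \<noteq> {}" using matching_on_nonempty[OF N4 M'] .
  have "mn M' \<in> (\<lambda>i. card (A i)) ` M'"
    unfolding mn_def using finM[OF M'] ne by (intro Min_in) auto
  then obtain j where j: "j \<in> M'" "mn M' = card (A j)" by auto
  have "card (A j) \<le> card (A i)" if "i \<in> M" for i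
  proof -
    have "mn M \<le> card (A i)" unfolding mn_def using finM[OF M] that by (intro Min_le) auto
    then show ?thesis using max[OF M'] j by simp
  qed
  then have f: "real (card (A j)) \<le> (46 + 130 * c0) * L"
    using minimal_pair_few_rays[OF M M' j(1) rel[OF j(1)]] by blast
  obtain x y where jxy: "j = (x, y)" by (cases j)
  have xy: "x \<in> U" "y \<in> U" "x \<noteq> y" using pair_members[OF M' j(1)] by (auto simp: jxy)
  define S where "S = {r \<in> Rng. sgn r x \<noteq> sgn r y}"
  have S: "finite S" "real (card S) \<le> 6 * \<epsilon> * N\<^sup>2"
    using M' j(1) finR unfolding good_matching_def S_def jxy by fastforce+
  have sub: "{(u, v). u \<in> U \<and> v \<in> U \<and> distinct [u, v, x, y] \<and> cr u v x y} \<subseteq> A j \<times> U \<union> U \<times> A j \<union> snd ` S"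
  proof
    fix r assume "r \<in> {(u, v). u \<in> U \<and> v \<in> U \<and> distinct [u, v, x, y] \<and> cr u v x y}"
    then obtain u v where r: "r = (u, v)" and uv: "u \<in> U" "v \<in> U" "distinct [u, v, x, y]" "cr u v x y"
      by auto
    show "r \<in> A j \<times> U \<union> U \<times> A j \<union> snd ` S"
    proof (cases "(u, v) \<in> snd ` S")
      case True
      then show ?thesis by (simp add: r)
    next
      case n: False
    have "(True, u, v) \<notin> S" using n by (metis image_eqI snd_conv)
    then have "inn u v x = inn u v y"
      using uv by (auto simp: S_def Rng_def offdiag_def sgn_def)
    moreover have "(inn u v x \<noteq> inn u v y) = (c u x y \<noteq> (c v x y \<noteq> cr u v x y))"
      by (rule edge_parity) (use uv xy in auto)
    ultimately have "c u x y \<or> c v x y" using uv by auto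
    then show ?thesis using uv by (auto simp: A_def jxy r)
    qed
  qed
  have "card {(u, v). u \<in> U \<and> v \<in> U \<and> distinct [u, v, x, y] \<and> cr u v x y} \<le> card (A j \<times> U \<union> U \<times> A j \<union> snd ` S)"
    by (rule card_mono[OF _ sub]) (use finA finU S in auto)
  also have "\<dots> \<le> card (A j \<times> U) + card (U \<times> A j) + card (snd ` S)"
    using card_Un_le[of "A j \<times> U \<union> U \<times> A j" "snd ` S"] card_Un_le[of "A j \<times> U" "U \<times> A j"] by linarith
  also have "\<dots> \<le> card (A j) * card U + card U * card (A j) + card S"
    using S by (simp add: card_cartesian_product card_image_le)
  finally have "real (card {(u, v). u \<in> U \<and> v \<in> U \<and> distinct [u, v, x, y] \<and> cr u v x y})
     \<le> real (card (A j) * card U + card U * card (A j) + card S)" by (rule of_nat_mono)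
  then have "real (card {(u, v). u \<in> U \<and> v \<in> U \<and> distinct [u, v, x, y] \<and> cr u v x y})
     \<le> 2 * N * real (card (A j)) + 6 * \<epsilon> * N\<^sup>2"
    using S(2) by (simp add: N_def)
  also have "6 * \<epsilon> * N\<^sup>2 = 6 * (\<epsilon> * N) * N" by (simp add: power2_eq_square)
  also have "\<dots> = 6 * c0 * L * N" by (simp add: N4_facts)
  finally have "real (card (A j)) + real (card {(u, v). u \<in> U \<and> v \<in> U \<and> distinct [u, v, x, y] \<and> cr u v x y})
     \<le> real (card (A j)) * 1 + 2 * N * real (card (A j)) + 6 * c0 * L * N" by simp
  also have "\<dots> \<le> real (card (A j)) * N + 2 * N * real (card (A j)) + 6 * c0 * L * N"
    by (intro add_right_mono mult_left_mono) (use N4 in auto)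
  also have "\<dots> = 3 * N * real (card (A j)) + 6 * c0 * L * N" by simp
  also have "\<dots> \<le> 3 * N * ((46 + 130 * c0) * L) + 6 * c0 * L * N"
    by (intro add_right_mono mult_left_mono f) (use N4 in auto)
  also have "\<dots> = (138 + 396 * c0) * (N * L)" by (simp add: algebra_simps)
  also have "N * L = N powr (7/4)"
    using N4_facts(1) powr_add[of N 1 "3/4"] by (simp add: L_def)
  finally show ?thesis using xy jxy by blast
qed

end

end

section \<open>Arcs in charts of crossings and the parity of crossings with a Jordan curve\<close>

text \<open>Induction removing the last switch \<open>t\<close>: the interval is shortened to end
  just before \<open>t\<close>, the value flips across \<open>t\<close>, and it stays constant from
  there to \<open>b\<close>.\<close>

lemma parity_of_switches:
  fixes \<phi> :: "real \<Rightarrow> bool"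
  assumes "finite T" "T \<subseteq> {a<..<b}"
    and const: "\<And>c d. a \<le> c \<Longrightarrow> c \<le> d \<Longrightarrow> d \<le> b \<Longrightarrow> {c..d} \<inter> T = {} \<Longrightarrow> \<phi> c = \<phi> d"
    and switch: "\<And>t. t \<in> T \<Longrightarrow> \<exists>\<delta>>0. \<forall>s s'. t - \<delta> < s \<and> s < t \<and> t < s' \<and> s' < t + \<delta> \<longrightarrow> \<phi> s \<noteq> \<phi> s'"
    and "a \<le> b"
  shows "(\<phi> a \<noteq> \<phi> b) = odd (card T)"
  using assms
proof (induction "card T" arbitrary: T b)
  case 0
  then have "T = {}" by simp
  then show ?case using 0(4)[of a b] 0(6) by simp
next
  case (Suc n T b)
  define t where "t = Max T"
  have t: "t \<in> T" "\<And>s. s \<in> T \<Longrightarrow> s \<le> t"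
    using Suc.hyps(2) Suc.prems(1) unfolding t_def by (auto intro!: Max_in Max_ge)
  have tab: "a < t" "t < b" using t Suc.prems(2) by auto
  obtain \<delta> where \<delta>: "\<delta> > 0" "\<And>s s'. t - \<delta> < s \<Longrightarrow> s < t \<Longrightarrow> t < s' \<Longrightarrow> s' < t + \<delta> \<Longrightarrow> \<phi> s \<noteq> \<phi> s'"
    using Suc.prems(4)[OF t(1)] by blast
  define T' where "T' = T - {t}"
  have finT': "finite T'" using Suc.prems(1) by (simp add: T'_def)
  have lt: "s < t" if "s \<in> T'" for s using that t(2)[of s] by (auto simp: T'_def)
  define m where "m = Max (insert a (insert (t - \<delta>) T'))"
  have m: "m < t" "a \<le> m" "t - \<delta> \<le> m" "\<And>s. s \<in> T' \<Longrightarrow> s \<le> m"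
  proof -
    have fin: "finite (insert a (insert (t - \<delta>) T'))" using finT' by simp
    show "m < t" unfolding m_def using fin lt tab \<delta>(1) by simp
    show "a \<le> m" "t - \<delta> \<le> m" "\<And>s. s \<in> T' \<Longrightarrow> s \<le> m"
      unfolding m_def by (rule Max_ge[OF fin]; simp)+
  qed
  define s where "s = (m + t) / 2"
  define s' where "s' = min ((t + b) / 2) (t + \<delta> / 2)"
  have s: "m < s" "s < t" "a < s" using m tab by (auto simp: s_def)
  have s': "t < s'" "s' < t + \<delta>" "s' < b"
  proof -
    have b: "s' \<le> (t + b) / 2" "s' \<le> t + \<delta> / 2"
      unfolding s'_def by (rule min.cobounded1, rule min.cobounded2)
    show "t < s'" using tab \<delta>(1) by (simp add: s'_def)
    show "s' < t + \<delta>" using b(2) \<delta>(1) by linarith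
    have "(t + b) / 2 < b" using tab by simp
    then show "s' < b" using b(1) by linarith
  qed
  have IH: "(\<phi> a \<noteq> \<phi> s) = odd (card T')"
  proof (rule Suc.hyps(1))
    show "n = card T'" using Suc.hyps(2) t(1) by (simp add: T'_def)
    show "T' \<subseteq> {a<..<s}" using m(4) s Suc.prems(2) by (force simp: T'_def)
    fix c d assume cd: "a \<le> c" "c \<le> d" "d \<le> s" "{c..d} \<inter> T' = {}"
    then have "{c..d} \<inter> T = {}" using s tab by (auto simp: T'_def)
    then show "\<phi> c = \<phi> d" using Suc.prems(3)[of c d] cd s tab by auto
  next
    fix u assume "u \<in> T'"
    then show "\<exists>\<delta>>0. \<forall>s s'. u - \<delta> < s \<and> s < u \<and> u < s' \<and> s' < u + \<delta> \<longrightarrow> \<phi> s \<noteq> \<phi> s'"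
      using Suc.prems(4)[of u] by (auto simp: T'_def)
  qed (use finT' s in auto)
  have "\<phi> s \<noteq> \<phi> s'" using \<delta>(2)[of s s'] m s s' by auto
  moreover have "\<phi> s' = \<phi> b"
  proof (rule Suc.prems(3))
    show "{s'..b} \<inter> T = {}" using t(2) s' by force
  qed (use s' tab in auto)
  moreover have "card T = Suc (card T')" using Suc.prems(1) t(1) unfolding T'_def by (metis card_Suc_Diff1)
  ultimately show ?case using IH by auto
qed

text \<open>This replaces transversality for arcs that are merely continuous: a continuous injective
  function on an interval is strictly monotone, hence changes sign at its zero;
  \<open>\<sigma>\<close> records the direction.\<close>

lemma injective_real_sign_change:
  fixes f :: "real \<Rightarrow> real"
  assumes "continuous_on {a<..<b} f" "inj_on f {a<..<b}" "t \<in> {a<..<b}" "f t = 0"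
  shows "\<exists>\<sigma>. \<sigma> \<noteq> 0 \<and> (\<forall>s\<in>{a<..<t}. \<sigma> * f s < 0) \<and> (\<forall>s\<in>{t<..<b}. 0 < \<sigma> * f s)"
proof -
  have "strict_mono_on {a<..<b} f \<or> strict_antimono_on {a<..<b} f"
    using injective_eq_monotone_map[of "{a<..<b}" f] assms by (simp add: is_interval_oo)
  then show ?thesis
  proof
    assume m: "strict_mono_on {a<..<b} f"
    have "f s < 0" if "s \<in> {a<..<t}" for s
      using strict_mono_onD[OF m, of s t] that assms by auto
    moreover have "0 < f s" if "s \<in> {t<..<b}" for s
      using strict_mono_onD[OF m, of t s] that assms by auto
    ultimately show ?thesis by (intro exI[of _ 1]) auto
  next
    assume m: "strict_antimono_on {a<..<b} f"
    have "f s > 0" if "s \<in> {a<..<t}" for s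
      using m that assms unfolding monotone_on_def by force
    moreover have "0 > f s" if "s \<in> {t<..<b}" for s
      using m that assms unfolding monotone_on_def by force
    ultimately show ?thesis by (intro exI[of _ "-1"]) auto
  qed
qed

text \<open>The part of the arc with distant parameters is compact and misses \<open>g t\<close>, so
  its complement is the neighbourhood.\<close>

lemma arc_avoid_far_part:
  fixes g :: "real \<Rightarrow> 'a::metric_space"
  assumes "arc g" "t \<in> {0<..<1}" "\<delta> > 0"
  shows "\<exists>N. open N \<and> g t \<in> N \<and> (\<forall>s\<in>{0..1}. g s \<in> N \<longrightarrow> \<bar>s - t\<bar> < \<delta>)"
proof -
  have cont: "continuous_on {0..1} g" and inj: "inj_on g {0..1}"
    using assms(1) by (auto simp: arc_def path_def)
  define F where "F = g ` ({0..1} - {t - \<delta><..<t + \<delta>})"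
  have "compact ({0..1} - {t - \<delta><..<t + \<delta>})" by (intro compact_diff) auto
  moreover have "continuous_on ({0..1} - {t - \<delta><..<t + \<delta>}) g" using cont by (rule continuous_on_subset) auto
  ultimately have "compact F" unfolding F_def by (intro compact_continuous_image)
  then have "open (- F)" using compact_imp_closed by auto
  moreover have "g t \<notin> F"
  proof
    assume "g t \<in> F"
    then obtain s where s: "s \<in> {0..1}" "s \<notin> {t - \<delta><..<t + \<delta>}" "g t = g s" by (auto simp: F_def)
    then have "t = s" using inj_onD[OF inj, of t s] assms(2) by auto
    then show False using s(2) assms(3) by simp
  qed
  moreover have "\<bar>s - t\<bar> < \<delta>" if "s \<in> {0..1}" "g s \<notin> F" for s
    using that by (force simp: F_def abs_less_iff)
  ultimately show ?thesis by (intro exI[of _ "- F"]) auto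
qed

lemma arc_near:
  fixes g :: "real \<Rightarrow> 'a::metric_space"
  assumes "arc g" "t \<in> {0<..<1}" "open N" "g t \<in> N"
  shows "\<exists>\<delta>>0. {t - \<delta><..<t + \<delta>} \<subseteq> {0<..<1} \<and> g ` {t - \<delta><..<t + \<delta>} \<subseteq> N"
proof -
  have "continuous_on {0<..<1} g" using assms(1) unfolding arc_def path_def
    by (meson continuous_on_subset greaterThanLessThan_subseteq_atLeastAtMost_iff order_refl)
  then have "open ({0<..<1} \<inter> g -` N)"
    by (intro continuous_open_preimage assms(3)) auto
  moreover have "t \<in> {0<..<1} \<inter> g -` N" using assms by auto
  ultimately obtain \<delta> where "\<delta> > 0" "ball t \<delta> \<subseteq> {0<..<1} \<inter> g -` N"
    using open_contains_ball by blast
  moreover have "ball t \<delta> = {t - \<delta><..<t + \<delta>}" by (rule ball_eq_greaterThanLessThan)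
  ultimately show ?thesis by blast
qed

text \<open>The chart is cut down to the preimage of a round ball lying over \<open>N\<close>;
  half-discs and quadrants of a ball are convex and therefore give connected pieces of the
  plane.\<close>

lemma crossing_chart:
  assumes "properly_cross_at e f p" "open N" "p \<in> N"
  obtains W h k r where "open W" "p \<in> W" "W \<subseteq> N" "r > 0" "homeomorphism W (ball (0::complex) r) h k" "h p = 0"
    "\<And>z. z \<in> W \<Longrightarrow> z \<in> path_image e \<longleftrightarrow> Im (h z) = 0"
    "\<And>z. z \<in> W \<Longrightarrow> z \<in> path_image f \<longleftrightarrow> Re (h z) = 0"
proof -
  obtain U h k where U: "open U" "p \<in> U" "homeomorphism U UNIV h k" "h p = 0"
    "h ` (path_image e \<inter> U) = {z. Im z = 0}" "h ` (path_image f \<inter> U) = {z. Re z = 0}"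
    using assms(1) unfolding properly_cross_at_def by blast
  have kh: "k (h z) = z" if "z \<in> U" for z using U(3) that by (auto simp: homeomorphism_def)
  have hk: "h (k w) = w" for w using U(3) by (auto simp: homeomorphism_def)
  have inj: "inj_on h U" using kh by (metis inj_onI)
  have "openin (top_of_set U) (U \<inter> N)" using assms(2) by (simp add: openin_open_Int)
  then have "openin (top_of_set UNIV) (h ` (U \<inter> N))"
    using homeomorphism_imp_open_map[OF U(3)] by blast
  then have "open (h ` (U \<inter> N))" by simp
  moreover have "0 \<in> h ` (U \<inter> N)" using U assms(3) by force
  ultimately obtain r where r: "r > 0" "ball 0 r \<subseteq> h ` (U \<inter> N)" using open_contains_ball by blast
  define W where "W = k ` ball 0 r"
  have homeo: "homeomorphism W (ball 0 r) h k"
    unfolding W_def by (rule homeomorphism_of_subsets[OF U(3)]) (use U(3) hk in \<open>auto simp: homeomorphism_def image_image\<close>)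
  have Wsub: "W \<subseteq> U \<inter> N"
  proof
    fix z assume "z \<in> W"
    then obtain w where w: "w \<in> ball 0 r" "z = k w" by (auto simp: W_def)
    then obtain y where y: "y \<in> U \<inter> N" "w = h y" using r by blast
    then show "z \<in> U \<inter> N" using kh w by auto
  qed
  have "openin (top_of_set U) W"
    unfolding W_def by (rule homeomorphism_imp_open_map[OF homeomorphism_symD[OF U(3)]]) auto
  then have "open W" using U(1) openin_open_eq by blast
  moreover have "p \<in> W" using kh[OF U(2)] U(4) r(1) by (force simp: W_def)
  moreover have "z \<in> path_image e \<longleftrightarrow> Im (h z) = 0" if "z \<in> W" for z
  proof -
    have zU: "z \<in> U" using that Wsub by auto
    then have "z \<in> path_image e \<longleftrightarrow> h z \<in> h ` (path_image e \<inter> U)" using inj by (auto simp: inj_on_def)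
    then show ?thesis using U(5) by simp
  qed
  moreover have "z \<in> path_image f \<longleftrightarrow> Re (h z) = 0" if "z \<in> W" for z
  proof -
    have zU: "z \<in> U" using that Wsub by auto
    then have "z \<in> path_image f \<longleftrightarrow> h z \<in> h ` (path_image f \<inter> U)" using inj by (auto simp: inj_on_def)
    then show ?thesis using U(6) by simp
  qed
  ultimately show ?thesis using that[of W r h k] Wsub r(1) homeo U(4) by blast
qed

section \<open>Sides of a Jordan curve along an arc\<close>

definition jordan_curve :: "complex set \<Rightarrow> bool" where
  "jordan_curve J \<longleftrightarrow> (\<exists>c. simple_path c \<and> pathfinish c = pathstart c \<and> path_image c = J)"

lemma jordan_curve_frontier:
  assumes "jordan_curve J"
  shows "frontier (inside J) = J" "frontier (outside J) = J" "inside J \<union> outside J = - J"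
  using assms Jordan_inside_outside unfolding jordan_curve_def by (metis, metis, simp)

lemma inside_const_on_connected:
  assumes "connected S" "S \<inter> J = {}" "x \<in> S" "y \<in> S"
  shows "x \<in> inside J \<longleftrightarrow> y \<in> inside J"
proof -
  have "connected_component (- J) x y"
    using assms unfolding connected_component_def by (intro exI[of _ S]) auto
  then show ?thesis
    using inside_same_component[of J x y] inside_same_component[of J y x] connected_component_sym by blast
qed

text \<open>In the chart \<open>J\<close> is the imaginary axis, so two connected half-discs remain.
  Inside and outside both accumulate at every point of a Jordan curve, hence each meets the chart
  and the half-discs lie on different sides. The arc runs injectively along the real axis and so
  passes from one half-disc to the other.\<close>

lemma crossing_switches_sides:
  assumes J: "jordan_curve J" and cross: "properly_cross_at g f (g t)" and g: "arc g" "t \<in> {0<..<1}"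
    and N: "open N" "g t \<in> N" "J \<inter> N = path_image f \<inter> N"
  shows "\<exists>\<delta>>0. \<forall>s s'. t - \<delta> < s \<and> s < t \<and> t < s' \<and> s' < t + \<delta> \<longrightarrow> (g s \<in> inside J) \<noteq> (g s' \<in> inside J)"
proof -
  obtain W r h k where W: "open W" "g t \<in> W" "W \<subseteq> N" "r > 0" "homeomorphism W (ball (0::complex) r) h k" "h (g t) = 0"
    and We: "\<And>z. z \<in> W \<Longrightarrow> z \<in> path_image g \<longleftrightarrow> Im (h z) = 0"
    and Wf: "\<And>z. z \<in> W \<Longrightarrow> z \<in> path_image f \<longleftrightarrow> Re (h z) = 0"
    by (rule crossing_chart[OF cross N(1,2)]) (rule that; assumption)
  have kh: "k (h z) = z" "h z \<in> ball 0 r" if "z \<in> W" for z using W(5) that by (auto simp: homeomorphism_def)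
  have hk: "h (k w) = w" "k w \<in> W" if "w \<in> ball 0 r" for w using W(5) that by (auto simp: homeomorphism_def)
  define P where "P = k ` ({z. Re z > 0} \<inter> ball 0 r)"
  define M where "M = k ` ({z. Re z < 0} \<inter> ball 0 r)"
  have contk: "continuous_on (ball 0 r) k" using W(5) by (auto simp: homeomorphism_def)
  have conn: "connected P" "connected M"
    unfolding P_def M_def
    by (intro connected_continuous_image continuous_on_subset[OF contk] convex_connected convex_Int
        convex_halfspace_Re_gt convex_halfspace_Re_lt convex_ball; simp)+
  have inJ: "z \<in> J \<longleftrightarrow> Re (h z) = 0" if "z \<in> W" for z using that N(3) W(3) Wf[OF that] by blast
  have PM: "z \<in> P \<longleftrightarrow> Re (h z) > 0" "z \<in> M \<longleftrightarrow> Re (h z) < 0" if "z \<in> W" for z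
  proof -
    show "z \<in> P \<longleftrightarrow> Re (h z) > 0"
      unfolding P_def using kh[OF that] hk(1) by (auto simp: image_iff intro!: bexI[of _ "h z"])
    show "z \<in> M \<longleftrightarrow> Re (h z) < 0"
      unfolding M_def using kh[OF that] hk(1) by (auto simp: image_iff intro!: bexI[of _ "h z"])
  qed
  have PMW: "P \<subseteq> W" "M \<subseteq> W" using hk(2) by (auto simp: P_def M_def)
  have disj: "P \<inter> J = {}" "M \<inter> J = {}" using PMW PM inJ by fastforce+
  have cover: "z \<in> P \<or> z \<in> M" if "z \<in> W" "z \<notin> J" for z
    using that PM[OF that(1)] inJ[OF that(1)] by linarith
  have "g t \<in> J" using inJ[OF W(2)] W(6) by simp
  then have "g t \<in> W \<inter> closure (inside J)" "g t \<in> W \<inter> closure (outside J)"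
    using jordan_curve_frontier[OF J] W(2) by (auto simp: frontier_def)
  then have "W \<inter> inside J \<noteq> {}" "W \<inter> outside J \<noteq> {}"
    using open_Int_closure_eq_empty[OF W(1)] by blast+
  then obtain a b where ab: "a \<in> W" "a \<in> inside J" "b \<in> W" "b \<in> outside J"
    by blast
  have abJ: "a \<notin> J" "b \<notin> J" "b \<notin> inside J"
    using ab inside_no_overlap[of J] outside_no_overlap[of J] inside_Int_outside[of J] by blast+
  have differ: "(u \<in> inside J) \<noteq> (v \<in> inside J)" if "u \<in> P" "v \<in> M" for u v
  proof -
    have cP: "x \<in> inside J \<longleftrightarrow> y \<in> inside J" if "x \<in> P" "y \<in> P" for x y
      using inside_const_on_connected[OF conn(1) disj(1)] that by blast
    have cM: "x \<in> inside J \<longleftrightarrow> y \<in> inside J" if "x \<in> M" "y \<in> M" for x y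
      using inside_const_on_connected[OF conn(2) disj(2)] that by blast
    show ?thesis using cover[OF ab(1) abJ(1)] cover[OF ab(3) abJ(2)] ab(2) abJ(3) cP cM that by blast
  qed
  obtain \<delta> where \<delta>: "\<delta> > 0" "{t - \<delta><..<t + \<delta>} \<subseteq> {0<..<1}" "g ` {t - \<delta><..<t + \<delta>} \<subseteq> W"
    using arc_near[OF g W(1,2)] by blast
  define \<psi> where "\<psi> s = Re (h (g s))" for s
  have gpath: "g s \<in> path_image g" if "s \<in> {0<..<1}" for s using that by (auto simp: path_image_def)
  have "{t - \<delta><..<t + \<delta>} \<subseteq> {0..1}" using \<delta>(2) by (rule order_trans) auto
  then have "continuous_on {t - \<delta><..<t + \<delta>} g"
    using g(1) unfolding arc_def path_def by (blast intro: continuous_on_subset)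
  then have "continuous_on {t - \<delta><..<t + \<delta>} \<psi>"
    unfolding \<psi>_def using W(5) \<delta>(3)
    by (intro continuous_on_Re continuous_on_compose2[of W h _ g]) (auto simp: homeomorphism_def)
  moreover have "inj_on \<psi> {t - \<delta><..<t + \<delta>}"
  proof (rule inj_onI)
    fix s s' assume s: "s \<in> {t - \<delta><..<t + \<delta>}" "s' \<in> {t - \<delta><..<t + \<delta>}" "\<psi> s = \<psi> s'"
    then have sW: "g s \<in> W" "g s' \<in> W" using \<delta>(3) by auto
    have s01: "s \<in> {0<..<1}" "s' \<in> {0<..<1}" using s \<delta>(2) by auto
    have "Im (h (g s)) = 0" "Im (h (g s')) = 0" using We sW gpath s01 by auto
    then have "h (g s) = h (g s')" using s(3) by (simp add: \<psi>_def complex_eq_iff)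
    then have "g s = g s'" using kh(1) sW by metis
    then show "s = s'" using g(1) s01 unfolding arc_def by (auto dest: inj_onD)
  qed
  moreover have "t \<in> {t - \<delta><..<t + \<delta>}" using \<delta>(1) by auto
  moreover have "\<psi> t = 0" using W(6) by (simp add: \<psi>_def)
  ultimately obtain \<sigma> where \<sigma>: "\<sigma> \<noteq> 0" "\<forall>s\<in>{t - \<delta><..<t}. \<sigma> * \<psi> s < 0" "\<forall>s\<in>{t<..<t + \<delta>}. 0 < \<sigma> * \<psi> s"
    using injective_real_sign_change by blast
  have "(g s \<in> inside J) \<noteq> (g s' \<in> inside J)" if s: "t - \<delta> < s" "s < t" "t < s'" "s' < t + \<delta>" for s s'
  proof -
    have sW: "g s \<in> W" "g s' \<in> W" using \<delta>(3) s by auto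
    have "\<sigma> * \<psi> s < 0" "0 < \<sigma> * \<psi> s'" using \<sigma> s by auto
    then consider "\<psi> s < 0" "\<psi> s' > 0" | "\<psi> s > 0" "\<psi> s' < 0"
      by (auto simp: mult_less_0_iff zero_less_mult_iff)
    then show ?thesis
      using differ[of "g s" "g s'"] differ[of "g s'" "g s"] PM sW by (cases) (auto simp: \<psi>_def)
  qed
  then show ?thesis using \<delta>(1) by blast
qed

text \<open>The curve may be pieced together from several arcs: near each hit it only has to agree
  with one arc that \<open>g\<close> crosses properly. The parameter interval is free so that
  counting can begin at the start of a ray.\<close>

lemma arc_jordan_parity:
  assumes J: "jordan_curve J" and g: "arc g" and ab: "0 \<le> a" "a \<le> b" "b \<le> 1"
    and X: "finite {t \<in> {a..b}. g t \<in> J}" "g a \<notin> J" "g b \<notin> J"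
    and cross: "\<And>t. a < t \<Longrightarrow> t < b \<Longrightarrow> g t \<in> J \<Longrightarrow>
      \<exists>f N. properly_cross_at g f (g t) \<and> open N \<and> g t \<in> N \<and> J \<inter> N = path_image f \<inter> N"
  shows "((g a \<in> inside J) \<noteq> (g b \<in> inside J)) = odd (card {t \<in> {a..b}. g t \<in> J})"
proof (rule parity_of_switches[where \<phi> = "\<lambda>t. g t \<in> inside J"])
  show sub: "{t \<in> {a..b}. g t \<in> J} \<subseteq> {a<..<b}"
  proof
    fix t assume t: "t \<in> {t \<in> {a..b}. g t \<in> J}"
    then have "t \<noteq> a" "t \<noteq> b" using X(2,3) by auto
    then show "t \<in> {a<..<b}" using t by auto
  qed
  fix c d assume cd: "a \<le> c" "c \<le> d" "d \<le> b" "{c..d} \<inter> {t \<in> {a..b}. g t \<in> J} = {}"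
  have "continuous_on {c..d} g" using g cd ab unfolding arc_def path_def by (auto elim: continuous_on_subset)
  then have "connected (g ` {c..d})" by (intro connected_continuous_image) auto
  moreover have "g ` {c..d} \<inter> J = {}" using cd by auto
  ultimately show "(g c \<in> inside J) = (g d \<in> inside J)"
    by (rule inside_const_on_connected) (use cd in auto)
next
  fix t assume t: "t \<in> {t \<in> {a..b}. g t \<in> J}"
  then have "t \<noteq> a" "t \<noteq> b" using X(2,3) by auto
  then have t': "a < t" "t < b" "g t \<in> J" using t by auto
  then obtain f N where "properly_cross_at g f (g t)" "open N" "g t \<in> N" "J \<inter> N = path_image f \<inter> N"
    using cross by blast
  then show "\<exists>\<delta>>0. \<forall>s s'. t - \<delta> < s \<and> s < t \<and> t < s' \<and> s' < t + \<delta> \<longrightarrow> (g s \<in> inside J) \<noteq> (g s' \<in> inside J)"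
    using crossing_switches_sides[OF J _ g] t' ab by force
qed (use X ab in auto)

text \<open>Where two arcs cross, one can pass from the part of one arc before the crossing to the part of
  the other arc before the crossing inside a quadrant that avoids the later parts of both.\<close>

lemma crossing_hop:
  assumes cross: "properly_cross_at e f p" and e: "arc e" "s \<in> {0<..<1}" "e s = p"
    and f: "arc f" "t \<in> {0<..<1}" "f t = p" and N: "open N" "p \<in> N"
  obtains H s0 t0 where "connected H" "H \<subseteq> N" "0 < s0" "s0 < s" "e s0 \<in> H" "0 < t0" "t0 < t" "f t0 \<in> H"
    "H \<inter> e ` {s..1} = {}" "H \<inter> f ` {t..1} = {}"
proof -
  obtain W r h k where W: "open W" "p \<in> W" "W \<subseteq> N" "r > 0" "homeomorphism W (ball (0::complex) r) h k" "h p = 0"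
    and We: "\<And>z. z \<in> W \<Longrightarrow> z \<in> path_image e \<longleftrightarrow> Im (h z) = 0"
    and Wf: "\<And>z. z \<in> W \<Longrightarrow> z \<in> path_image f \<longleftrightarrow> Re (h z) = 0"
    by (rule crossing_chart[OF cross N]) (rule that; assumption)
  have kh: "k (h z) = z" "h z \<in> ball 0 r" if "z \<in> W" for z using W(5) that by (auto simp: homeomorphism_def)
  have hk: "h (k w) = w" "k w \<in> W" if "w \<in> ball 0 r" for w using W(5) that by (auto simp: homeomorphism_def)
  have conth: "continuous_on W h" and contk: "continuous_on (ball 0 r) k" using W(5) by (auto simp: homeomorphism_def)
  have sign: "\<exists>\<delta> \<sigma>. \<delta> > 0 \<and> {u - \<delta><..<u + \<delta>} \<subseteq> {0<..<1} \<and> g ` {u - \<delta><..<u + \<delta>} \<subseteq> W \<and>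
      continuous_on {u - \<delta><..<u + \<delta>} (\<lambda>x. h (g x)) \<and>
      (\<forall>x\<in>{u - \<delta><..<u}. \<sigma> * D (h (g x)) < 0) \<and> (\<forall>x\<in>{u<..<u + \<delta>}. 0 < \<sigma> * D (h (g x)))"
    if g: "arc g" "u \<in> {0<..<1}" "g u = p" and D: "D = Re \<or> D = Im"
      and inj: "\<And>z z'. z \<in> W \<Longrightarrow> z' \<in> W \<Longrightarrow> z \<in> path_image g \<Longrightarrow> z' \<in> path_image g \<Longrightarrow> D (h z) = D (h z') \<Longrightarrow> h z = h z'"
    for g u and D :: "complex \<Rightarrow> real"
  proof -
    obtain \<delta> where \<delta>: "\<delta> > 0" "{u - \<delta><..<u + \<delta>} \<subseteq> {0<..<1}" "g ` {u - \<delta><..<u + \<delta>} \<subseteq> W"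
      using arc_near[OF g(1,2) W(1)] W(2) g(3) by blast
    have gpath: "g x \<in> path_image g" if "x \<in> {u - \<delta><..<u + \<delta>}" for x using that \<delta>(2) by (force simp: path_image_def)
    have "{u - \<delta><..<u + \<delta>} \<subseteq> {0..1}" using \<delta>(2) by (rule order_trans) auto
    then have "continuous_on {u - \<delta><..<u + \<delta>} g"
      using g(1) unfolding arc_def path_def by (blast intro: continuous_on_subset)
    then have ch: "continuous_on {u - \<delta><..<u + \<delta>} (\<lambda>x. h (g x))"
      using conth \<delta>(3) by (intro continuous_on_compose2[of W h _ g]) auto
    then have "continuous_on {u - \<delta><..<u + \<delta>} (\<lambda>x. D (h (g x)))"
      using D continuous_on_Re continuous_on_Im by metis
    moreover have "inj_on (\<lambda>x. D (h (g x))) {u - \<delta><..<u + \<delta>}"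
    proof (rule inj_onI)
      fix x y assume xy: "x \<in> {u - \<delta><..<u + \<delta>}" "y \<in> {u - \<delta><..<u + \<delta>}" "D (h (g x)) = D (h (g y))"
      then have W': "g x \<in> W" "g y \<in> W" using \<delta>(3) by auto
      have "h (g x) = h (g y)" by (rule inj) (use W' gpath xy in auto)
      then have "g x = g y" using kh(1) W' by metis
      moreover have "x \<in> {0..1}" "y \<in> {0..1}" using xy \<delta>(2) by force+
      ultimately show "x = y" using g(1) unfolding arc_def by (auto dest: inj_onD)
    qed
    moreover have "u \<in> {u - \<delta><..<u + \<delta>}" using \<delta>(1) by auto
    moreover have "D (h (g u)) = 0" using D W(6) g(3) by auto
    ultimately obtain \<sigma> where "\<forall>x\<in>{u - \<delta><..<u}. \<sigma> * D (h (g x)) < 0" "\<forall>x\<in>{u<..<u + \<delta>}. 0 < \<sigma> * D (h (g x))"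
      using injective_real_sign_change[of "u - \<delta>" "u + \<delta>" "\<lambda>x. D (h (g x))" u] by blast
    then show ?thesis using \<delta> ch by blast
  qed
  obtain \<delta>e \<sigma>e where E: "\<delta>e > 0" "{s - \<delta>e<..<s + \<delta>e} \<subseteq> {0<..<1}" "e ` {s - \<delta>e<..<s + \<delta>e} \<subseteq> W"
      "continuous_on {s - \<delta>e<..<s + \<delta>e} (\<lambda>x. h (e x))"
      "\<forall>x\<in>{s - \<delta>e<..<s}. \<sigma>e * Re (h (e x)) < 0" "\<forall>x\<in>{s<..<s + \<delta>e}. 0 < \<sigma>e * Re (h (e x))"
    using sign[OF e, of Re] We by (auto simp: complex_eq_iff)
  obtain \<delta>f \<sigma>f where F: "\<delta>f > 0" "{t - \<delta>f<..<t + \<delta>f} \<subseteq> {0<..<1}" "f ` {t - \<delta>f<..<t + \<delta>f} \<subseteq> W"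
      "continuous_on {t - \<delta>f<..<t + \<delta>f} (\<lambda>x. h (f x))"
      "\<forall>x\<in>{t - \<delta>f<..<t}. \<sigma>f * Im (h (f x)) < 0" "\<forall>x\<in>{t<..<t + \<delta>f}. 0 < \<sigma>f * Im (h (f x))"
    using sign[OF f, of Im] Wf by (auto simp: complex_eq_iff)
  \<comment> \<open>Within \<open>Ne\<close> and \<open>Nf\<close> only parameters near the crossing
    occur, so there the sign of the coordinate decides whether a point of the arc comes before or
    after it.\<close>
  obtain Ne where Ne: "open Ne" "p \<in> Ne" "\<And>x. x \<in> {0..1} \<Longrightarrow> e x \<in> Ne \<Longrightarrow> \<bar>x - s\<bar> < \<delta>e"
    using arc_avoid_far_part[OF e(1,2) E(1)] e(3) by blast
  obtain Nf where Nf: "open Nf" "p \<in> Nf" "\<And>x. x \<in> {0..1} \<Longrightarrow> f x \<in> Nf \<Longrightarrow> \<bar>x - t\<bar> < \<delta>f"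
    using arc_avoid_far_part[OF f(1,2) F(1)] f(3) by blast
  have "open (ball 0 r \<inter> k -` (Ne \<inter> Nf))"
    using Ne(1) Nf(1) by (intro continuous_open_preimage contk) auto
  moreover have "0 \<in> ball 0 r \<inter> k -` (Ne \<inter> Nf)" using kh(1)[OF W(2)] W(4,6) Ne(2) Nf(2) by auto
  ultimately obtain r' where r': "r' > 0" "ball 0 r' \<subseteq> ball 0 r \<inter> k -` (Ne \<inter> Nf)"
    using open_contains_ball by blast
  \<comment> \<open>The closed quadrant bounded by the earlier halves of both arcs, without the
    crossing point. It stays convex, because the origin is an extreme point of the quadrant.\<close>
  define Q where "Q = {z. \<sigma>e * Re z \<le> 0} \<inter> {z. \<sigma>f * Im z \<le> 0} \<inter> ball 0 r' - {0}"
  have Qconn: "connected Q"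
  proof (rule convex_connected, rule convexI)
    fix x y u v assume *: "x \<in> Q" "y \<in> Q" "0 \<le> u" "0 \<le> v" "u + v = (1::real)"
    define z where "z = u *\<^sub>R x + v *\<^sub>R y"
    have lin: "\<sigma>e * Re z = u * (\<sigma>e * Re x) + v * (\<sigma>e * Re y)" "\<sigma>f * Im z = u * (\<sigma>f * Im x) + v * (\<sigma>f * Im y)"
      by (simp_all add: z_def algebra_simps)
    have le: "u * (\<sigma>e * Re x) \<le> 0" "v * (\<sigma>e * Re y) \<le> 0" "u * (\<sigma>f * Im x) \<le> 0" "v * (\<sigma>f * Im y) \<le> 0"
      using * by (auto simp: Q_def mult_nonneg_nonpos)
    have "z \<in> ball 0 r'" unfolding z_def using * by (intro convexD[OF convex_ball]) (auto simp: Q_def)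
    moreover have "z \<noteq> 0"
    proof
      assume "z = 0"
      then have s0: "u * (\<sigma>e * Re x) + v * (\<sigma>e * Re y) = 0" "u * (\<sigma>f * Im x) + v * (\<sigma>f * Im y) = 0"
        using lin by simp_all
      have "u * (\<sigma>e * Re x) = 0" using s0(1) le(1,2) by linarith
      moreover have "v * (\<sigma>e * Re y) = 0" using s0(1) le(1,2) by linarith
      moreover have "u * (\<sigma>f * Im x) = 0" using s0(2) le(3,4) by linarith
      moreover have "v * (\<sigma>f * Im y) = 0" using s0(2) le(3,4) by linarith
      moreover have "\<sigma>e \<noteq> 0" using E(1) bspec[OF E(5), of "s - \<delta>e / 2"] by auto
      moreover have "\<sigma>f \<noteq> 0" using F(1) bspec[OF F(5), of "t - \<delta>f / 2"] by auto
      ultimately show False using * by (auto simp: Q_def complex_eq_iff)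
    qed
    ultimately show "u *\<^sub>R x + v *\<^sub>R y \<in> Q" using lin le unfolding z_def[symmetric] Q_def by auto
  qed
  have near: "\<exists>x. 0 < x \<and> x < u \<and> u - \<delta> < x \<and> h (g x) \<in> ball 0 r'"
    if "\<delta> > 0" "{u - \<delta><..<u + \<delta>} \<subseteq> {0<..<1}" "continuous_on {u - \<delta><..<u + \<delta>} (\<lambda>x. h (g x))" "g u = p" for u \<delta> and g :: "real \<Rightarrow> complex"
  proof -
    have "open ({u - \<delta><..<u + \<delta>} \<inter> (\<lambda>x. h (g x)) -` ball 0 r')"
      by (intro continuous_open_preimage that) auto
    moreover have "u \<in> {u - \<delta><..<u + \<delta>} \<inter> (\<lambda>x. h (g x)) -` ball 0 r'" using that W(6) r'(1) by auto
    ultimately obtain \<eta> where \<eta>: "\<eta> > 0" "ball u \<eta> \<subseteq> {u - \<delta><..<u + \<delta>} \<inter> (\<lambda>x. h (g x)) -` ball 0 r'"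
      using open_contains_ball by blast
    have "u - \<eta> / 2 \<in> ball u \<eta>" using \<eta>(1) by (simp add: dist_real_def)
    from subsetD[OF \<eta>(2) this]
    have x: "u - \<eta> / 2 \<in> {u - \<delta><..<u + \<delta>}" "h (g (u - \<eta> / 2)) \<in> ball 0 r'"
      unfolding Int_iff vimage_eq by blast+
    have "u - \<eta> / 2 \<in> {0<..<1}" using x(1) that(2) by blast
    then show ?thesis using x \<eta>(1) by (intro exI[of _ "u - \<eta> / 2"]) auto
  qed
  obtain s0 where s0: "0 < s0" "s0 < s" "s - \<delta>e < s0" "h (e s0) \<in> ball 0 r'" using near[OF E(1,2,4) e(3)] by blast
  obtain t0 where t0: "0 < t0" "t0 < t" "t - \<delta>f < t0" "h (f t0) \<in> ball 0 r'" using near[OF F(1,2,4) f(3)] by blast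
  have eW: "e s0 \<in> W" "e s0 \<in> path_image e" using E(2,3) s0 by (force simp: path_image_def)+
  have fW: "f t0 \<in> W" "f t0 \<in> path_image f" using F(2,3) t0 by (force simp: path_image_def)+
  have "h (e s0) \<in> Q"
  proof -
    have "\<sigma>e * Re (h (e s0)) < 0" using E(5) s0 by auto
    moreover have "Im (h (e s0)) = 0" using We eW by blast
    ultimately show ?thesis using s0(4) by (auto simp: Q_def)
  qed
  then have eH: "e s0 \<in> k ` Q" using kh(1)[OF eW(1)] by force
  have "h (f t0) \<in> Q"
  proof -
    have "\<sigma>f * Im (h (f t0)) < 0" using F(5) t0 by auto
    moreover have "Re (h (f t0)) = 0" using Wf fW by blast
    ultimately show ?thesis using t0(4) by (auto simp: Q_def)
  qed
  then have fH: "f t0 \<in> k ` Q" using kh(1)[OF fW(1)] by force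
  have Qr: "z \<in> ball 0 r" "k z \<in> Ne" "k z \<in> Nf" if "z \<in> Q" for z using that r'(2) by (auto simp: Q_def)
  show ?thesis
  proof (rule that[of "k ` Q" s0 t0])
    show "connected (k ` Q)"
      using Qr(1) by (intro connected_continuous_image Qconn continuous_on_subset[OF contk]) auto
    show "k ` Q \<subseteq> N" using Qr(1) hk(2) W(3) by blast
    show "k ` Q \<inter> e ` {s..1} = {}"
    proof (rule ccontr)
      assume "k ` Q \<inter> e ` {s..1} \<noteq> {}"
      then obtain z x where zx: "z \<in> Q" "k z = e x" "s \<le> x" "x \<le> 1" by auto
      then have hx: "h (e x) = z" using hk(1) Qr(1) by metis
      have "\<bar>x - s\<bar> < \<delta>e" using Ne(3)[of x] Qr(2)[OF zx(1)] zx e(2) by auto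
      then have "x = s \<or> 0 < \<sigma>e * Re z" using E(6) zx(3) hx by auto
      then show False using zx(1) hx e(3) W(6) by (auto simp: Q_def)
    qed
    show "k ` Q \<inter> f ` {t..1} = {}"
    proof (rule ccontr)
      assume "k ` Q \<inter> f ` {t..1} \<noteq> {}"
      then obtain z x where zx: "z \<in> Q" "k z = f x" "t \<le> x" "x \<le> 1" by auto
      then have hx: "h (f x) = z" using hk(1) Qr(1) by metis
      have "\<bar>x - t\<bar> < \<delta>f" using Nf(3)[of x] Qr(3)[OF zx(1)] zx f(2) by auto
      then have "x = t \<or> 0 < \<sigma>f * Im z" using F(6) zx(3) hx by auto
      then show False using zx(1) hx f(3) W(6) by (auto simp: Q_def)
    qed
  qed (use s0 t0 eH fH in auto)
qed

section \<open>Cells of a union of arcs\<close>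

lemma card_image_le_factor:
  assumes "finite P" "\<And>x y. x \<in> P \<Longrightarrow> y \<in> P \<Longrightarrow> f x = f y \<Longrightarrow> g x = g y"
  shows "card (g ` P) \<le> card (f ` P)"
proof -
  define k where "k z = g (SOME x. x \<in> P \<and> f x = z)" for z
  have "g x = k (f x)" if "x \<in> P" for x
  proof -
    have "\<exists>y. y \<in> P \<and> f y = f x" using that by blast
    then have "(SOME y. y \<in> P \<and> f y = f x) \<in> P \<and> f (SOME y. y \<in> P \<and> f y = f x) = f x"
      by (rule someI_ex)
    then show ?thesis using assms(2) that unfolding k_def by metis
  qed
  then have "g ` P = k ` f ` P" by (simp add: image_image)
  then show ?thesis using assms(1) by (simp add: card_image_le)
qed

text \<open>Only cells occupied by points of \<open>P\<close> are counted, so the number is finite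
  together with \<open>P\<close>.\<close>

definition ncells :: "complex set \<Rightarrow> complex set \<Rightarrow> nat" where
  "ncells K P = card (connected_component_set (- K) ` P)"

lemma ncells_le_factor:
  assumes "finite P" "P \<inter> K' = {}" "K \<subseteq> K'"
    and "\<And>x y. x \<in> P \<Longrightarrow> y \<in> P \<Longrightarrow> connected_component (- K) x y \<Longrightarrow> connected_component (- K') x y"
  shows "ncells K' P \<le> ncells K P"
  unfolding ncells_def
proof (rule card_image_le_factor[OF assms(1)])
  fix x y assume xy: "x \<in> P" "y \<in> P" "connected_component_set (- K) x = connected_component_set (- K) y"
  then have "connected_component (- K) x y"
    using assms(2,3) connected_component_eq_eq[of "- K" x y] by blast
  then show "connected_component_set (- K') x = connected_component_set (- K') y"
    using assms(4)[OF xy(1,2)] connected_component_eq[of y "- K'" x] by simp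
qed

text \<open>Janiszewski's theorem: an arc does not separate the plane and it meets \<open>K\<close>
  in a single point, a connected set, so two points in one cell of \<open>K\<close> stay connected
  after the arc is added.\<close>

lemma ncells_add_arc_touching:
  assumes K: "compact K" and c: "arc c" "path_image c \<inter> K = {a}" and P: "finite P" "P \<inter> (K \<union> path_image c) = {}"
  shows "ncells (K \<union> path_image c) P \<le> ncells K P"
proof (rule ncells_le_factor[OF P])
  fix x y assume xy: "x \<in> P" "y \<in> P" "connected_component (- K) x y"
  have "connected_component (- (path_image c \<union> K)) x y"
  proof (rule Janiszewski_weak)
    have "connected (- path_image c)" using c(1) by (simp add: connected_arc_complement)
    then show "connected_component (- path_image c) x y"
      using xy P unfolding connected_iff_connected_component by blast
  qed (use K c xy compact_arc_image in auto)
  then show "connected_component (- (K \<union> path_image c)) x y" by (simp add: Un_commute)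
qed auto

text \<open>Only the cell through which the open chord runs can be cut. The chord and an arc in
  \<open>K\<close> form a Jordan curve that meets \<open>K\<close> in that arc, so by Janiszewski's
  theorem points of this cell on the same side of the curve remain connected: the cell falls into at
  most two.\<close>

lemma ncells_add_chord:
  assumes K: "compact K" "path_connected K" and c: "arc c" "path_image c \<inter> K = {pathstart c, pathfinish c}"
    and P: "finite P" "P \<inter> (K \<union> path_image c) = {}"
  shows "ncells (K \<union> path_image c) P \<le> ncells K P + 1"
proof -
  have ne: "pathstart c \<noteq> pathfinish c" using arc_distinct_ends[OF c(1)] by metis
  have "pathstart c \<in> K" "pathfinish c \<in> K" using c(2) by auto
  then obtain b where b: "arc b" "path_image b \<subseteq> K" "pathstart b = pathstart c" "pathfinish b = pathfinish c"
    using K(2) ne unfolding path_connected_arcwise by blast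
  define J where "J = path_image c \<union> path_image b"
  have inter: "path_image c \<inter> path_image b = {pathstart c, pathfinish c}"
    using b c(2) pathstart_in_path_image[of b] pathfinish_in_path_image[of b]
      pathstart_in_path_image[of c] pathfinish_in_path_image[of c] by auto
  have sp: "simple_path (c +++ reversepath b)"
    using c(1) b inter by (intro simple_path_join_loop) (auto simp: arc_reversepath)
  have Jim: "path_image (c +++ reversepath b) = J"
    using b by (simp add: path_image_join J_def)
  have Jconn: "connected (inside J)" "connected (outside J)" "inside J \<union> outside J = - J"
    using Jordan_inside_outside[OF sp] b Jim by auto
  \<comment> \<open>Any point of the open chord would do; it names the cell that is cut.\<close>
  define w where "w = c (1/2)"
  have "w \<in> path_image c" by (auto simp: w_def path_image_def)
  moreover have "w \<noteq> pathstart c" "w \<noteq> pathfinish c"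
    using c(1) unfolding arc_def w_def pathstart_def pathfinish_def by (force dest: inj_onD)+
  ultimately have w: "w \<in> path_image c - {pathstart c, pathfinish c}" by simp
  define f where "f x = connected_component_set (- K) x" for x
  define g where "g x = connected_component_set (- (K \<union> path_image c)) x" for x
  \<comment> \<open>The Boolean can be true only on the cell of \<open>w\<close>, so it adds at most
    one value to those of \<open>f\<close>.\<close>
  define fb where "fb x = (f x, f x = f w \<and> x \<in> inside J)" for x
  have "card (g ` P) \<le> card (fb ` P)"
  proof (rule card_image_le_factor[OF P(1)])
    fix x y assume xy: "x \<in> P" "y \<in> P" "fb x = fb y"
    then have fxy: "f x = f y" by (simp add: fb_def)
    have nK: "x \<notin> K" "y \<notin> K" "x \<notin> path_image c" "y \<notin> path_image c" using xy P(2) by auto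
    then have cK: "connected_component (- K) x y"
      using fxy connected_component_eq_eq[of "- K" x y] unfolding f_def by blast
    have "connected_component (- (K \<union> path_image c)) x y"
    proof (cases "f x = f w")
      case True
      then have io: "x \<in> inside J \<longleftrightarrow> y \<in> inside J" using xy(3) fxy by (simp add: fb_def)
      have nJ: "x \<in> - J" "y \<in> - J" using nK b(2) by (auto simp: J_def)
      have "connected_component (- J) x y"
      proof (cases "x \<in> inside J")
        case True
        then show ?thesis using io Jconn unfolding connected_component_def by (intro exI[of _ "inside J"]) blast
      next
        case False
        then have "x \<in> outside J" "y \<in> outside J" using io Jconn(3) nJ by blast+
        then show ?thesis using Jconn unfolding connected_component_def by (intro exI[of _ "outside J"]) blast
      qed
      moreover have "J \<inter> K = path_image b" using b(2) c(2) inter by (auto simp: J_def)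
      moreover have "compact J" unfolding Jim[symmetric] using sp by (rule compact_simple_path_image)
      ultimately have "connected_component (- (J \<union> K)) x y"
        using Janiszewski_weak[of J K x y] K(1) cK connected_arc_image[OF b(1)] by simp
      moreover have "J \<union> K = K \<union> path_image c" using b(2) by (auto simp: J_def)
      ultimately show ?thesis by simp
    next
      case False
      have conn: "connected (path_image c - {pathstart c, pathfinish c})"
        using c(1) by (intro connected_simple_path_endless arc_imp_simple_path)
      have "f x \<inter> path_image c = {}"
      proof (rule ccontr)
        assume "f x \<inter> path_image c \<noteq> {}"
        then obtain z where z: "z \<in> f x" "z \<in> path_image c" by blast
        have zK: "z \<in> - K" using z(1) unfolding f_def using connected_component_in by fastforce
        then have "z \<in> path_image c - {pathstart c, pathfinish c}" using z(2) c(2) by auto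
        then have "connected_component (- K) z w"
          unfolding connected_component_def using conn w c(2)
          by (intro exI[of _ "path_image c - {pathstart c, pathfinish c}"]) auto
        moreover have "connected_component (- K) x z" using z(1) by (simp add: f_def)
        ultimately have "connected_component (- K) x w" using connected_component_trans by metis
        then show False using False connected_component_eq[of w "- K" x] by (simp add: f_def)
      qed
      moreover have "f x \<subseteq> - K" unfolding f_def by (rule connected_component_subset)
      ultimately have "f x \<subseteq> - (K \<union> path_image c)" by blast
      moreover have "connected (f x)" by (simp add: f_def)
      moreover have "x \<in> f x" "y \<in> f x" using cK nK by (auto simp: f_def connected_component_refl)
      ultimately show ?thesis unfolding connected_component_def by (intro exI[of _ "f x"]) auto
    qed
    then show "g x = g y" unfolding g_def using connected_component_eq[of y "- (K \<union> path_image c)" x] by simp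
  qed
  also have "card (fb ` P) \<le> card (insert (f w, True) ((\<lambda>X. (X, False)) ` f ` P))"
    using P(1) by (intro card_mono) (auto simp: fb_def)
  also have "\<dots> \<le> Suc (card ((\<lambda>X. (X, False)) ` f ` P))" by (rule card_insert_le_m1[simplified]) auto
  also have "\<dots> \<le> Suc (card (f ` P))" using P(1) by (simp add: card_image_le)
  finally show ?thesis by (simp add: ncells_def f_def[abs_def] g_def[abs_def])
qed

lemma subarc_facts:
  assumes "arc g" "0 \<le> c" "c < d" "d \<le> (1::real)"
  shows "arc (subpath c d g)" "path_image (subpath c d g) = g ` {c..d}"
    "pathstart (subpath c d g) = g c" "pathfinish (subpath c d g) = g d"
proof -
  show "arc (subpath c d g)" by (rule arc_subpath_arc) (use assms in auto)
  show "path_image (subpath c d g) = g ` {c..d}" using assms by (simp add: path_image_subpath)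
qed simp_all

lemma arc_interval_topology:
  fixes g :: "real \<Rightarrow> 'a::real_normed_vector"
  assumes "arc g" "0 \<le> c" "d \<le> (1::real)"
  shows "compact (g ` {c..d})" "path_connected (g ` {c..d})"
proof -
  have "continuous_on {c..d} g"
    using continuous_on_subset[of "{0..1}" g "{c..d}"] assms by (simp add: arc_def path_def)
  then show "compact (g ` {c..d})" "path_connected (g ` {c..d})"
    using compact_continuous_image[of "{c..d}" g] path_connected_continuous_image[of "{c..d}" g]
    by (simp_all add: convex_imp_path_connected)
qed

lemma ncells_add_touching_interval:
  assumes g: "arc g" and cd: "0 \<le> c" "c \<le> d" "d \<le> 1" and K: "compact K"
    and T: "{t \<in> {c..d}. g t \<in> K} = {u}"
    and P: "finite P" "P \<inter> (K \<union> g ` {c..d}) = {}"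
  shows "ncells (K \<union> g ` {c..d}) P \<le> ncells K P"
proof -
  have u: "c \<le> u" "u \<le> d" "g u \<in> K" using equalityD2[OF T] by simp_all
  have uniq: "t = u" if "c \<le> t" "t \<le> d" "g t \<in> K" for t using equalityD1[OF T] that by auto
  show ?thesis
  proof (cases "c = d")
    case True
    then have "g ` {c..d} \<subseteq> K" using u by simp
    then show ?thesis by (simp add: Un_absorb2)
  next
    case False
    then have "c < d" using cd by simp
    note sub = subarc_facts[OF g cd(1) this cd(3)]
    have "g ` {c..d} \<inter> K = {g u}"
    proof
      show "g ` {c..d} \<inter> K \<subseteq> {g u}" using uniq by fastforce
      show "{g u} \<subseteq> g ` {c..d} \<inter> K" using u by simp
    qed
    then show ?thesis
      using ncells_add_arc_touching[OF K sub(1), of "g u" P] P unfolding sub(2) by blast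
  qed
qed

text \<open>Cut the arc at its hits with \<open>K\<close>. The pieces before the first and after the
  last hit only touch and add no cell; each piece between consecutive hits is a chord and adds at
  most one, hence \<open>m\<close> for \<open>m + 1\<close> hits.\<close>

lemma ncells_add_arc_interval:
  assumes g: "arc g" and ab: "0 \<le> a" "a < b" "b \<le> 1"
    and K: "compact K" "path_connected K"
    and T: "finite {t \<in> {a..b}. g t \<in> K}" "card {t \<in> {a..b}. g t \<in> K} = Suc m"
    and P: "finite P" "P \<inter> (K \<union> g ` {a..b}) = {}"
  shows "ncells (K \<union> g ` {a..b}) P \<le> ncells K P + m"
  using ab K T P
proof (induction m arbitrary: a K)
  have inj: "t = t'" if "g t = g t'" "0 \<le> t" "t \<le> 1" "0 \<le> t'" "t' \<le> 1" for t t'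
    using g that unfolding arc_def by (auto dest: inj_onD)
  {
    \<comment> \<open>Shared by both cases of the induction: the piece up to the first hit is
      absorbed into \<open>K\<close>.\<close>
    fix a K m
    assume prems: "0 \<le> a" "a < b" "b \<le> 1" "compact K" "path_connected K"
      "finite {t \<in> {a..b}. g t \<in> K}" "card {t \<in> {a..b}. g t \<in> K} = Suc m"
      "finite P" "P \<inter> (K \<union> g ` {a..b}) = {}"
    define T where "T = {t \<in> {a..b}. g t \<in> K}"
    define t1 where "t1 = Min T"
    have "T \<noteq> {}" using prems(7) unfolding T_def[symmetric] by auto
    moreover have "finite T" using prems(6) unfolding T_def .
    ultimately have t1: "t1 \<in> T" "\<And>t. t \<in> T \<Longrightarrow> t1 \<le> t" by (simp_all add: t1_def)
    have t1ab: "a \<le> t1" "t1 \<le> b" "g t1 \<in> K" using t1(1) by (auto simp: T_def)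
    define K1 where "K1 = K \<union> g ` {a..t1}"
    have "{t \<in> {a..t1}. g t \<in> K} = {t1}"
    proof (rule set_eqI)
      fix t show "t \<in> {t \<in> {a..t1}. g t \<in> K} \<longleftrightarrow> t \<in> {t1}"
        using t1(2)[of t] t1ab by (auto simp: T_def)
    qed
    then have n1: "ncells K1 P \<le> ncells K P"
      unfolding K1_def using prems t1ab
      by (intro ncells_add_touching_interval[OF g _ _ _ prems(4)]) auto
    have topo: "compact (g ` {a..t1})" "path_connected (g ` {a..t1})"
      using arc_interval_topology[OF g prems(1), of t1] t1ab prems(3) by auto
    have K1: "compact K1" "path_connected K1"
      unfolding K1_def using prems(4,5) topo t1ab by (auto intro!: path_connected_Un compact_Un)
    have K1t: "g t \<in> K1 \<longleftrightarrow> t \<in> T" if "t \<in> {t1..b}" for t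
      using that t1ab t1(1) prems(1-3) by (auto simp: K1_def T_def dest: inj)
    have "\<exists>T t1 K1. T = {t \<in> {a..b}. g t \<in> K} \<and> t1 \<in> T \<and> (\<forall>t\<in>T. t1 \<le> t) \<and> K1 = K \<union> g ` {a..t1} \<and>
      ncells K1 P \<le> ncells K P \<and> compact K1 \<and> path_connected K1 \<and> (\<forall>t\<in>{t1..b}. g t \<in> K1 \<longleftrightarrow> t \<in> T) \<and> a \<le> t1 \<and> t1 \<le> b"
      using T_def t1 K1_def n1 K1 K1t t1ab by blast
  }
  note first = this
  {
    case (0 a K)
    obtain T t1 K1 where F: "T = {t \<in> {a..b}. g t \<in> K}" "t1 \<in> T" "\<forall>t\<in>T. t1 \<le> t" "K1 = K \<union> g ` {a..t1}"
      "ncells K1 P \<le> ncells K P" "compact K1" "path_connected K1" "\<forall>t\<in>{t1..b}. g t \<in> K1 \<longleftrightarrow> t \<in> T" "a \<le> t1" "t1 \<le> b"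
      using first[OF 0] by blast
    have "T = {t1}" using 0(7) F(1,2) by (metis One_nat_def card_1_singletonE singletonD)
    then have "{t \<in> {t1..b}. g t \<in> K1} = {t1}" using F(8,10) by auto
    moreover have eq: "K1 \<union> g ` {t1..b} = K \<union> g ` {a..b}"
      unfolding F(4) Un_assoc image_Un[symmetric] using F(9,10) by (simp add: ivl_disj_un_two_touch)
    ultimately have "ncells (K1 \<union> g ` {t1..b}) P \<le> ncells K1 P"
      using 0 F by (intro ncells_add_touching_interval[OF g _ _ _ F(6)]) auto
    then show ?case using F(5) eq by simp
  next
    case (Suc m a K)
    obtain T t1 K1 where F: "T = {t \<in> {a..b}. g t \<in> K}" "t1 \<in> T" "\<forall>t\<in>T. t1 \<le> t" "K1 = K \<union> g ` {a..t1}"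
      "ncells K1 P \<le> ncells K P" "compact K1" "path_connected K1" "\<forall>t\<in>{t1..b}. g t \<in> K1 \<longleftrightarrow> t \<in> T" "a \<le> t1" "t1 \<le> b"
      using first[OF Suc.prems] by blast
    define T' where "T' = T - {t1}"
    have cT': "finite T'" "card T' = Suc m" using Suc.prems(6,7) F(1,2) by (auto simp: T'_def)
    define t2 where "t2 = Min T'"
    have "T' \<noteq> {}" using cT' by auto
    then have t2: "t2 \<in> T'" "\<And>t. t \<in> T' \<Longrightarrow> t2 \<le> t" using cT' by (simp_all add: t2_def)
    have t12: "t1 < t2" "t2 \<le> b" "g t2 \<in> K" using t2(1) F(1,3) by (auto simp: T'_def less_le)
    have t01: "0 \<le> t1" "t2 \<le> 1" using Suc.prems F(9) t12 by auto
    note sub = subarc_facts[OF g t01(1) t12(1) t01(2)]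
    define K2 where "K2 = K1 \<union> g ` {t1..t2}"
    have mid: "g ` {t1..t2} \<inter> K1 = {g t1, g t2}"
    proof -
      have "g t \<in> K1 \<longleftrightarrow> t = t1 \<or> t = t2" if "t \<in> {t1..t2}" for t
        using that F(2,8) t2(1) t2(2)[of t] t12 by (cases "t = t1") (auto simp: T'_def)
      then show ?thesis using t12 by auto
    qed
    have eq: "K2 \<union> g ` {t2..b} = K \<union> g ` {a..b}" "K2 = K \<union> g ` {a..t2}"
      unfolding K2_def F(4) Un_assoc image_Un[symmetric] using F(9,10) t12
      by (simp_all add: ivl_disj_un_two_touch)
    have disj: "P \<inter> K2 = {}" using Suc.prems(9) eq(1) by blast
    have "ncells (K1 \<union> path_image (subpath t1 t2 g)) P \<le> ncells K1 P + 1"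
      by (rule ncells_add_chord[OF F(6,7) sub(1) _ Suc.prems(8)]) (use sub mid disj in \<open>auto simp: K2_def\<close>)
    then have n2: "ncells K2 P \<le> ncells K P + 1" using F(5) by (simp add: sub(2) K2_def)
    have topo: "compact (g ` {t1..t2})" "path_connected (g ` {t1..t2})"
      using arc_interval_topology[OF g t01] by auto
    have K2: "compact K2" "path_connected K2"
      unfolding K2_def using F(6,7) topo mid by (auto intro!: path_connected_Un compact_Un)
    have K2t: "{t \<in> {t2..b}. g t \<in> K2} = T'"
    proof (rule set_eqI)
      fix t
      have "g t \<in> K2 \<longleftrightarrow> t \<in> T'" if "t \<in> {t2..b}"
        using that t12 t2(1) t01 Suc.prems(1-3) F(1,9) unfolding eq(2) T'_def by (auto dest: inj)
      then show "t \<in> {t \<in> {t2..b}. g t \<in> K2} \<longleftrightarrow> t \<in> T'" using t2(2) F(1) by (auto simp: T'_def)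
    qed
    show ?case
    proof (cases "t2 = b")
      case True
      then have "K \<union> g ` {a..b} = K2" using eq(2) by simp
      then show ?thesis using n2 by simp
    next
      case False
      have "ncells (K2 \<union> g ` {t2..b}) P \<le> ncells K2 P + m"
        by (rule Suc.IH) (use Suc.prems t01 t12 False K2 K2t cT' eq in auto)
      then show ?thesis using n2 eq(1) by simp
    qed
  }
qed

lemma ncells_add_arc:
  assumes g: "arc g" and K: "compact K" "path_connected K"
    and T: "finite (path_image g \<inter> K)" "path_image g \<inter> K \<noteq> {}" "card (path_image g \<inter> K) \<le> Suc m"
    and P: "finite P" "P \<inter> (K \<union> path_image g) = {}"
  shows "ncells (K \<union> path_image g) P \<le> ncells K P + m"
proof -
  define T where "T = {t \<in> {0..1}. g t \<in> K}"
  have gT: "g ` T = path_image g \<inter> K" by (auto simp: T_def path_image_def)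
  have injT: "inj_on g T" using g unfolding arc_def T_def by (auto intro: inj_on_subset)
  have "finite T" using gT assms(4) injT by (metis finite_imageD)
  moreover have cT: "card T = card (path_image g \<inter> K)" using gT injT by (metis card_image)
  moreover have "card T > 0" using cT assms(4,5) by (simp add: card_gt_0_iff)
  moreover obtain m' where "card T = Suc m'" using \<open>card T > 0\<close> by (cases "card T") auto
  ultimately have "ncells (K \<union> g ` {0..1}) P \<le> ncells K P + m'" "m' \<le> m"
    using ncells_add_arc_interval[OF g, of 0 1 K m' P] K P assms(6) by (auto simp: T_def path_image_def)
  then show ?thesis by (simp add: path_image_def)
qed

section \<open>Complete drawings\<close>

lemma jordan_curve_triangle:
  assumes "arc f" "arc g" "arc k" "pathstart f = a" "pathfinish f = u" "pathstart g = u" "pathfinish g = v"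
    "pathstart k = v" "pathfinish k = a" "a \<noteq> u" "u \<noteq> v" "v \<noteq> a"
    "path_image f \<inter> path_image g = {u}" "path_image g \<inter> path_image k = {v}" "path_image k \<inter> path_image f = {a}"
  shows "jordan_curve (path_image f \<union> path_image g \<union> path_image k)"
proof -
  have fg: "arc (f +++ g)" using assms by (intro arc_join) auto
  have im: "path_image (f +++ g) = path_image f \<union> path_image g"
    using assms by (simp add: path_image_join)
  have "simple_path ((f +++ g) +++ k)"
    by (rule simple_path_join_loop[OF fg]) (use assms im in auto)
  then show ?thesis
    unfolding jordan_curve_def using assms im
    by (intro exI[of _ "(f +++ g) +++ k"]) (simp add: path_image_join)
qed

lemma path_first_exit:
  fixes g :: "real \<Rightarrow> 'a::euclidean_space"
  assumes "path g" "g 0 = a" "r > 0" "dist a (g 1) > r"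
  shows "\<exists>t. 0 < t \<and> t < 1 \<and> dist a (g t) = r \<and> (\<forall>s. 0 \<le> s \<and> s < t \<longrightarrow> dist a (g s) < r)"
proof -
  obtain u where u: "0 \<le> u" "u \<le> 1" "\<And>x. 0 \<le> x \<and> x < u \<Longrightarrow> g x \<in> interior (ball a r)"
    "g u \<notin> interior (ball a r)" "u = 0 \<or> g u \<in> closure (ball a r)"
    using subpath_to_frontier_explicit[of g "ball a r"] assms by (auto simp: pathfinish_def)
  have "u \<noteq> 0" using u(4) assms by auto
  then have "dist a (g u) = r" using u(4,5) assms by auto
  moreover have "u \<noteq> 1" using calculation assms by auto
  ultimately show ?thesis using u \<open>u \<noteq> 0\<close> by (intro exI[of _ u]) (auto simp: less_le)
qed

lemma Int_singleton_trace: "S \<inter> T = {z} \<Longrightarrow> z \<notin> R \<Longrightarrow> (S \<inter> R) \<inter> (T \<inter> R) = {}"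
  by auto

lemma Int_singleton_notin: "S \<inter> T = {z} \<Longrightarrow> p \<in> S \<Longrightarrow> p \<noteq> z \<Longrightarrow> p \<notin> T"
  by auto

section \<open>Triangles spanned by the star of a vertex\<close>

locale complete_drawing =
  fixes V :: "complex set" and \<gamma> :: "complex \<Rightarrow> complex \<Rightarrow> real \<Rightarrow> complex" and a :: complex
  assumes finV: "finite V" and aV: "a \<in> V"
    and arcs: "\<And>u v. u \<in> V \<Longrightarrow> v \<in> V \<Longrightarrow> u \<noteq> v \<Longrightarrow> arc (\<gamma> u v) \<and> pathstart (\<gamma> u v) = u \<and> pathfinish (\<gamma> u v) = v"
    and image_sym: "\<And>u v. u \<in> V \<Longrightarrow> v \<in> V \<Longrightarrow> u \<noteq> v \<Longrightarrow> path_image (\<gamma> u v) = path_image (\<gamma> v u)"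
    and vertices: "\<And>u v. u \<in> V \<Longrightarrow> v \<in> V \<Longrightarrow> u \<noteq> v \<Longrightarrow> path_image (\<gamma> u v) \<inter> V = {u, v}"
    and adjacent: "\<And>u v w. u \<in> V \<Longrightarrow> v \<in> V \<Longrightarrow> w \<in> V \<Longrightarrow> distinct [u, v, w] \<Longrightarrow>
       path_image (\<gamma> u v) \<inter> path_image (\<gamma> u w) = {u}"
    and proper: "\<And>u v x y p. u \<in> V \<Longrightarrow> v \<in> V \<Longrightarrow> x \<in> V \<Longrightarrow> y \<in> V \<Longrightarrow> distinct [u, v, x, y] \<Longrightarrow>
       p \<in> path_image (\<gamma> u v) \<Longrightarrow> p \<in> path_image (\<gamma> x y) \<Longrightarrow> properly_cross_at (\<gamma> u v) (\<gamma> x y) p"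
    and once: "\<And>u v x y p q. u \<in> V \<Longrightarrow> v \<in> V \<Longrightarrow> x \<in> V \<Longrightarrow> y \<in> V \<Longrightarrow> distinct [u, v, x, y] \<Longrightarrow>
       p \<in> path_image (\<gamma> u v) \<inter> path_image (\<gamma> x y) \<Longrightarrow> q \<in> path_image (\<gamma> u v) \<inter> path_image (\<gamma> x y) \<Longrightarrow> p = q"
begin

definition U :: "complex set" where "U = V - {a}"

abbreviation P :: "complex \<Rightarrow> complex \<Rightarrow> complex set" where "P u v \<equiv> path_image (\<gamma> u v)"

definition J :: "complex \<Rightarrow> complex \<Rightarrow> complex set" where
  "J u v = P a u \<union> P u v \<union> P a v"

definition inn :: "complex \<Rightarrow> complex \<Rightarrow> complex \<Rightarrow> bool" where
  "inn u v x \<longleftrightarrow> x \<in> inside (J u v)"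

text \<open>The two orientations of an edge are known to have equal images only for vertices of the
  drawing; taking the union makes \<open>c\<close> and \<open>cr\<close> symmetric for all
  arguments, as the abstract system demands.\<close>

definition c :: "complex \<Rightarrow> complex \<Rightarrow> complex \<Rightarrow> bool" where
  "c x u v \<longleftrightarrow> P a x \<inter> (P u v \<union> P v u) \<noteq> {}"

definition cr :: "complex \<Rightarrow> complex \<Rightarrow> complex \<Rightarrow> complex \<Rightarrow> bool" where
  "cr u v x y \<longleftrightarrow> (P u v \<union> P v u) \<inter> (P x y \<union> P y x) \<noteq> {}"

lemma U_facts: "finite U" "a \<notin> U" "x \<in> U \<Longrightarrow> x \<in> V" "x \<in> U \<Longrightarrow> x \<noteq> a"
  using finV by (auto simp: U_def)

lemma c_iff: "u \<in> U \<Longrightarrow> v \<in> U \<Longrightarrow> u \<noteq> v \<Longrightarrow> c x u v \<longleftrightarrow> P a x \<inter> P u v \<noteq> {}"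
  using image_sym[of u v] by (simp add: c_def U_facts)

lemma cr_iff: "u \<in> U \<Longrightarrow> v \<in> U \<Longrightarrow> u \<noteq> v \<Longrightarrow> x \<in> U \<Longrightarrow> y \<in> U \<Longrightarrow> x \<noteq> y \<Longrightarrow>
    cr u v x y \<longleftrightarrow> P u v \<inter> P x y \<noteq> {}"
  using image_sym[of u v] image_sym[of x y] by (simp add: cr_def U_facts)

lemma compact_P: "u \<in> V \<Longrightarrow> v \<in> V \<Longrightarrow> u \<noteq> v \<Longrightarrow> compact (P u v)"
  using arcs compact_arc_image by blast

lemma ray_facts:
  assumes "u \<in> U"
  shows "arc (\<gamma> a u)" "\<gamma> a u 0 = a" "\<gamma> a u 1 = u" "a \<in> P a u" "u \<in> P a u" "compact (P a u)"
    "\<And>t. 0 \<le> t \<Longrightarrow> t \<le> 1 \<Longrightarrow> \<gamma> a u t = a \<Longrightarrow> t = 0"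
    "\<And>t. 0 \<le> t \<Longrightarrow> t \<le> 1 \<Longrightarrow> \<gamma> a u t \<in> P a u"
proof -
  have *: "arc (\<gamma> a u) \<and> pathstart (\<gamma> a u) = a \<and> pathfinish (\<gamma> a u) = u"
    using arcs[of a u] aV assms U_facts by auto
  then show "arc (\<gamma> a u)" and 0: "\<gamma> a u 0 = a" "\<gamma> a u 1 = u" by (auto simp: pathstart_def pathfinish_def)
  show "a \<in> P a u" "u \<in> P a u" using * pathstart_in_path_image pathfinish_in_path_image by metis+
  show "compact (P a u)" using * compact_arc_image by blast
  show "t = 0" if "0 \<le> t" "t \<le> 1" "\<gamma> a u t = a" for t
    using * 0 that unfolding arc_def by (auto dest: inj_onD[of _ _ t 0])
  show "\<gamma> a u t \<in> P a u" if "0 \<le> t" "t \<le> 1" for t using that by (auto simp: path_image_def)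
qed

lemma rays_meet: "u \<in> U \<Longrightarrow> v \<in> U \<Longrightarrow> u \<noteq> v \<Longrightarrow> P a u \<inter> P a v = {a}"
  using adjacent[of a u v] aV U_facts by auto

lemma ray_edge: "u \<in> U \<Longrightarrow> v \<in> U \<Longrightarrow> u \<noteq> v \<Longrightarrow> P a u \<inter> P u v = {u}"
  using adjacent[of u a v] image_sym[of a u] aV U_facts by auto

lemma ray_edge': "u \<in> U \<Longrightarrow> v \<in> U \<Longrightarrow> u \<noteq> v \<Longrightarrow> P a v \<inter> P u v = {v}"
  using ray_edge[of v u] image_sym[of u v] U_facts by auto

lemma edge_vertices:
  assumes "u \<in> V" "v \<in> V" "u \<noteq> v" "x \<in> V" "x \<noteq> u" "x \<noteq> v"
  shows "x \<notin> P u v"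
proof
  assume "x \<in> P u v"
  then have "x \<in> P u v \<inter> V" using assms(4) by (rule IntI)
  then show False unfolding vertices[OF assms(1-3)] using assms(5,6) by simp
qed

lemma center_notin_edge: "u \<in> U \<Longrightarrow> v \<in> U \<Longrightarrow> u \<noteq> v \<Longrightarrow> a \<notin> P u v"
  by (intro edge_vertices) (use aV in \<open>auto simp: U_def\<close>)

lemma vertex_notin_edge: "u \<in> U \<Longrightarrow> v \<in> U \<Longrightarrow> x \<in> U \<Longrightarrow> distinct [u, v, x] \<Longrightarrow> x \<notin> P u v \<and> x \<notin> P a u"
  by (intro conjI edge_vertices) (use aV in \<open>auto simp: U_def\<close>)

lemma jordan_J:
  assumes "u \<in> U" "v \<in> U" "u \<noteq> v"
  shows "jordan_curve (J u v)"
proof -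
  have e: "arc (\<gamma> u v) \<and> pathstart (\<gamma> u v) = u \<and> pathfinish (\<gamma> u v) = v"
    "arc (\<gamma> a u) \<and> pathstart (\<gamma> a u) = a \<and> pathfinish (\<gamma> a u) = u"
    "arc (\<gamma> v a) \<and> pathstart (\<gamma> v a) = v \<and> pathfinish (\<gamma> v a) = a"
    using assms arcs aV U_facts by auto
  have s: "P v a = P a v" using assms aV U_facts by (intro image_sym) auto
  have "jordan_curve (P a u \<union> P u v \<union> P v a)"
    by (rule jordan_curve_triangle[of _ _ _ a u v])
      (use e s assms U_facts ray_edge[OF assms] ray_edge'[OF assms] rays_meet[OF assms] in auto)
  then show ?thesis by (simp add: J_def s)
qed

text \<open>The ray to \<open>u\<close> without \<open>a\<close>, joined to the edge
  \<open>pq\<close> at their crossing, is a connected set that contains \<open>u\<close> and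
  \<open>p\<close> and misses the triangle over \<open>xy\<close>.\<close>

lemma inn_ray_side:
  assumes "x \<in> U" "y \<in> U" "p \<in> U" "q \<in> U" "u \<in> U" "distinct [x, y, p, q, u]" "c u p q" "\<not> c u x y"
    "\<not> c x p q" "\<not> c y p q" "\<not> cr x y p q"
  shows "inn x y u = inn x y p"
proof -
  have conn: "connected (\<gamma> a u ` {0<..1})"
    using ray_facts(1)[OF assms(5)] continuous_on_subset[of "{0..1}" "\<gamma> a u" "{0<..1}"]
      connected_continuous_image[of "{0<..1}" "\<gamma> a u"] by (simp add: arc_def path_def subset_iff)
  have S: "\<gamma> a u ` {0<..1} = P a u - {a}"
  proof
    show "\<gamma> a u ` {0<..1} \<subseteq> P a u - {a}"
    proof
      fix z assume "z \<in> \<gamma> a u ` {0<..1}"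
      then obtain t where "0 < t" "t \<le> 1" "z = \<gamma> a u t" by auto
      then show "z \<in> P a u - {a}" using ray_facts(7,8)[OF assms(5), of t] by auto
    qed
    show "P a u - {a} \<subseteq> \<gamma> a u ` {0<..1}"
    proof
      fix z assume z: "z \<in> P a u - {a}"
      then obtain t where t: "0 \<le> t" "t \<le> 1" "z = \<gamma> a u t" by (auto simp: path_image_def)
      then have "t \<noteq> 0" using z ray_facts(2)[OF assms(5)] by auto
      then show "z \<in> \<gamma> a u ` {0<..1}" using t by auto
    qed
  qed
  have pV: "p \<in> V" "q \<in> V" "p \<noteq> q" using assms U_facts(3) by auto
  have "connected (P p q)" using arcs[OF pV] connected_arc_image by blast
  moreover have "(P a u - {a}) \<inter> P p q \<noteq> {}"
  proof -
    have "P a u \<inter> P p q \<noteq> {}" using assms c_iff[of p q u] by simp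
    moreover have "a \<notin> P p q" using center_notin_edge[of p q] assms by simp
    ultimately show ?thesis by blast
  qed
  ultimately have "connected ((P a u - {a}) \<union> P p q)"
    using connected_Un[OF conn[unfolded S]] by blast
  moreover have "((P a u - {a}) \<union> P p q) \<inter> J x y = {}"
  proof -
    have e: "P p q \<inter> P a x = {}" "P p q \<inter> P a y = {}" "P a u \<inter> P x y = {}" "P p q \<inter> P x y = {}"
      unfolding Int_commute[of "P p q"]
      using assms c_iff[of p q x] c_iff[of p q y] c_iff[of x y u] cr_iff[of x y p q] by simp_all
    have "P a u \<inter> P a x = {a}" "P a u \<inter> P a y = {a}"
      by (rule rays_meet; use assms in auto)+
    then have "(P a u - {a}) \<inter> P a x = {}" "(P a u - {a}) \<inter> P a y = {}" using ray_facts(4)[OF assms(1)] ray_facts(4)[OF assms(2)] by (simp_all add: Diff_Int_distrib2)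
    moreover have "(P a u - {a}) \<inter> P x y = {}" using e(3) by (simp add: Diff_Int_distrib2)
    ultimately show ?thesis using e by (simp add: J_def Int_Un_distrib Int_Un_distrib2)
  qed
  moreover have "u \<in> P a u - {a}" using ray_facts(5)[OF assms(5)] U_facts(4)[OF assms(5)] by blast
  moreover have "p \<in> P p q" using arcs[OF pV] pathstart_in_path_image[of "\<gamma> p q"] by simp
  ultimately show ?thesis unfolding inn_def
    using inside_const_on_connected[of "(P a u - {a}) \<union> P p q" "J x y" u p] by blast
qed

lemma edges_meet_card:
  assumes "u \<in> V" "v \<in> V" "x \<in> V" "y \<in> V" "distinct [u, v, x, y]"
  shows "finite (P u v \<inter> P x y)" "card (P u v \<inter> P x y) = of_bool (P u v \<inter> P x y \<noteq> {})"
proof -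
  have "\<exists>p. P u v \<inter> P x y \<subseteq> {p}"
    using once[OF assms] by (cases "P u v \<inter> P x y = {}") blast+
  then obtain p where "P u v \<inter> P x y \<subseteq> {p}" ..
  then have "P u v \<inter> P x y = {} \<or> P u v \<inter> P x y = {p}" by blast
  then show "finite (P u v \<inter> P x y)" "card (P u v \<inter> P x y) = of_bool (P u v \<inter> P x y \<noteq> {})" by auto
qed

text \<open>The edge \<open>xy\<close> meets each side of the triangle at most once and avoids its
  corners, so the number of hits is the sum of three indicators. Near a hit the triangle is a single
  side, the other two being closed and not containing the hit.\<close>

lemma inn_edge_parity:
  assumes "u \<in> U" "v \<in> U" "x \<in> U" "y \<in> U" "distinct [u, v, x, y]"
  shows "(inn u v x \<noteq> inn u v y) = (c u x y \<noteq> (c v x y \<noteq> cr u v x y))"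
proof -
  have V: "u \<in> V" "v \<in> V" "x \<in> V" "y \<in> V" "a \<noteq> u" "a \<noteq> v" "a \<noteq> x" "a \<noteq> y" using assms U_facts by auto
  have ne: "v \<noteq> u" "x \<noteq> u" "y \<noteq> u" "x \<noteq> v" "y \<noteq> v" "y \<noteq> x" using assms(5) by auto
  have g: "arc (\<gamma> x y)" "\<gamma> x y 0 = x" "\<gamma> x y 1 = y"
    using arcs[of x y] V assms by (auto simp: pathstart_def pathfinish_def)
  define A where "A = P a u \<inter> P x y"
  define B where "B = P a v \<inter> P x y"
  define C where "C = P u v \<inter> P x y"
  have ends: "x \<notin> J u v" "y \<notin> J u v"
    using assms vertex_notin_edge[of u v x] vertex_notin_edge[of u v y] vertex_notin_edge[of v u x] vertex_notin_edge[of v u y] ne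
    by (simp_all add: J_def)
  have cA: "finite A" "card A = of_bool (c u x y)"
    unfolding A_def using edges_meet_card[of a u x y] V aV assms ne c_iff[of x y u] by simp_all
  have cB: "finite B" "card B = of_bool (c v x y)"
    unfolding B_def using edges_meet_card[of a v x y] V aV assms ne c_iff[of x y v] by simp_all
  have cC: "finite C" "card C = of_bool (cr u v x y)"
    unfolding C_def using edges_meet_card[of u v x y] V aV assms ne cr_iff[of u v x y] by simp_all
  have nv: "a \<notin> P x y" "u \<notin> P x y" "v \<notin> P x y"
    using assms ne center_notin_edge[of x y] vertex_notin_edge[of x y u] vertex_notin_edge[of x y v] by simp_all
  have disj: "A \<inter> B = {}" "A \<inter> C = {}" "B \<inter> C = {}"
    unfolding A_def B_def C_def
    using Int_singleton_trace[OF rays_meet nv(1), of u v] Int_singleton_trace[OF ray_edge nv(2), of v]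
      Int_singleton_trace[OF ray_edge' nv(3), of u] assms ne by simp_all
  define X where "X = {t \<in> {0..1}. \<gamma> x y t \<in> J u v}"
  have "\<gamma> x y ` X = P x y \<inter> J u v" by (auto simp: X_def path_image_def)
  also have "\<dots> = A \<union> B \<union> C" by (auto simp: J_def A_def B_def C_def)
  finally have im: "\<gamma> x y ` X = A \<union> B \<union> C" .
  have injX: "inj_on (\<gamma> x y) X"
    using g(1) inj_on_subset[of "\<gamma> x y" "{0..1}" X] by (simp add: arc_def X_def subset_iff)
  have finX: "finite X" using im cA cB cC injX by (metis finite_UnI finite_imageD)
  have "card X = card (A \<union> B \<union> C)" using im injX by (metis card_image)
  also have "\<dots> = card (A \<union> B) + card C" using cA cB cC disj by (intro card_Un_disjoint) auto
  also have "card (A \<union> B) = card A + card B" using cA cB disj by (intro card_Un_disjoint) auto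
  finally have X: "finite X" "card X = card A + card B + card C" using finX by auto
  have "((\<gamma> x y 0 \<in> inside (J u v)) \<noteq> (\<gamma> x y 1 \<in> inside (J u v))) = odd (card X)"
    unfolding X_def
  proof (rule arc_jordan_parity[OF jordan_J[OF assms(1,2)] g(1)])
    fix t assume t: "(0::real) < t" "t < 1" "\<gamma> x y t \<in> J u v"
    define p where "p = \<gamma> x y t"
    have pxy: "p \<in> P x y" using t by (auto simp: p_def path_image_def)
    have pnv: "p \<noteq> a" "p \<noteq> u" "p \<noteq> v" using pxy nv by auto
    have cl: "closed (P a u)" "closed (P a v)" "closed (P u v)"
      using V aV assms ne compact_P[of a u] compact_P[of a v] compact_P[of u v] by (simp_all add: compact_imp_closed)
    consider "p \<in> P a u" | "p \<in> P a v" | "p \<in> P u v" using t by (auto simp: J_def p_def)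
    then show "\<exists>f N. properly_cross_at (\<gamma> x y) f (\<gamma> x y t) \<and> open N \<and> \<gamma> x y t \<in> N \<and> J u v \<inter> N = path_image f \<inter> N"
    proof cases
      case 1
      have "properly_cross_at (\<gamma> x y) (\<gamma> a u) p" using 1 pxy V aV assms ne by (intro proper) simp_all
      moreover have "p \<in> - (P a v \<union> P u v)"
        using Int_singleton_notin[OF rays_meet[of u v] 1] Int_singleton_notin[OF ray_edge[of u v] 1] pnv assms ne by simp
      moreover have "open (- (P a v \<union> P u v))" using cl by (intro open_Compl closed_Un)
      moreover have "J u v \<inter> - (P a v \<union> P u v) = P a u \<inter> - (P a v \<union> P u v)" by (auto simp: J_def)
      ultimately show ?thesis unfolding p_def by blast
    next
      case 2
      have "properly_cross_at (\<gamma> x y) (\<gamma> a v) p" using 2 pxy V aV assms ne by (intro proper) simp_all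
      moreover have "p \<in> - (P a u \<union> P u v)"
        using Int_singleton_notin[OF rays_meet[of v u] 2] Int_singleton_notin[OF ray_edge'[of u v] 2] pnv assms ne by simp
      moreover have "open (- (P a u \<union> P u v))" using cl by (intro open_Compl closed_Un)
      moreover have "J u v \<inter> - (P a u \<union> P u v) = P a v \<inter> - (P a u \<union> P u v)" by (auto simp: J_def)
      ultimately show ?thesis unfolding p_def by blast
    next
      case 3
      have "properly_cross_at (\<gamma> x y) (\<gamma> u v) p" using 3 pxy V aV assms ne by (intro proper) simp_all
      moreover have "p \<in> - (P a u \<union> P a v)"
        using Int_singleton_notin[of "P u v" "P a u" u p] Int_singleton_notin[of "P u v" "P a v" v p] 3 pnv
          ray_edge[of u v] ray_edge'[of u v] assms by (simp add: Int_commute)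
      moreover have "open (- (P a u \<union> P a v))" using cl by (intro open_Compl closed_Un)
      moreover have "J u v \<inter> - (P a u \<union> P a v) = P u v \<inter> - (P a u \<union> P a v)" by (auto simp: J_def)
      ultimately show ?thesis unfolding p_def by blast
    qed
  qed (use assms X(1) X_def g ends in auto)
  then show ?thesis unfolding inn_def using g X(2) cA cB cC by auto
qed

end

section \<open>Edges that cross each other's rays\<close>

lemma arc_inj: "arc g \<Longrightarrow> g s = g t \<Longrightarrow> 0 \<le> s \<Longrightarrow> s \<le> 1 \<Longrightarrow> 0 \<le> t \<Longrightarrow> t \<le> (1::real) \<Longrightarrow> s = t"
  unfolding arc_def by (auto dest: inj_onD)

context complete_drawing
begin

text \<open>
  If \<open>xy\<close> crosses the rays to \<open>p\<close> and \<open>q\<close> but not the edge \<open>pq\<close>, then the pieces between the crossings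
  form a Jordan curve which leaves \<open>a\<close> and \<open>x\<close> on the same side, so that the ray to \<open>x\<close> cannot
  cross \<open>pq\<close>.
\<close>

lemma mutual_crossing_ordered:
  assumes U: "x \<in> U" "y \<in> U" "p \<in> U" "q \<in> U" "distinct [x, y, p, q]"
    and ncr: "P x y \<inter> P p q = {}"
    and s: "0 < s" "s < s'" "s' < 1" and t: "0 < t" "t < 1" and t': "0 < t'" "t' < 1"
    and \<alpha>: "\<gamma> x y s = \<gamma> a p t" and \<beta>: "\<gamma> x y s' = \<gamma> a q t'"
  shows "P a x \<inter> P p q = {}"
proof (rule ccontr)
  assume "P a x \<inter> P p q \<noteq> {}"
  then obtain z where z: "z \<in> P a x" "z \<in> P p q" by blast
  have V: "x \<in> V" "y \<in> V" "p \<in> V" "q \<in> V" "a \<in> V" using U(1-4) U_facts(3) aV by auto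
  have ne: "a \<noteq> x" "a \<noteq> y" "a \<noteq> p" "a \<noteq> q" "x \<noteq> y" "x \<noteq> p" "x \<noteq> q" "y \<noteq> p" "y \<noteq> q" "p \<noteq> q"
    "p \<noteq> x" "q \<noteq> x" "q \<noteq> p" "p \<noteq> y" "q \<noteq> y"
    using U U_facts(4) by auto
  have e: "arc (\<gamma> x y)" "\<gamma> x y 0 = x"
    using arcs[OF V(1,2)] ne by (auto simp: pathstart_def)
  have pq: "arc (\<gamma> p q)" "pathstart (\<gamma> p q) = p" "pathfinish (\<gamma> p q) = q"
    using arcs[OF V(3,4)] ne by auto
  note fp = ray_facts[OF U(3)] and fq = ray_facts[OF U(4)] and fx = ray_facts[OF U(1)]
  have eP: "\<gamma> x y \<tau> \<in> P x y" if "0 \<le> \<tau>" "\<tau> \<le> 1" for \<tau> using that by (auto simp: path_image_def)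
  define F where "F = \<gamma> a p ` {t..1}"
  define G where "G = \<gamma> a q ` {t'..1}"
  define E where "E = \<gamma> x y ` {s..s'}"
  \<comment> \<open>The loop runs from \<open>\<gamma> x y s\<close> along the rest of the ray to
    \<open>p\<close>, along \<open>pq\<close>, back along the ray to \<open>q\<close> as far as
    \<open>\<gamma> x y s'\<close>, and back along \<open>xy\<close>.\<close>
  define L where "L = F \<union> P p q \<union> (G \<union> E)"
  have sub: "F \<subseteq> P a p" "G \<subseteq> P a q" "E \<subseteq> P x y"
    using fp(8) fq(8) eP s t t' by (auto simp: F_def G_def E_def)
  have aFG: "a \<notin> F" "a \<notin> G"
  proof -
    show "a \<notin> F"
    proof
      assume "a \<in> F"
      then obtain \<tau> where "t \<le> \<tau>" "\<tau> \<le> 1" "\<gamma> a p \<tau> = a" unfolding F_def by fastforce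
      then show False using fp(7)[of \<tau>] t by simp
    qed
    show "a \<notin> G"
    proof
      assume "a \<in> G"
      then obtain \<tau> where "t' \<le> \<tau>" "\<tau> \<le> 1" "\<gamma> a q \<tau> = a" unfolding G_def by fastforce
      then show False using fq(7)[of \<tau>] t' by simp
    qed
  qed
  have sin: "\<gamma> x y s \<in> P x y" "\<gamma> x y s' \<in> P x y" using eP[of s] eP[of s'] s by simp_all
  have tin: "\<gamma> x y s \<in> P a p" "\<gamma> x y s' \<in> P a q" unfolding \<alpha> \<beta> using fp(8)[of t] fq(8)[of t'] t t' by simp_all
  have only_\<alpha>: "w = \<gamma> x y s" if "w \<in> P a p" "w \<in> P x y" for w
    by (rule once[of a p x y]) (use V ne that sin tin in simp_all)
  have only_\<beta>: "w = \<gamma> x y s'" if "w \<in> P a q" "w \<in> P x y" for w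
    by (rule once[of a q x y]) (use V ne that sin tin in simp_all)
  have rays: "P a p \<inter> P a q = {a}" "P a x \<inter> P a p = {a}" "P a x \<inter> P a q = {a}"
    using rays_meet[OF U(3,4)] rays_meet[OF U(1,3)] rays_meet[OF U(1,4)] ne by simp_all
  have re: "P a p \<inter> P p q = {p}" "P a q \<inter> P p q = {q}" "P a x \<inter> P x y = {x}"
    using ray_edge[OF U(3,4)] ray_edge'[OF U(3,4)] ray_edge[OF U(1,2)] ne by simp_all
  have "F \<inter> G \<subseteq> {a}" using Int_mono[OF sub(1,2)] rays(1) by simp
  then have FG: "F \<inter> G = {}" using aFG by blast
  have FE: "F \<inter> E \<subseteq> {\<gamma> x y s}" using sub only_\<alpha> by blast
  have GE: "G \<inter> E \<subseteq> {\<gamma> x y s'}" using sub only_\<beta> by blast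
  have FQ: "F \<inter> P p q \<subseteq> {p}" using Int_mono[OF sub(1) order_refl, of "P p q"] re(1) by simp
  have GQ: "P p q \<inter> G \<subseteq> {q}" using Int_mono[OF sub(2) order_refl, of "P p q"] re(2) by (simp add: Int_commute)
  have QE: "P p q \<inter> E = {}" using sub ncr by blast
  have jL: "jordan_curve L"
  proof -
    define A1 where "A1 = subpath t 1 (\<gamma> a p)"
    define A3 where "A3 = subpath 1 t' (\<gamma> a q)"
    define A4 where "A4 = subpath s' s (\<gamma> x y)"
    have a1: "arc A1" unfolding A1_def using fp(1) t by (intro arc_subpath_arc) auto
    have a3: "arc A3" unfolding A3_def using fq(1) t' by (intro arc_subpath_arc) auto
    have a4: "arc A4" unfolding A4_def using e(1) s by (intro arc_subpath_arc) auto
    have ends: "pathstart A1 = \<gamma> x y s" "pathfinish A1 = p" "pathstart A3 = q" "pathfinish A3 = \<gamma> x y s'"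
      "pathstart A4 = \<gamma> x y s'" "pathfinish A4 = \<gamma> x y s"
      using \<alpha> \<beta> fp(3) fq(3) by (simp_all add: A1_def A3_def A4_def)
    have im: "path_image A1 = F" "path_image A3 = G" "path_image A4 = E"
      using s t t' by (simp_all add: A1_def A3_def A4_def F_def G_def E_def path_image_subpath)
    have b1: "arc (A1 +++ \<gamma> p q)" using a1 pq ends im FQ by (intro arc_join) auto
    have b2: "arc (A3 +++ A4)" using a3 a4 ends im GE by (intro arc_join) auto
    have i1: "path_image (A1 +++ \<gamma> p q) = F \<union> P p q" using pq ends im by (simp add: path_image_join)
    have i2: "path_image (A3 +++ A4) = G \<union> E" using ends im by (simp add: path_image_join)
    have "(F \<union> P p q) \<inter> (G \<union> E) \<subseteq> {\<gamma> x y s, q}" using FG FE GQ QE by blast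
    then have "simple_path ((A1 +++ \<gamma> p q) +++ (A3 +++ A4))"
      using b1 b2 pq ends i1 i2 by (intro simple_path_join_loop) auto
    moreover have "path_image ((A1 +++ \<gamma> p q) +++ (A3 +++ A4)) = L"
      using pq ends i1 i2 by (simp add: path_image_join L_def)
    ultimately show ?thesis
      unfolding jordan_curve_def using ends by (intro exI[of _ "(A1 +++ \<gamma> p q) +++ (A3 +++ A4)"]) simp
  qed
  have compF: "compact F" unfolding F_def using arc_interval_topology(1)[OF fp(1), of t 1] t by simp
  have compG: "compact G" unfolding G_def using arc_interval_topology(1)[OF fq(1), of t' 1] t' by simp
  have compE: "compact E" unfolding E_def using arc_interval_topology(1)[OF e(1), of s s'] s by simp
  have clQ: "closed (P p q)" using compact_P[OF V(3,4)] ne compact_imp_closed by blast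
  define N where "N = - (P p q \<union> G)"
  have N: "open N" unfolding N_def by (intro open_Compl closed_Un clQ compact_imp_closed[OF compG])
  have \<alpha>N: "\<gamma> x y s \<in> N"
  proof -
    have "\<gamma> x y s \<notin> P p q" using eP[of s] ncr s by auto
    moreover have "\<gamma> x y s \<noteq> \<gamma> x y s'" using arc_inj[OF e(1), of s s'] s by auto
    then have "\<gamma> x y s \<notin> G" using only_\<beta>[of "\<gamma> x y s"] sub(2) eP[of s] s by auto
    ultimately show ?thesis by (simp add: N_def)
  qed
  \<comment> \<open>A walk from \<open>x\<close> to \<open>a\<close> off the loop: along
    \<open>xy\<close> until just before the crossing, through the quadrant \<open>H\<close> to the
    ray to \<open>p\<close> just before the crossing, and along that ray to
    \<open>a\<close>.\<close>
  have "properly_cross_at (\<gamma> x y) (\<gamma> a p) (\<gamma> x y s)"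
    by (rule proper) (use V ne eP[of s] fp(8)[of t] s t \<alpha> in auto)
  then obtain s0 t0 H where H: "connected H" "H \<subseteq> N" "0 < s0" "s0 < s" "\<gamma> x y s0 \<in> H" "0 < t0" "t0 < t"
    "\<gamma> a p t0 \<in> H" "H \<inter> \<gamma> x y ` {s..1} = {}" "H \<inter> \<gamma> a p ` {t..1} = {}"
    by (rule crossing_hop[of "\<gamma> x y" "\<gamma> a p" "\<gamma> x y s" s t N])
      (use e fp(1) s t \<alpha> N \<alpha>N in \<open>auto simp del: greaterThanLessThan_iff simp: greaterThanLessThan_iff\<close>)
  define S1 where "S1 = \<gamma> x y ` {0..s0}"
  define S2 where "S2 = \<gamma> a p ` {0..t0}"
  have c1: "connected S1" unfolding S1_def using arc_interval_topology(2)[OF e(1), of 0 s0] H s path_connected_imp_connected by auto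
  have c2: "connected S2" unfolding S2_def using arc_interval_topology(2)[OF fp(1), of 0 t0] H t path_connected_imp_connected by auto
  have "\<gamma> x y s0 \<in> S1" "\<gamma> a p t0 \<in> S2" using H(3,6) by (auto simp: S1_def S2_def)
  then have "S1 \<inter> H \<noteq> {}" "H \<inter> S2 \<noteq> {}" using H(5,8) by blast+
  then have conn: "connected (S1 \<union> H \<union> S2)"
    using connected_Un[OF c1 H(1)] connected_Un[of "S1 \<union> H" S2] c2 by blast
  have S1P: "S1 \<subseteq> P x y" using eP H s by (auto simp: S1_def)
  have S2P: "S2 \<subseteq> P a p" using fp(8) H t by (auto simp: S2_def)
  have S1n: "\<gamma> x y \<tau> \<notin> S1" if "s \<le> \<tau>" "\<tau> \<le> 1" for \<tau>
  proof
    assume "\<gamma> x y \<tau> \<in> S1"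
    then obtain \<tau>' where "0 \<le> \<tau>'" "\<tau>' \<le> s0" "\<gamma> x y \<tau> = \<gamma> x y \<tau>'" by (auto simp: S1_def)
    then show False using arc_inj[OF e(1), of \<tau> \<tau>'] that H s by auto
  qed
  have S2n: "\<gamma> a p \<tau> \<notin> S2" if "t \<le> \<tau>" "\<tau> \<le> 1" for \<tau>
  proof
    assume "\<gamma> a p \<tau> \<in> S2"
    then obtain \<tau>' where "0 \<le> \<tau>'" "\<tau>' \<le> t0" "\<gamma> a p \<tau> = \<gamma> a p \<tau>'" by (auto simp: S2_def)
    then show False using arc_inj[OF fp(1), of \<tau> \<tau>'] that H t by auto
  qed
  have "S1 \<inter> F \<subseteq> {\<gamma> x y s}" "S1 \<inter> G \<subseteq> {\<gamma> x y s'}" "S2 \<inter> E \<subseteq> {\<gamma> x y s}"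
    using only_\<alpha> only_\<beta> S1P S2P sub by blast+
  moreover have "\<gamma> x y s \<notin> S1" "\<gamma> x y s' \<notin> S1" "\<gamma> x y s \<notin> S2"
    using S1n[of s] S1n[of s'] S2n[of t] s t \<alpha> by auto
  ultimately have SL: "S1 \<inter> F = {}" "S1 \<inter> G = {}" "S2 \<inter> E = {}" by blast+
  have "S2 \<inter> P p q \<subseteq> {p}" "S2 \<inter> G \<subseteq> {a}"
    using Int_mono[OF S2P order_refl, of "P p q"] Int_mono[OF S2P sub(2)] re(1) rays(1) by simp_all
  moreover have "p \<notin> S2" using S2n[of 1] fp(3) t by simp
  ultimately have SL2: "S2 \<inter> P p q = {}" "S2 \<inter> G = {}" using aFG(2) by blast+
  have HE: "H \<inter> E = {}"
  proof -
    have "E \<subseteq> \<gamma> x y ` {s..1}" unfolding E_def using s by (intro image_mono) simp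
    then show ?thesis using H(9) by blast
  qed
  have "S1 \<inter> P p q = {}" using S1P ncr by blast
  moreover have "S1 \<inter> E = {}" using S1n s by (auto simp: E_def)
  moreover have "S2 \<inter> F = {}" using S2n by (auto simp: F_def)
  moreover have "H \<inter> F = {}" using H(10) by (simp add: F_def)
  moreover have "H \<inter> (P p q \<union> G) = {}" using H(2) by (auto simp: N_def)
  ultimately have "(S1 \<union> H \<union> S2) \<inter> L = {}"
    unfolding L_def using SL SL2 HE by (simp add: Int_Un_distrib Int_Un_distrib2)
  moreover have "x \<in> S1" using e(2) H by (force simp: S1_def)
  moreover have "a \<in> S2" using fp(2) H by (force simp: S2_def)
  ultimately have same: "x \<in> inside L \<longleftrightarrow> a \<in> inside L"
    using inside_const_on_connected[OF conn] by blast
  have xE: "x \<notin> E"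
  proof
    assume "x \<in> E"
    then obtain \<tau> where "s \<le> \<tau>" "\<tau> \<le> s'" "x = \<gamma> x y \<tau>" by (auto simp: E_def)
    then show False using S1n[of \<tau>] \<open>x \<in> S1\<close> s by auto
  qed
  have "P a x \<inter> F \<subseteq> {a}" "P a x \<inter> G \<subseteq> {a}" "P a x \<inter> E \<subseteq> {x}"
    using Int_mono[OF order_refl sub(1), of "P a x"] Int_mono[OF order_refl sub(2), of "P a x"]
      Int_mono[OF order_refl sub(3), of "P a x"] rays(2,3) re(3) by simp_all
  then have PxL: "P a x \<inter> F = {}" "P a x \<inter> G = {}" "P a x \<inter> E = {}" using aFG xE by blast+
  have "a \<notin> P p q" "a \<notin> P x y" using center_notin_edge[OF U(3,4)] center_notin_edge[OF U(1,2)] ne by simp_all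
  then have aL: "a \<notin> L" using aFG sub(3) by (auto simp: L_def)
  have "x \<notin> P p q" using vertex_notin_edge[OF U(3,4,1)] ne by simp
  then have xL: "x \<notin> L" using PxL fx(5) by (auto simp: L_def)
  \<comment> \<open>Apart from its ends, which are off the loop, the ray to \<open>x\<close> shares
    no point with the rays to \<open>p\<close> and \<open>q\<close> or with \<open>xy\<close>. It
    therefore meets the loop only on \<open>pq\<close>, exactly once, and would have to end on the
    other side.\<close>
  define X where "X = {\<tau> \<in> {0..1}. \<gamma> a x \<tau> \<in> L}"
  obtain \<tau>z where \<tau>z: "0 \<le> \<tau>z" "\<tau>z \<le> 1" "z = \<gamma> a x \<tau>z" using z(1) by (auto simp: path_image_def)
  have XQ: "\<gamma> a x \<tau> \<in> P p q" if "\<tau> \<in> X" for \<tau>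
    using that PxL fx(8)[of \<tau>] by (auto simp: X_def L_def)
  have "X = {\<tau>z}"
  proof (rule set_eqI)
    fix \<tau>
    show "\<tau> \<in> X \<longleftrightarrow> \<tau> \<in> {\<tau>z}"
    proof
      assume \<tau>: "\<tau> \<in> X"
      then have \<tau>01: "0 \<le> \<tau>" "\<tau> \<le> 1" by (auto simp: X_def)
      have "\<gamma> a x \<tau> = z" by (rule once[of a x p q]) (use V ne z XQ[OF \<tau>] fx(8)[OF \<tau>01] in auto)
      then show "\<tau> \<in> {\<tau>z}" using arc_inj[OF fx(1), of \<tau> \<tau>z] \<tau>01 \<tau>z by simp
    next
      assume "\<tau> \<in> {\<tau>z}"
      then show "\<tau> \<in> X" using \<tau>z z by (auto simp: X_def L_def)
    qed
  qed
  then have cX: "finite X" "card X = 1" by auto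
  have "((\<gamma> a x 0 \<in> inside L) \<noteq> (\<gamma> a x 1 \<in> inside L)) = odd (card X)"
    unfolding X_def
  proof (rule arc_jordan_parity[OF jL fx(1)])
    fix \<tau> assume \<tau>: "(0::real) < \<tau>" "\<tau> < 1" "\<gamma> a x \<tau> \<in> L"
    then have Q: "\<gamma> a x \<tau> \<in> P p q" "\<gamma> a x \<tau> \<in> P a x" using XQ[of \<tau>] fx(8)[of \<tau>] by (auto simp: X_def)
    have "properly_cross_at (\<gamma> a x) (\<gamma> p q) (\<gamma> a x \<tau>)" by (rule proper) (use V ne Q in auto)
    moreover have "open (- (F \<union> G \<union> E))" using compF compG compE by (intro open_Compl closed_Un compact_imp_closed)
    moreover have "\<gamma> a x \<tau> \<in> - (F \<union> G \<union> E)" using Q PxL by auto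
    moreover have "L \<inter> - (F \<union> G \<union> E) = P p q \<inter> - (F \<union> G \<union> E)" by (auto simp: L_def)
    ultimately show "\<exists>f N. properly_cross_at (\<gamma> a x) f (\<gamma> a x \<tau>) \<and> open N \<and> \<gamma> a x \<tau> \<in> N \<and> L \<inter> N = path_image f \<inter> N"
      by blast
  qed (use cX X_def fx aL xL in auto)
  then show False using same cX fx by simp
qed

text \<open>Orders the two crossings along \<open>xy\<close>; if the ray to \<open>q\<close> is
  crossed first, \<open>p\<close> and \<open>q\<close> change roles. The crossings are distinct
  because two rays share only \<open>a\<close>.\<close>

lemma mutual_rays_cross:
  assumes U: "x \<in> U" "y \<in> U" "p \<in> U" "q \<in> U" "distinct [x, y, p, q]"
    and c: "c p x y" "c q x y" "c x p q"
  shows "cr x y p q"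
proof (rule ccontr)
  assume "\<not> cr x y p q"
  then have ncr: "P x y \<inter> P p q = {}" using cr_iff[of x y p q] U by simp
  have V: "x \<in> V" "y \<in> V" using U(1,2) U_facts(3) by auto
  have e: "\<gamma> x y 0 = x" "\<gamma> x y 1 = y"
    using arcs[OF V] U(5) by (auto simp: pathstart_def pathfinish_def)
  have param: "\<exists>s t. 0 < s \<and> s < 1 \<and> 0 < t \<and> t < 1 \<and> \<gamma> x y s = \<gamma> a w t"
    if w: "w \<in> U" "w \<noteq> x" "w \<noteq> y" "c w x y" for w
  proof -
    have "P a w \<inter> P x y \<noteq> {}" using c_iff[of x y w] U w by simp
    then obtain z where z: "z \<in> P a w" "z \<in> P x y" by blast
    obtain s where s: "s \<in> {0..1}" "z = \<gamma> x y s" using z(2) unfolding path_image_def by blast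
    obtain t where t: "t \<in> {0..1}" "z = \<gamma> a w t" using z(1) unfolding path_image_def by blast
    have st: "0 \<le> s" "s \<le> 1" "0 \<le> t" "t \<le> 1" "\<gamma> x y s = \<gamma> a w t" using s t by auto
    note fw = ray_facts[OF w(1)]
    have xy: "x \<notin> P a w" "y \<notin> P a w" "w \<notin> P x y" "a \<notin> P x y"
      using edge_vertices[of a w x] edge_vertices[of a w y] edge_vertices[of x y w] edge_vertices[of x y a]
        aV V U w U_facts(3,4) by auto
    have in1: "\<gamma> a w t \<in> P a w" using fw(8) st by blast
    have in2: "\<gamma> a w t \<in> P x y" using st by (metis atLeastAtMost_iff imageI path_image_def)
    have "s \<noteq> 0" "s \<noteq> 1" using st(5) e xy(1,2) in1 by auto
    moreover have "t \<noteq> 0" "t \<noteq> 1" using fw(2,3) xy(3,4) in2 by auto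
    ultimately show ?thesis using st by (intro exI[of _ s] exI[of _ t]) auto
  qed
  obtain s t where s: "0 < s" "s < 1" "0 < t" "t < 1" "\<gamma> x y s = \<gamma> a p t" using param[of p] U c by auto
  obtain s' t' where s': "0 < s'" "s' < 1" "0 < t'" "t' < 1" "\<gamma> x y s' = \<gamma> a q t'" using param[of q] U c by auto
  have "s \<noteq> s'"
  proof
    assume "s = s'"
    then have "\<gamma> a p t \<in> P a p \<inter> P a q" using s s' ray_facts(8)[OF U(3), of t] ray_facts(8)[OF U(4), of t'] by auto
    then have "\<gamma> a p t = a" using rays_meet[of p q] U by auto
    then show False using ray_facts(7)[OF U(3), of t] s by auto
  qed
  moreover have "P a x \<inter> P p q \<noteq> {}" using c(3) c_iff[of p q x] U by simp
  moreover have sym: "P q p = P p q" using image_sym[of p q] U U_facts(3) by auto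
  ultimately show False
    using mutual_crossing_ordered[of x y p q s s' t t'] mutual_crossing_ordered[of x y q p s' s t' t]
      U ncr s s' by (cases "s < s'") auto
qed

end

section \<open>Starts of the rays near the centre\<close>

context complete_drawing
begin

text \<open>The disc of radius \<open>r\<close> avoids all other vertices and all edges not at
  \<open>a\<close>, and \<open>t u\<close> is the first exit of the ray to \<open>u\<close> from it.
  A ray may come back into this disc later, so a second radius \<open>r'\<close> keeps away from
  everything after the exits, and the starts are chosen within \<open>r'\<close>.\<close>

lemma exists_start_points:
  "\<exists>r r' t s. 0 < r' \<and> r' \<le> r \<and> (\<forall>u\<in>U. \<forall>v\<in>U. u \<noteq> v \<longrightarrow> P u v \<inter> cball a r = {}) \<and>
     (\<forall>u\<in>U. 0 < t u \<and> t u < 1 \<and> dist a (\<gamma> a u (t u)) = r \<and>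
        (\<forall>\<tau>. 0 \<le> \<tau> \<and> \<tau> < t u \<longrightarrow> dist a (\<gamma> a u \<tau>) < r) \<and>
        (\<forall>\<tau>. t u \<le> \<tau> \<and> \<tau> \<le> 1 \<longrightarrow> r' \<le> dist a (\<gamma> a u \<tau>)) \<and>
        0 < s u \<and> s u < t u \<and> dist a (\<gamma> a u (s u)) < r')"
proof -
  define F where "F = (\<Union>(u, v)\<in>{(u, v). u \<in> U \<and> v \<in> U \<and> u \<noteq> v}. P u v) \<union> U"
  have "{(u, v). u \<in> U \<and> v \<in> U \<and> u \<noteq> v} \<subseteq> U \<times> U" by auto
  then have "finite {(u, v). u \<in> U \<and> v \<in> U \<and> u \<noteq> v}" using U_facts(1) by (meson finite_SigmaI finite_subset)
  moreover have "compact (P u v)" if "u \<in> U" "v \<in> U" "u \<noteq> v" for u v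
    using compact_P that U_facts(3) by blast
  ultimately have "compact (\<Union>(u, v)\<in>{(u, v). u \<in> U \<and> v \<in> U \<and> u \<noteq> v}. P u v)"
    by (intro compact_UN) auto
  then have "compact F"
    unfolding F_def using finite_imp_compact[OF U_facts(1)] by (rule compact_Un)
  then have "open (- F)" using compact_imp_closed by auto
  moreover have "a \<in> - F" using center_notin_edge U_facts(2) by (auto simp: F_def)
  ultimately obtain r where r: "r > 0" "cball a r \<subseteq> - F" using open_contains_cball by blast
  have "P u v \<inter> cball a r = {}" if "u \<in> U" "v \<in> U" "u \<noteq> v" for u v
  proof -
    have "P u v \<subseteq> F" using that by (auto simp: F_def)
    then show ?thesis using r(2) by blast
  qed
  note edges = this
  have far: "r < dist a u" if "u \<in> U" for u
  proof -
    have "u \<in> F" using that by (simp add: F_def)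
    then have "u \<notin> cball a r" using r(2) by blast
    then show ?thesis by simp
  qed
  have path: "path (\<gamma> a u)" if "u \<in> U" for u using ray_facts(1)[OF that] by (rule arc_imp_path)
  have "\<exists>t. 0 < t \<and> t < 1 \<and> dist a (\<gamma> a u t) = r \<and> (\<forall>\<tau>. 0 \<le> \<tau> \<and> \<tau> < t \<longrightarrow> dist a (\<gamma> a u \<tau>) < r)"
    if "u \<in> U" for u
    by (rule path_first_exit[OF path[OF that]]) (use ray_facts(2,3)[OF that] r far[OF that] in auto)
  then obtain t where t: "\<And>u. u \<in> U \<Longrightarrow> 0 < t u \<and> t u < 1 \<and> dist a (\<gamma> a u (t u)) = r \<and>
      (\<forall>\<tau>. 0 \<le> \<tau> \<and> \<tau> < t u \<longrightarrow> dist a (\<gamma> a u \<tau>) < r)"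
    by metis
  define T where "T = (\<Union>u\<in>U. \<gamma> a u ` {t u..1})"
  have "compact (\<gamma> a u ` {t u..1})" if "u \<in> U" for u
    using arc_interval_topology(1)[OF ray_facts(1)[OF that], of "t u" 1] t[OF that] by simp
  then have "compact T" unfolding T_def using U_facts(1) by (intro compact_UN) auto
  then have "open (- T)" using compact_imp_closed by auto
  moreover have "a \<in> - T"
  proof
    assume "a \<in> T"
    then obtain u \<tau> where u: "u \<in> U" "t u \<le> \<tau>" "\<tau> \<le> 1" "\<gamma> a u \<tau> = a" unfolding T_def by fastforce
    then show False using ray_facts(7)[OF u(1), of \<tau>] t[OF u(1)] by simp
  qed
  ultimately obtain r1 where r1: "r1 > 0" "ball a r1 \<subseteq> - T" using open_contains_ball by blast
  define r' where "r' = min r1 r"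
  have r': "0 < r'" "r' \<le> r" "r' \<le> r1" using r r1 by (auto simp: r'_def)
  have tail: "r' \<le> dist a (\<gamma> a u \<tau>)" if "u \<in> U" "t u \<le> \<tau>" "\<tau> \<le> 1" for u \<tau>
  proof -
    have "\<gamma> a u \<tau> \<in> T" unfolding T_def by (rule UN_I[OF that(1)]) (use that in simp)
    then have "\<gamma> a u \<tau> \<notin> ball a r1" using r1(2) by blast
    then show ?thesis using r' by simp
  qed
  have "\<exists>s. 0 < s \<and> s < t u \<and> dist a (\<gamma> a u s) < r'" if u: "u \<in> U" for u
  proof -
    have "r' < dist a u" using far[OF u] r' by simp
    then obtain t' where t': "0 < t'" "\<forall>\<tau>. 0 \<le> \<tau> \<and> \<tau> < t' \<longrightarrow> dist a (\<gamma> a u \<tau>) < r'"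
      using path_first_exit[OF path[OF u], of a r'] ray_facts(2,3)[OF u] r' by auto
    define s where "s = min t' (t u) / 2"
    have "0 < s" "s < t'" "s < t u" using t' t[OF u] by (auto simp: s_def)
    then show ?thesis using t' by (intro exI[of _ s]) auto
  qed
  then obtain s where "\<And>u. u \<in> U \<Longrightarrow> 0 < s u \<and> s u < t u \<and> dist a (\<gamma> a u (s u)) < r'" by metis
  then show ?thesis using r' edges t tail by (intro exI[of _ r] exI[of _ r'] exI[of _ t] exI[of _ s]) simp
qed

end

locale drawing_with_starts = complete_drawing +
  fixes r r' :: real and t s :: "complex \<Rightarrow> real"
  assumes r: "0 < r'" "r' \<le> r"
    and edge_far: "\<And>u v. u \<in> U \<Longrightarrow> v \<in> U \<Longrightarrow> u \<noteq> v \<Longrightarrow> P u v \<inter> cball a r = {}"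
    and t: "\<And>u. u \<in> U \<Longrightarrow> 0 < t u" "\<And>u. u \<in> U \<Longrightarrow> t u < 1" "\<And>u. u \<in> U \<Longrightarrow> dist a (\<gamma> a u (t u)) = r"
    and before: "\<And>u \<tau>. u \<in> U \<Longrightarrow> 0 \<le> \<tau> \<Longrightarrow> \<tau> < t u \<Longrightarrow> dist a (\<gamma> a u \<tau>) < r"
    and after: "\<And>u \<tau>. u \<in> U \<Longrightarrow> t u \<le> \<tau> \<Longrightarrow> \<tau> \<le> 1 \<Longrightarrow> r' \<le> dist a (\<gamma> a u \<tau>)"
    and s: "\<And>u. u \<in> U \<Longrightarrow> 0 < s u" "\<And>u. u \<in> U \<Longrightarrow> s u < t u" "\<And>u. u \<in> U \<Longrightarrow> dist a (\<gamma> a u (s u)) < r'"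
begin

definition S :: "complex \<Rightarrow> complex" where "S u = \<gamma> a u (s u)"

definition spoke :: "complex \<Rightarrow> complex set" where "spoke u = \<gamma> a u ` {0..t u}"

definition st :: "complex \<Rightarrow> complex \<Rightarrow> complex \<Rightarrow> bool" where
  "st u v x \<longleftrightarrow> S x \<in> inside (J u v)"

lemma S_facts:
  assumes "x \<in> U"
  shows "S x \<in> P a x" "S x \<noteq> a" "dist a (S x) < r'" "S x \<in> spoke x"
proof -
  have b: "0 < s x" "s x < t x" "t x < 1" using s t assms by auto
  then show "S x \<in> P a x" unfolding S_def using ray_facts(8)[OF assms] by simp
  show "S x \<noteq> a" unfolding S_def using ray_facts(7)[OF assms, of "s x"] b by auto
  show "dist a (S x) < r'" unfolding S_def by (rule s(3)[OF assms])
  show "S x \<in> spoke x" unfolding S_def spoke_def using b by auto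
qed

lemma spoke_sub: "u \<in> U \<Longrightarrow> spoke u \<subseteq> P a u"
  unfolding spoke_def using ray_facts(8) t(2) by fastforce

lemma spoke_cball: "u \<in> U \<Longrightarrow> spoke u \<subseteq> cball a r"
proof
  fix z assume u: "u \<in> U" and "z \<in> spoke u"
  then obtain \<tau> where \<tau>: "0 \<le> \<tau>" "\<tau> \<le> t u" "z = \<gamma> a u \<tau>" by (auto simp: spoke_def)
  then show "z \<in> cball a r" using before[OF u, of \<tau>] t(3)[OF u] by (cases "\<tau> = t u") auto
qed

lemma S_notin_J:
  assumes "u \<in> U" "v \<in> U" "u \<noteq> v" "x \<in> U" "x \<noteq> u" "x \<noteq> v"
  shows "S x \<notin> J u v"
proof -
  note Sx = S_facts[OF assms(4)]
  have "S x \<notin> P a u" "S x \<notin> P a v"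
    using Int_singleton_notin[OF rays_meet[of x u] Sx(1,2)] Int_singleton_notin[OF rays_meet[of x v] Sx(1,2)] assms
    by simp_all
  moreover have "S x \<in> cball a r" using Sx(3) r by simp
  then have "S x \<notin> P u v" using edge_far[OF assms(1-3)] by blast
  ultimately show ?thesis by (simp add: J_def)
qed

text \<open>From its start on, the ray to \<open>x\<close> can meet the triangle only on
  \<open>uv\<close>, since distinct rays share only \<open>a\<close>. The single possible crossing
  with \<open>uv\<close> comes after the start, because the ray stays in the disc that
  \<open>uv\<close> avoids up to then.\<close>

lemma start_ray_parity:
  assumes "u \<in> U" "v \<in> U" "x \<in> U" "distinct [u, v, x]"
  shows "c x u v = (st u v x \<noteq> inn u v x)"
proof -
  have ne: "u \<noteq> v" "x \<noteq> u" "x \<noteq> v" "u \<noteq> x" "v \<noteq> x" "v \<noteq> u" using assms(4) by auto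
  have V: "u \<in> V" "v \<in> V" "x \<in> V" "a \<in> V" "a \<noteq> u" "a \<noteq> v" "a \<noteq> x" using assms U_facts aV by auto
  note fx = ray_facts[OF assms(3)]
  have b: "0 < s x" "s x < t x" "t x < 1" using s t assms by auto
  define X where "X = {\<tau> \<in> {s x..1}. \<gamma> a x \<tau> \<in> J u v}"
  have X_iff: "\<gamma> a x \<tau> \<in> J u v \<longleftrightarrow> \<gamma> a x \<tau> \<in> P u v" if \<tau>: "0 < \<tau>" "\<tau> \<le> 1" for \<tau>
  proof -
    have "\<gamma> a x \<tau> \<in> P a x" "\<gamma> a x \<tau> \<noteq> a" using fx(7,8)[of \<tau>] \<tau> by auto
    then have "\<gamma> a x \<tau> \<notin> P a u" "\<gamma> a x \<tau> \<notin> P a v"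
      using Int_singleton_notin[OF rays_meet[of x u], of "\<gamma> a x \<tau>"]
        Int_singleton_notin[OF rays_meet[of x v], of "\<gamma> a x \<tau>"] assms ne by simp_all
    then show ?thesis by (simp add: J_def)
  qed
  have late: "s x < \<tau>" if "\<gamma> a x \<tau> \<in> P u v" "0 \<le> \<tau>" for \<tau>
  proof (rule ccontr)
    assume "\<not> s x < \<tau>"
    then have "dist a (\<gamma> a x \<tau>) < r" using before[OF assms(3), of \<tau>] that b by simp
    then have "\<gamma> a x \<tau> \<in> cball a r" by simp
    then show False using edge_far[OF assms(1,2) ne(1)] that by blast
  qed
  have im: "\<gamma> a x ` X = P a x \<inter> P u v"
  proof
    show "\<gamma> a x ` X \<subseteq> P a x \<inter> P u v"
    proof
      fix z assume "z \<in> \<gamma> a x ` X"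
      then obtain \<tau> where "s x \<le> \<tau>" "\<tau> \<le> 1" "\<gamma> a x \<tau> \<in> J u v" "z = \<gamma> a x \<tau>" by (auto simp: X_def)
      then show "z \<in> P a x \<inter> P u v" using X_iff[of \<tau>] fx(8)[of \<tau>] b by auto
    qed
    show "P a x \<inter> P u v \<subseteq> \<gamma> a x ` X"
    proof
      fix z assume z: "z \<in> P a x \<inter> P u v"
      then obtain \<tau> where \<tau>: "0 \<le> \<tau>" "\<tau> \<le> 1" "z = \<gamma> a x \<tau>" by (auto simp: path_image_def)
      then have "s x < \<tau>" using late[of \<tau>] z by auto
      then show "z \<in> \<gamma> a x ` X" using X_iff[of \<tau>] \<tau> z b by (auto simp: X_def)
    qed
  qed
  have injX: "inj_on (\<gamma> a x) X"
    using fx(1) inj_on_subset[of "\<gamma> a x" "{0..1}" X] b by (simp add: arc_def X_def subset_iff)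
  have m: "finite (P a x \<inter> P u v)" "card (P a x \<inter> P u v) = of_bool (P a x \<inter> P u v \<noteq> {})"
    using edges_meet_card[of a x u v] V ne by simp_all
  have finX: "finite X" using im injX m by (metis finite_imageD)
  have cX: "card X = of_bool (c x u v)"
  proof -
    have "card X = card (P a x \<inter> P u v)" using card_image[OF injX] im by simp
    then show ?thesis using m(2) c_iff[OF assms(1,2) ne(1), of x] by simp
  qed
  have "((\<gamma> a x (s x) \<in> inside (J u v)) \<noteq> (\<gamma> a x 1 \<in> inside (J u v))) = odd (card X)"
    unfolding X_def
  proof (rule arc_jordan_parity[OF jordan_J[OF assms(1,2) ne(1)] fx(1)])
    show "\<gamma> a x (s x) \<notin> J u v" using S_notin_J[OF assms(1,2) ne(1) assms(3) ne(2,3)] by (simp add: S_def)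
    show "\<gamma> a x 1 \<notin> J u v"
      using X_iff[of 1] fx(3) vertex_notin_edge[OF assms(1,2,3)] ne by simp
    fix \<tau> assume \<tau>: "s x < \<tau>" "\<tau> < 1" "\<gamma> a x \<tau> \<in> J u v"
    then have Q: "\<gamma> a x \<tau> \<in> P u v" "\<gamma> a x \<tau> \<in> P a x" "\<gamma> a x \<tau> \<noteq> a"
      using X_iff[of \<tau>] fx(7,8)[of \<tau>] b by auto
    have "properly_cross_at (\<gamma> a x) (\<gamma> u v) (\<gamma> a x \<tau>)" by (rule proper) (use V ne Q in simp_all)
    moreover have "open (- (P a u \<union> P a v))"
      using compact_P[of a u] compact_P[of a v] V by (intro open_Compl closed_Un compact_imp_closed) simp_all
    moreover have "\<gamma> a x \<tau> \<in> - (P a u \<union> P a v)"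
      using Int_singleton_notin[OF rays_meet[of x u] Q(2,3)] Int_singleton_notin[OF rays_meet[of x v] Q(2,3)]
        assms ne by simp
    moreover have "J u v \<inter> - (P a u \<union> P a v) = P u v \<inter> - (P a u \<union> P a v)" by (auto simp: J_def)
    ultimately show "\<exists>f N. properly_cross_at (\<gamma> a x) f (\<gamma> a x \<tau>) \<and> open N \<and> \<gamma> a x \<tau> \<in> N \<and> J u v \<inter> N = path_image f \<inter> N"
      by blast
  qed (use finX X_def b in auto)
  then show ?thesis using cX fx(3) by (auto simp: st_def inn_def S_def)
qed

end

section \<open>Counting cells, slots and sign patterns\<close>

lemma path_connected_arc_image: "arc g \<Longrightarrow> path_connected (path_image g)"
  by (simp add: arc_imp_path path_connected_path_image)

lemma ncells_le_1:
  assumes "connected T" "T \<inter> K = {}" "Q \<subseteq> T" "finite Q"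
  shows "ncells K Q \<le> 1"
proof -
  have "card (connected_component_set (- K) ` Q) \<le> card ((\<lambda>_. ()) ` Q)"
  proof (rule card_image_le_factor[OF assms(4)])
    fix x y assume "x \<in> Q" "y \<in> Q"
    then have "connected_component (- K) x y"
      unfolding connected_component_def using assms by (intro exI[of _ T]) auto
    then show "connected_component_set (- K) x = connected_component_set (- K) y"
      using connected_component_eq[of y "- K" x] by simp
  qed
  also have "\<dots> \<le> card (UNIV :: unit set)" by (rule card_mono) auto
  finally show ?thesis by (simp add: ncells_def)
qed

context complete_drawing
begin

lemma distinct_edges_meet:
  assumes "u \<in> V" "v \<in> V" "u \<noteq> v" "x \<in> V" "y \<in> V" "x \<noteq> y" "P u v \<noteq> P x y"
  shows "finite (P u v \<inter> P x y)" "card (P u v \<inter> P x y) \<le> 1"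
proof -
  have "\<exists>z. P u v \<inter> P x y \<subseteq> {z}"
  proof (cases "distinct [u, v, x, y]")
    case True
    then show ?thesis using once[OF assms(1,2,4,5) True] by (cases "P u v \<inter> P x y = {}") blast+
  next
    case False
    have sym: "P v u = P u v" "P y x = P x y" using image_sym assms by blast+
    consider "x = u" | "x = v" | "y = u" | "y = v" using False assms by auto
    then show ?thesis
    proof cases
      case 1
      then have "v \<noteq> y" using assms(7) by blast
      then show ?thesis using adjacent[of u v y] assms 1 by (intro exI[of _ u]) simp
    next
      case 2
      then have "u \<noteq> y" using assms(7) sym by auto
      then show ?thesis using adjacent[of v u y] assms 2 sym by (intro exI[of _ v]) simp
    next
      case 3
      then have "v \<noteq> x" using assms(7) sym by auto
      then show ?thesis using adjacent[of u v x] assms 3 sym by (intro exI[of _ u]) simp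
    next
      case 4
      then have "u \<noteq> x" using assms(7) by blast
      then show ?thesis using adjacent[of v u x] assms 4 sym by (intro exI[of _ v]) simp
    qed
  qed
  then obtain z where z: "P u v \<inter> P x y \<subseteq> {z}" ..
  then show "finite (P u v \<inter> P x y)" by (rule finite_subset) simp
  show "card (P u v \<inter> P x y) \<le> 1" using card_mono[OF _ z] by simp
qed

definition star :: "complex set \<Rightarrow> complex set" where
  "star W = insert a (\<Union>w\<in>W. P a w)"

text \<open>Each further ray touches the star built so far only in \<open>a\<close>, so no ray
  creates a cell.\<close>

lemma star_facts:
  assumes "finite W" "W \<subseteq> U" "finite Q" "Q \<inter> star W = {}"
  shows "compact (star W) \<and> path_connected (star W) \<and> ncells (star W) Q \<le> 1"
  using assms
proof (induction W rule: finite_induct)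
  case empty
  have "connected (- {a})" by (intro connected_punctured_universe) simp
  then have "ncells {a} Q \<le> 1" using empty by (intro ncells_le_1[of "- {a}"]) (auto simp: star_def)
  then show ?case by (simp add: star_def)
next
  case (insert w W)
  have w: "w \<in> U" and WU: "W \<subseteq> U" using insert.prems by auto
  note fw = ray_facts[OF w]
  have eq: "star (insert w W) = star W \<union> P a w" by (auto simp: star_def)
  have IH: "compact (star W)" "path_connected (star W)" "ncells (star W) Q \<le> 1"
    using insert.IH insert.prems WU eq by auto
  have int: "P a w \<inter> star W = {a}"
  proof
    show "P a w \<inter> star W \<subseteq> {a}"
    proof
      fix z assume z: "z \<in> P a w \<inter> star W"
      show "z \<in> {a}"
      proof (rule ccontr)
        assume "z \<notin> {a}"
        then obtain w' where w': "w' \<in> W" "z \<in> P a w'" using z by (auto simp: star_def)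
        then have "P a w \<inter> P a w' = {a}" using w WU insert.hyps(2) by (intro rays_meet) auto
        then show False using z w' \<open>z \<notin> {a}\<close> by blast
      qed
    qed
    show "{a} \<subseteq> P a w \<inter> star W" using fw(4) by (simp add: star_def)
  qed
  have "ncells (star W \<union> P a w) Q \<le> ncells (star W) Q"
    by (rule ncells_add_arc_touching[OF IH(1) fw(1) int insert.prems(2)]) (use insert.prems eq in auto)
  moreover have "path_connected (star W \<union> P a w)"
    using IH(2) fw(1) int by (intro path_connected_Un path_connected_arc_image) auto
  ultimately show ?case using IH fw(6) eq by (auto intro: compact_Un)
qed

text \<open>A new edge meets every ray and every earlier edge at most once, hence the set drawn so
  far in at most \<open>card W + k\<close> points, and this bounds the number of cells it adds. It
  is attached through its end \<open>u\<close>, which lies on the star.\<close>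

lemma drawing_cells:
  assumes W: "finite W" "W \<subseteq> U" and I: "finite I" "I \<subseteq> {(u, v). u \<in> W \<and> v \<in> W \<and> u \<noteq> v}" "card I \<le> k"
    and Q: "finite Q" "Q \<inter> (star W \<union> (\<Union>(u, v)\<in>I. P u v)) = {}"
  shows "compact (star W \<union> (\<Union>(u, v)\<in>I. P u v)) \<and> path_connected (star W \<union> (\<Union>(u, v)\<in>I. P u v)) \<and>
    ncells (star W \<union> (\<Union>(u, v)\<in>I. P u v)) Q \<le> 1 + card I * (card W + k)"
  using I Q
proof (induction I rule: finite_induct)
  case empty
  then show ?case using star_facts[OF W] by simp
next
  case (insert e I)
  obtain u v where e: "e = (u, v)" by (cases e)
  define K where "K = star W \<union> (\<Union>(u, v)\<in>I. P u v)"
  have eq: "star W \<union> (\<Union>(u, v)\<in>insert e I. P u v) = K \<union> P u v" by (auto simp: K_def e)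
  have uv: "u \<in> W" "v \<in> W" "u \<noteq> v" using insert.prems(1) e by auto
  have uvU: "u \<in> U" "v \<in> U" and uvV: "u \<in> V" "v \<in> V" using uv W U_facts(3) by auto
  have IH: "compact K" "path_connected K" "ncells K Q \<le> 1 + card I * (card W + k)"
    using insert.IH insert.prems insert.hyps eq unfolding K_def[symmetric] by auto
  have cI: "card (insert e I) = Suc (card I)" using insert.hyps by simp
  have g: "arc (\<gamma> u v)" using arcs[OF uvV uv(3)] by simp
  have "u \<in> P a u" using ray_facts(5)[OF uvU(1)] .
  then have uK: "u \<in> P u v \<inter> K"
    using uv(1) arcs[OF uvV uv(3)] pathstart_in_path_image[of "\<gamma> u v"] by (auto simp: K_def star_def)
  have topo: "compact (K \<union> P u v)" "path_connected (K \<union> P u v)"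
  proof -
    show "compact (K \<union> P u v)" using IH(1) compact_P[OF uvV uv(3)] by (rule compact_Un)
    show "path_connected (K \<union> P u v)"
      using IH(2) path_connected_arc_image[OF g] uK by (intro path_connected_Un) auto
  qed
  \<comment> \<open>The edge is already drawn, for instance, if \<open>I\<close> contains the
    reversed pair; otherwise it differs from every arc drawn so far.\<close>
  have "ncells (K \<union> P u v) Q \<le> ncells K Q + (card W + k)"
  proof (cases "P u v \<subseteq> K")
    case True
    then show ?thesis by (simp add: Un_absorb2)
  next
    case False
    have ray: "finite (P u v \<inter> P a w) \<and> card (P u v \<inter> P a w) \<le> 1" if "w \<in> W" for w
    proof -
      have "P a w \<subseteq> K" using that by (auto simp: K_def star_def)
      then have "P u v \<noteq> P a w" using False by blast
      moreover have "w \<in> V" "w \<noteq> a" using that W(2) U_facts(3,4) by auto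
      ultimately show ?thesis using distinct_edges_meet[of u v a w] uvV uv(3) aV by auto
    qed
    have edge: "finite (P u v \<inter> P x y) \<and> card (P u v \<inter> P x y) \<le> 1" if "(x, y) \<in> I" for x y
    proof -
      have "P x y \<subseteq> K" using that by (auto simp: K_def)
      then have "P u v \<noteq> P x y" using False by blast
      moreover have "x \<in> V" "y \<in> V" "x \<noteq> y" using that insert.prems(1) W(2) U_facts(3) by auto
      ultimately show ?thesis using distinct_edges_meet[of u v x y] uvV uv(3) by auto
    qed
    define R1 where "R1 = (\<Union>w\<in>W. P u v \<inter> P a w)"
    define R2 where "R2 = (\<Union>i\<in>I. P u v \<inter> P (fst i) (snd i))"
    have R1: "finite R1" "card R1 \<le> card W"
    proof -
      show "finite R1" unfolding R1_def using W(1) ray by blast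
      have "card R1 \<le> (\<Sum>w\<in>W. card (P u v \<inter> P a w))" unfolding R1_def using W(1) by (rule card_UN_le)
      also have "\<dots> \<le> (\<Sum>w\<in>W. 1)" using ray by (intro sum_mono) blast
      finally show "card R1 \<le> card W" by simp
    qed
    have R2: "finite R2" "card R2 \<le> card I"
    proof -
      have "finite (P u v \<inter> P (fst i) (snd i))" if "i \<in> I" for i using edge[of "fst i" "snd i"] that by simp
      then show "finite R2" unfolding R2_def by (rule finite_UN_I[OF insert.hyps(1)])
      have "card R2 \<le> (\<Sum>i\<in>I. card (P u v \<inter> P (fst i) (snd i)))" unfolding R2_def using insert.hyps(1) by (rule card_UN_le)
      also have "\<dots> \<le> (\<Sum>i\<in>I. 1)" using edge by (intro sum_mono) auto
      finally show "card R2 \<le> card I" by simp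
    qed
    have "a \<notin> P u v" using center_notin_edge[OF uvU uv(3)] .
    then have int: "P u v \<inter> K = R1 \<union> R2"
      by (auto simp: K_def star_def R1_def R2_def split_beta)
    have "card (P u v \<inter> K) \<le> card R1 + card R2" unfolding int by (rule card_Un_le)
    also have "\<dots> \<le> Suc (card W + k)" using R1(2) R2(2) insert.prems(2) cI by linarith
    finally have "card (P u v \<inter> K) \<le> Suc (card W + k)" .
    then show ?thesis
      using ncells_add_arc[OF g IH(1,2), of "card W + k" Q] R1(1) R2(1) uK insert.prems eq unfolding int
      by (metis Int_Un_distrib empty_iff finite_UnI int)
  qed
  then show ?case unfolding eq cI using topo IH(3) by simp
qed

end

context drawing_with_starts
begin

text \<open>A new spoke meets the circle and the earlier spokes at most in \<open>a\<close> and in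
  its exit point, so it adds at most one slot.\<close>

lemma start_slots:
  assumes W: "finite W" "W \<subseteq> U" and Q: "finite Q" "Q \<subseteq> U - W"
  shows "compact (sphere a r \<union> (\<Union>w\<in>W. spoke w)) \<and> path_connected (sphere a r \<union> (\<Union>w\<in>W. spoke w)) \<and>
    ncells (sphere a r \<union> (\<Union>w\<in>W. spoke w)) (S ` Q) \<le> 1 + card W"
  using W Q
proof (induction W rule: finite_induct)
  case empty
  have "S ` Q \<subseteq> ball a r" using S_facts(3) empty(3) r by force
  then have "ncells (sphere a r) (S ` Q) \<le> 1"
    using empty(2) by (intro ncells_le_1[of "ball a r"]) auto
  then show ?case by (simp add: path_connected_sphere_eq)
next
  case (insert w W)
  define D where "D = sphere a r \<union> (\<Union>w\<in>W. spoke w)"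
  have w: "w \<in> U" and WU: "W \<subseteq> U" using insert.prems by auto
  note fw = ray_facts[OF w]
  have eq: "sphere a r \<union> (\<Union>w\<in>insert w W. spoke w) = D \<union> spoke w" by (auto simp: D_def)
  have IH: "compact D" "path_connected D" "ncells D (S ` Q) \<le> 1 + card W"
    using insert.IH WU insert.prems unfolding D_def by auto
  have tw: "0 < t w" "t w < 1" using t w by auto
  define g where "g = subpath 0 (t w) (\<gamma> a w)"
  have g: "arc g" "path_image g = spoke w"
    using subarc_facts(1,2)[OF fw(1), of 0 "t w"] tw by (simp_all add: g_def spoke_def)
  have endD: "\<gamma> a w (t w) \<in> spoke w \<inter> D" using t(3)[OF w] tw by (auto simp: spoke_def D_def)
  have int: "spoke w \<inter> D \<subseteq> {a, \<gamma> a w (t w)}"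
  proof
    fix z assume z: "z \<in> spoke w \<inter> D"
    then obtain \<tau> where \<tau>: "0 \<le> \<tau>" "\<tau> \<le> t w" "z = \<gamma> a w \<tau>" by (auto simp: spoke_def)
    show "z \<in> {a, \<gamma> a w (t w)}"
    proof (cases "z \<in> sphere a r")
      case True
      then have "\<not> \<tau> < t w" using before[OF w, of \<tau>] \<tau>(1,3) by force
      then have "\<tau> = t w" using \<tau>(2) by simp
      then show ?thesis using \<tau>(3) by simp
    next
      case False
      then obtain w' where w': "w' \<in> W" "z \<in> spoke w'" using z by (auto simp: D_def)
      then have "z \<in> P a w \<inter> P a w'" using spoke_sub[OF w] spoke_sub[of w'] WU z by blast
      moreover have "P a w \<inter> P a w' = {a}" using w WU w' insert.hyps(2) by (intro rays_meet) auto
      ultimately show ?thesis by simp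
    qed
  qed
  have disj: "S ` Q \<inter> (D \<union> spoke w) = {}"
  proof -
    have "S x \<notin> D \<union> spoke w" if x: "x \<in> Q" for x
    proof -
      have xU: "x \<in> U" using x insert.prems by auto
      note Sx = S_facts[OF xU]
      have "S x \<notin> sphere a r" using Sx(3) r by auto
      moreover have "S x \<notin> spoke w'" if "w' \<in> insert w W" for w'
      proof -
        have w': "w' \<in> U" "x \<noteq> w'" using that w WU x insert.prems by auto
        have "S x \<notin> P a w'" by (rule Int_singleton_notin[OF rays_meet[OF xU w'] Sx(1,2)])
        then show ?thesis using spoke_sub[OF w'(1)] by blast
      qed
      ultimately show ?thesis by (auto simp: D_def)
    qed
    then show ?thesis by auto
  qed
  have fin: "finite (spoke w \<inter> D)" using int by (rule finite_subset) simp
  have "card (spoke w \<inter> D) \<le> card {a, \<gamma> a w (t w)}" by (rule card_mono[OF _ int]) simp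
  also have "\<dots> \<le> Suc 1" by (simp add: card_insert_if)
  finally have c2: "card (spoke w \<inter> D) \<le> Suc 1" .
  have ne: "spoke w \<inter> D \<noteq> {}" using endD by blast
  have "ncells (D \<union> spoke w) (S ` Q) \<le> ncells D (S ` Q) + 1"
    using ncells_add_arc[OF g(1) IH(1,2), of 1 "S ` Q"] fin ne c2 insert.prems(2) disj unfolding g(2) by blast
  moreover have "compact (D \<union> spoke w)"
    using IH(1) compact_arc_image[OF g(1)] unfolding g(2) by (rule compact_Un)
  moreover have "path_connected (D \<union> spoke w)"
    using IH(2) path_connected_arc_image[OF g(1)] endD unfolding g(2) by (intro path_connected_Un) auto
  ultimately show ?case unfolding eq using IH(3) insert.hyps by simp
qed

text \<open>Janiszewski's theorem with the circle as common part. The circle with the spokes of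
  \<open>u\<close> and \<open>v\<close> does not separate two starts in one slot, and the circle
  with the later parts of both rays and the edge \<open>uv\<close> misses the ball of radius
  \<open>r'\<close> that holds all starts. Adding the circle to both sets makes their intersection
  connected.\<close>

lemma st_determined_by_slot:
  assumes W: "W \<subseteq> U" and uv: "u \<in> W" "v \<in> W" "u \<noteq> v" and yz: "y \<in> U" "z \<in> U"
    and comp: "connected_component (- (sphere a r \<union> (\<Union>w\<in>W. spoke w))) (S y) (S z)"
  shows "st u v y = st u v z"
proof -
  have U: "u \<in> U" "v \<in> U" "u \<in> V" "v \<in> V" using uv W U_facts(3) by auto
  define tl where "tl w = \<gamma> a w ` {t w..1}" for w
  define S1 where "S1 = spoke u \<union> spoke v \<union> sphere a r"
  define T1 where "T1 = tl u \<union> P u v \<union> tl v \<union> sphere a r"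
  have ray: "P a w = spoke w \<union> tl w" "tl w \<subseteq> P a w" "a \<notin> tl w" "spoke w \<inter> tl w \<subseteq> sphere a r"
    "compact (tl w)" "compact (spoke w)" "\<And>p. p \<in> tl w \<Longrightarrow> r' \<le> dist a p" if w: "w \<in> U" for w
  proof -
    note fw = ray_facts[OF w]
    have tw: "0 < t w" "t w < 1" using t w by auto
    have "{0..1} = {0..t w} \<union> {t w..1}" using tw by auto
    then show *: "P a w = spoke w \<union> tl w" by (simp add: path_image_def spoke_def tl_def image_Un)
    then show "tl w \<subseteq> P a w" by blast
    show "a \<notin> tl w"
    proof
      assume "a \<in> tl w"
      then obtain \<tau> where "t w \<le> \<tau>" "\<tau> \<le> 1" "\<gamma> a w \<tau> = a" unfolding tl_def by fastforce
      then show False using fw(7)[of \<tau>] tw by simp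
    qed
    show "spoke w \<inter> tl w \<subseteq> sphere a r"
    proof
      fix p assume "p \<in> spoke w \<inter> tl w"
      then obtain \<tau> \<tau>' where \<tau>: "0 \<le> \<tau>" "\<tau> \<le> t w" "p = \<gamma> a w \<tau>" "t w \<le> \<tau>'" "\<tau>' \<le> 1" "p = \<gamma> a w \<tau>'"
        unfolding spoke_def tl_def by auto
      then have "\<tau> = \<tau>'" using arc_inj[OF fw(1), of \<tau> \<tau>'] tw by simp
      then have "\<tau> = t w" using \<tau> by simp
      then show "p \<in> sphere a r" using t(3)[OF w] \<tau>(3) by simp
    qed
    show "compact (tl w)" unfolding tl_def using arc_interval_topology(1)[OF fw(1), of "t w" 1] tw by simp
    show "compact (spoke w)" unfolding spoke_def using arc_interval_topology(1)[OF fw(1), of 0 "t w"] tw by simp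
    show "r' \<le> dist a p" if "p \<in> tl w" for p using that after[OF w] by (auto simp: tl_def)
  qed
  note ru = ray[OF U(1)] and rv = ray[OF U(2)]
  have "compact S1" unfolding S1_def by (intro compact_Un ru(6) rv(6) compact_sphere)
  moreover have "compact T1"
    unfolding T1_def by (intro compact_Un ru(5) rv(5) compact_sphere compact_P[OF U(3,4) uv(3)])
  moreover have "S1 \<inter> T1 = sphere a r"
  proof -
    have far: "spoke u \<inter> P u v = {}" "spoke v \<inter> P u v = {}"
      using spoke_cball[OF U(1)] spoke_cball[OF U(2)] edge_far[OF U(1,2) uv(3)] by blast+
    have "spoke u \<inter> tl v \<subseteq> {a}" "spoke v \<inter> tl u \<subseteq> {a}"
      using Int_mono[OF spoke_sub[OF U(1)] rv(2)] Int_mono[OF spoke_sub[OF U(2)] ru(2)] rays_meet[OF U(1,2) uv(3)]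
      by (simp_all add: Int_commute)
    then have "spoke u \<inter> tl v = {}" "spoke v \<inter> tl u = {}" using ru(3) rv(3) by blast+
    then show ?thesis unfolding S1_def T1_def using far ru(4) rv(4) by blast
  qed
  moreover have "connected (sphere a r)" by (simp add: connected_sphere_eq)
  moreover have "connected_component (- S1) (S y) (S z)"
    by (rule connected_component_of_subset[OF comp]) (use uv in \<open>auto simp: S1_def\<close>)
  moreover have "connected_component (- T1) (S y) (S z)"
    unfolding connected_component_def
  proof (intro exI conjI)
    show "connected (ball a r')" by (rule connected_ball)
    show "S y \<in> ball a r'" "S z \<in> ball a r'" using S_facts(3) yz by auto
    have "p \<notin> T1" if p: "p \<in> ball a r'" for p
    proof -
      have d: "dist a p < r'" using p by simp
      have "p \<notin> tl u" "p \<notin> tl v" using ru(7)[of p] rv(7)[of p] d by auto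
      moreover have "p \<notin> sphere a r" using d r by simp
      moreover have "p \<in> cball a r" using d r by simp
      then have "p \<notin> P u v" using edge_far[OF U(1,2) uv(3)] by blast
      ultimately show ?thesis by (simp add: T1_def)
    qed
    then show "ball a r' \<subseteq> - T1" by blast
  qed
  ultimately have cc: "connected_component (- (S1 \<union> T1)) (S y) (S z)"
    using Janiszewski_weak[of S1 T1 "S y" "S z"] by simp
  have "J u v \<subseteq> S1 \<union> T1" unfolding J_def using ru(1) rv(1) by (auto simp: S1_def T1_def)
  then have "connected_component (- J u v) (S y) (S z)"
    using connected_component_of_subset[OF cc, of "- J u v"] by blast
  then show ?thesis
    unfolding st_def using inside_same_component[of "J u v" "S y" "S z"] inside_same_component[of "J u v" "S z" "S y"]
      connected_component_sym by blast
qed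

text \<open>The cell of \<open>x\<close> determines the pattern of \<open>inn\<close> and the slot
  of its start that of \<open>st\<close>, so patterns are bounded by a quadratic times a linear
  count. The at most \<open>2 * k\<close> corners of the triangles lie on the drawing itself and are
  counted one by one.\<close>

lemma sign_patterns:
  assumes I: "finite I" "I \<subseteq> {(u, v). u \<in> U \<and> v \<in> U \<and> u \<noteq> v}"
  shows "card ((\<lambda>x. ({(u, v) \<in> I. inn u v x}, {(u, v) \<in> I. st u v x})) ` U) \<le> 6 * (card I + 1) ^ 3"
proof -
  define k where "k = card I"
  define W where "W = fst ` I \<union> snd ` I"
  define Q where "Q = U - W"
  define K where "K = star W \<union> (\<Union>(u, v)\<in>I. P u v)"
  define D where "D = sphere a r \<union> (\<Union>w\<in>W. spoke w)"
  define g where "g x = ({(u, v) \<in> I. inn u v x}, {(u, v) \<in> I. st u v x})" for x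
  define f where "f x = (connected_component_set (- K) x, connected_component_set (- D) (S x))" for x
  have W: "finite W" "W \<subseteq> U" using I by (auto simp: W_def)
  have cW: "card W \<le> 2 * k"
    using card_Un_le[of "fst ` I" "snd ` I"] card_image_le[OF I(1), of fst] card_image_le[OF I(1), of snd]
    by (simp add: W_def k_def)
  have IW: "I \<subseteq> {(u, v). u \<in> W \<and> v \<in> W \<and> u \<noteq> v}" using I(2) by (force simp: W_def)
  have Q: "finite Q" "Q \<subseteq> U - W" using U_facts(1) by (auto simp: Q_def)
  have QK: "x \<notin> K" if x: "x \<in> Q" for x
  proof -
    have xU: "x \<in> U" "x \<notin> W" using x by (auto simp: Q_def)
    have "x \<notin> P a w" if "w \<in> W" for w
      by (rule edge_vertices) (use that W(2) xU U_facts aV in auto)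
    moreover have "x \<notin> P u v" if "(u, v) \<in> I" for u v
      by (rule edge_vertices) (use that IW I(2) xU U_facts in auto)
    ultimately show ?thesis using U_facts(4)[OF xU(1)] by (auto simp: K_def star_def)
  qed
  then have QK': "Q \<inter> K = {}" by blast
  have nK: "ncells K Q \<le> 1 + k * (card W + k)"
    using drawing_cells[OF W I(1) IW, of k Q] Q(1) QK' unfolding K_def k_def by simp
  have nD: "ncells D (S ` Q) \<le> 1 + card W" using start_slots[OF W Q] unfolding D_def by simp
  have "card (g ` Q) \<le> card (f ` Q)"
  proof (rule card_image_le_factor[OF Q(1)])
    fix x y assume xy: "x \<in> Q" "y \<in> Q" "f x = f y"
    have xyU: "x \<in> U" "y \<in> U" using xy by (auto simp: Q_def)
    have cK: "connected_component (- K) x y"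
      using xy(3) QK[OF xy(1)] connected_component_eq_eq[of "- K" x y] by (simp add: f_def)
    have SD: "S w \<notin> D" if "w \<in> Q" for w
    proof -
      have w: "w \<in> U" "w \<notin> W" using that by (auto simp: Q_def)
      note Sw = S_facts[OF w(1)]
      have "S w \<notin> spoke w'" if "w' \<in> W" for w'
      proof -
        have w': "w' \<in> U" "w \<noteq> w'" using that W(2) w by auto
        have "S w \<notin> P a w'" by (rule Int_singleton_notin[OF rays_meet[OF w(1) w'] Sw(1,2)])
        then show ?thesis using spoke_sub[OF w'(1)] by blast
      qed
      moreover have "S w \<notin> sphere a r" using Sw(3) r by simp
      ultimately show ?thesis by (simp add: D_def)
    qed
    have cD: "connected_component (- D) (S x) (S y)"
      using xy(3) SD[OF xy(1)] connected_component_eq_eq[of "- D" "S x" "S y"] by (simp add: f_def)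
    have "inn u v x = inn u v y \<and> st u v x = st u v y" if uv: "(u, v) \<in> I" for u v
    proof
      have uvW: "u \<in> W" "v \<in> W" "u \<noteq> v" using uv IW by auto
      have "J u v \<subseteq> K" using uv uvW by (auto simp: J_def K_def star_def)
      then have "connected_component (- J u v) x y"
        using connected_component_of_subset[OF cK, of "- J u v"] by blast
      then show "inn u v x = inn u v y"
        unfolding inn_def using inside_same_component[of "J u v" x y] inside_same_component[of "J u v" y x]
          connected_component_sym by blast
      show "st u v x = st u v y"
        by (rule st_determined_by_slot[OF W(2) uvW xyU]) (use cD in \<open>simp add: D_def\<close>)
    qed
    then show "g x = g y" unfolding g_def by auto
  qed
  also have "card (f ` Q) \<le> card (connected_component_set (- K) ` Q \<times> connected_component_set (- D) ` S ` Q)"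
    using Q(1) by (intro card_mono) (auto simp: f_def)
  also have "\<dots> = ncells K Q * ncells D (S ` Q)" by (simp add: card_cartesian_product ncells_def)
  also have "\<dots> \<le> (1 + k * (card W + k)) * (1 + card W)" using nK nD by (rule mult_le_mono)
  also have "\<dots> \<le> (1 + k * (2 * k + k)) * (1 + 2 * k)"
    using cW by (intro mult_le_mono add_le_mono order_refl) auto
  finally have gQ: "card (g ` Q) \<le> (1 + k * (2 * k + k)) * (1 + 2 * k)" .
  have "U = Q \<union> W" using W(2) by (auto simp: Q_def)
  then have "card (g ` U) \<le> card (g ` Q) + card (g ` W)" by (metis card_Un_le image_Un)
  also have "\<dots> \<le> (1 + k * (2 * k + k)) * (1 + 2 * k) + 2 * k"
    using gQ card_image_le[OF W(1), of g] cW by linarith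
  also have "\<dots> \<le> 6 * (k + 1) ^ 3" by (simp add: power3_eq_cube algebra_simps)
  finally show ?thesis by (simp add: g_def k_def)
qed

end

section \<open>Complete simple topological graphs\<close>

text \<open>At 15 the power of two has overtaken, \<open>32768\<close> against \<open>24576\<close>;
  beyond that the cube grows per step by a factor of at most \<open>(5/4)^3 < 2\<close>.\<close>

lemma cubic_growth_bound:
  assumes "2 ^ m \<le> 6 * (m + 1) ^ 3"
  shows "m \<le> (14 :: nat)"
proof (rule ccontr)
  assume "\<not> m \<le> 14"
  then have "15 \<le> m" by simp
  then have "6 * (m + 1) ^ 3 < (2 :: nat) ^ m"
  proof (induction m rule: dec_induct)
    case base
    show ?case by simp
  next
    case (step n)
    have "4 * (n + 2) \<le> 5 * (n + 1)" using step.hyps by simp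
    then have "(4 * (n + 2)) ^ 3 \<le> (5 * (n + 1)) ^ 3" by (rule power_mono) simp
    then have "64 * (n + 2) ^ 3 \<le> 125 * (n + 1) ^ 3" unfolding power_mult_distrib by simp
    then have "6 * (n + 2) ^ 3 \<le> 2 * (6 * (n + 1) ^ 3)" by linarith
    also have "\<dots> < 2 * 2 ^ n" using step.IH by simp
    finally show ?case by simp
  qed
  with assms show False by simp
qed

lemma (in drawing_with_starts) star_system: "star_system U inn st c cr 6 14"
proof
  show "finite U" by (rule U_facts(1))
  show "c x u v = c x v u" for x u v by (simp add: c_def Un_commute)
  show "cr u v x y = cr x y u v" for u v x y by (simp add: cr_def Int_commute)
  show "cr u v x y = cr u v y x" for u v x y by (simp add: cr_def Un_commute)
  show "c x u v = (st u v x \<noteq> inn u v x)" if "u \<in> U" "v \<in> U" "x \<in> U" "distinct [u, v, x]" for u v x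
    using that by (rule start_ray_parity)
  show "(inn u v x \<noteq> inn u v y) = (c u x y \<noteq> (c v x y \<noteq> cr u v x y))"
    if "u \<in> U" "v \<in> U" "x \<in> U" "y \<in> U" "distinct [u, v, x, y]" for u v x y
    using that by (rule inn_edge_parity)
  show "inn x y u = inn x y p"
    if "x \<in> U" "y \<in> U" "p \<in> U" "q \<in> U" "u \<in> U" "distinct [x, y, p, q, u]" "c u p q" "\<not> c u x y"
      "\<not> c x p q" "\<not> c y p q" "\<not> cr x y p q" for x y p q u
    using that by (rule inn_ray_side)
  show "cr x y p q"
    if "x \<in> U" "y \<in> U" "p \<in> U" "q \<in> U" "distinct [x, y, p, q]" "c p x y" "c q x y" "c x p q" for x y p q
    using that by (rule mutual_rays_cross)
  show "card ((\<lambda>x. ({(u, v) \<in> I. inn u v x}, {(u, v) \<in> I. st u v x})) ` U) \<le> 6 * (card I + 1) ^ 3"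
    if "finite I" "I \<subseteq> {(u, v). u \<in> U \<and> v \<in> U \<and> u \<noteq> v}" for I
    using that by (rule sign_patterns)
  show "m \<le> 14" if "2 ^ m \<le> 6 * (m + 1) ^ 3" for m :: nat
    using that by (rule cubic_growth_bound)
qed

text \<open>The constant of the abstract bound for \<open>d = 14\<close> and
  \<open>C = 6\<close>.\<close>

definition light_const :: real where
  "light_const = 138 + 396 * ((12 * real (14 :: nat) + 3) * (2 * real (6 :: nat)) powr (1/3))"

lemma light_const_pos: "light_const > 0"
  unfolding light_const_def by (intro add_pos_nonneg) auto

lemma (in complete_drawing) exists_light_edge:
  assumes "card U \<ge> 4"
  shows "\<exists>x\<in>U. \<exists>y\<in>U. x \<noteq> y \<and>
     real (card {u \<in> U. u \<noteq> x \<and> u \<noteq> y \<and> c u x y}) +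
     real (card {(u, v). u \<in> U \<and> v \<in> U \<and> distinct [u, v, x, y] \<and> cr u v x y})
       \<le> light_const * real (card U) powr (7/4)"
proof -
  obtain r r' t s where rt: "0 < r'" "r' \<le> r" "\<forall>u\<in>U. \<forall>v\<in>U. u \<noteq> v \<longrightarrow> P u v \<inter> cball a r = {}"
     "\<forall>u\<in>U. 0 < t u \<and> t u < 1 \<and> dist a (\<gamma> a u (t u)) = r \<and>
        (\<forall>\<tau>. 0 \<le> \<tau> \<and> \<tau> < t u \<longrightarrow> dist a (\<gamma> a u \<tau>) < r) \<and>
        (\<forall>\<tau>. t u \<le> \<tau> \<and> \<tau> \<le> 1 \<longrightarrow> r' \<le> dist a (\<gamma> a u \<tau>)) \<and>
        0 < s u \<and> s u < t u \<and> dist a (\<gamma> a u (s u)) < r'"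
    using exists_start_points by blast
  interpret D: drawing_with_starts V \<gamma> a r r' t s
    by unfold_locales (use rt in simp_all)
  interpret S: star_system U inn D.st c cr 6 14 by (rule D.star_system)
  have "4 \<le> S.N" using assms by (simp add: S.N_def)
  from S.exists_light_pair[OF this] show ?thesis
    unfolding S.A_def S.N_def S.c0_def light_const_def fst_conv snd_conv .
qed

section \<open>From complete simple topological graphs to drawings\<close>

definition edge_between :: "plane_arc set \<Rightarrow> complex \<Rightarrow> complex \<Rightarrow> plane_arc" where
  "edge_between E u v = (THE e. e \<in> E \<and> endpoints e = {u, v})"

text \<open>An edge of the graph is stored in one direction only; the drawing needs a
  parametrisation for each order of the ends.\<close>

definition oriented_edge :: "plane_arc set \<Rightarrow> complex \<Rightarrow> complex \<Rightarrow> plane_arc" where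
  "oriented_edge E u v =
     (if pathstart (edge_between E u v) = u then edge_between E u v else reversepath (edge_between E u v))"

locale complete_simple_graph =
  fixes V :: "complex set" and E :: "plane_arc set"
  assumes complete: "complete_topological_graph V E" and simple: "simple_topological_graph V E"
begin

lemma finite_vertices: "finite V"
  using complete by (simp add: complete_topological_graph_def topological_graph_def)

lemma edge_facts:
  assumes "e \<in> E"
  shows "arc e" "endpoints e \<subseteq> V" "arc_interior e \<inter> V = {}" "path_image e \<inter> V = endpoints e"
    "pathstart e \<in> V" "pathfinish e \<in> V" "pathstart e \<noteq> pathfinish e"
proof -
  show *: "arc e" "endpoints e \<subseteq> V" "arc_interior e \<inter> V = {}"
    using complete assms by (auto simp: complete_topological_graph_def topological_graph_def)
  have "endpoints e \<subseteq> path_image e"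
    by (simp add: endpoints_def pathstart_in_path_image pathfinish_in_path_image)
  then show "path_image e \<inter> V = endpoints e" using *(2,3) unfolding arc_interior_def by blast
  show "pathstart e \<in> V" "pathfinish e \<in> V" using *(2) by (auto simp: endpoints_def)
  show "pathstart e \<noteq> pathfinish e" using arc_distinct_ends[OF *(1)] by simp
qed

lemma edge_between:
  assumes "u \<in> V" "v \<in> V" "u \<noteq> v"
  shows "edge_between E u v \<in> E" "endpoints (edge_between E u v) = {u, v}"
proof -
  have "\<exists>!e. e \<in> E \<and> endpoints e = {u, v}"
    using complete assms by (simp add: complete_topological_graph_def)
  from theI'[OF this] show "edge_between E u v \<in> E" "endpoints (edge_between E u v) = {u, v}"
    unfolding edge_between_def by auto
qed

lemma edge_eqI:
  assumes "e \<in> E" "f \<in> E" "endpoints e = endpoints f"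
  shows "e = f"
proof -
  have "\<exists>!g. g \<in> E \<and> endpoints g = {pathstart f, pathfinish f}"
    using complete edge_facts(5-7)[OF assms(2)] by (simp add: complete_topological_graph_def)
  moreover have "endpoints e = {pathstart f, pathfinish f}" "endpoints f = {pathstart f, pathfinish f}"
    using assms(3) by (simp_all add: endpoints_def)
  ultimately show ?thesis using assms(1,2) by blast
qed

lemma edge_between_commute: "edge_between E u v = edge_between E v u"
  by (simp add: edge_between_def insert_commute)

lemma path_image_oriented_edge: "path_image (oriented_edge E u v) = path_image (edge_between E u v)"
  by (simp add: oriented_edge_def)

lemma arc_oriented_edge:
  assumes "u \<in> V" "v \<in> V" "u \<noteq> v"
  shows "arc (oriented_edge E u v)" "pathstart (oriented_edge E u v) = u" "pathfinish (oriented_edge E u v) = v"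
proof -
  note e = edge_between[OF assms]
  show "arc (oriented_edge E u v)"
    using edge_facts(1)[OF e(1)] by (simp add: oriented_edge_def arc_reversepath)
  show "pathstart (oriented_edge E u v) = u" "pathfinish (oriented_edge E u v) = v"
    using e(2) assms(3) by (auto simp: oriented_edge_def endpoints_def doubleton_eq_iff)
qed

lemma edges_meet_once:
  assumes "e \<in> E" "f \<in> E" "e \<noteq> f" "p \<in> path_image e" "p \<in> path_image f" "q \<in> path_image e" "q \<in> path_image f"
  shows "p = q"
  using simple assms unfolding simple_topological_graph_def by blast

lemma edges_meet_proper:
  assumes "e \<in> E" "f \<in> E" "e \<noteq> f" "p \<in> path_image e" "p \<in> path_image f"
  shows "p \<in> endpoints e \<inter> endpoints f \<or> properly_cross_at e f p"
  using simple assms unfolding simple_topological_graph_def by blast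

lemma complete_drawing_oriented_edge:
  assumes "a \<in> V"
  shows "complete_drawing V (oriented_edge E) a"
proof
  show "finite V" "a \<in> V" using finite_vertices assms by auto
  show "arc (oriented_edge E u v) \<and> pathstart (oriented_edge E u v) = u \<and> pathfinish (oriented_edge E u v) = v"
    if "u \<in> V" "v \<in> V" "u \<noteq> v" for u v using arc_oriented_edge[OF that] by simp
  show "path_image (oriented_edge E u v) = path_image (oriented_edge E v u)" for u v
    by (simp add: path_image_oriented_edge edge_between_commute)
  show "path_image (oriented_edge E u v) \<inter> V = {u, v}" if "u \<in> V" "v \<in> V" "u \<noteq> v" for u v
    using edge_between[OF that] edge_facts(4) by (simp add: path_image_oriented_edge)
  show "path_image (oriented_edge E u v) \<inter> path_image (oriented_edge E u w) = {u}"
    if "u \<in> V" "v \<in> V" "w \<in> V" "distinct [u, v, w]" for u v w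
  proof -
    have e: "edge_between E u v \<in> E" "endpoints (edge_between E u v) = {u, v}"
      "edge_between E u w \<in> E" "endpoints (edge_between E u w) = {u, w}"
      using edge_between[of u v] edge_between[of u w] that by auto
    then have ne: "edge_between E u v \<noteq> edge_between E u w" using that(4) by (auto simp: doubleton_eq_iff)
    have "u \<in> path_image (edge_between E u v)" "u \<in> path_image (edge_between E u w)"
      using e edge_facts(4)[OF e(1)] edge_facts(4)[OF e(3)] by auto
    then show ?thesis
      using edges_meet_once[OF e(1) e(3) ne] unfolding path_image_oriented_edge by blast
  qed
  fix u v x y assume V: "u \<in> V" "v \<in> V" "x \<in> V" "y \<in> V" and d: "distinct [u, v, x, y]"
  have e: "edge_between E u v \<in> E" "endpoints (edge_between E u v) = {u, v}"
    "edge_between E x y \<in> E" "endpoints (edge_between E x y) = {x, y}"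
    using edge_between[of u v] edge_between[of x y] V d by auto
  then have ne: "edge_between E u v \<noteq> edge_between E x y" using d by (auto simp: doubleton_eq_iff)
  show "properly_cross_at (oriented_edge E u v) (oriented_edge E x y) p"
    if "p \<in> path_image (oriented_edge E u v)" "p \<in> path_image (oriented_edge E x y)" for p
  proof -
    have "p \<notin> {u, v} \<inter> {x, y}" using d by auto
    then have "properly_cross_at (edge_between E u v) (edge_between E x y) p"
      using edges_meet_proper[OF e(1,3) ne, of p] that e(2,4) unfolding path_image_oriented_edge by blast
    then show ?thesis unfolding properly_cross_at_def path_image_oriented_edge .
  qed
  show "p = q"
    if "p \<in> path_image (oriented_edge E u v) \<inter> path_image (oriented_edge E x y)"
       "q \<in> path_image (oriented_edge E u v) \<inter> path_image (oriented_edge E x y)" for p q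
    using edges_meet_once[OF e(1,3) ne, of p q] that by (simp add: path_image_oriented_edge)
qed

text \<open>A shared endpoint would be a second common point besides the crossing.\<close>

lemma crossing_edges_disjoint:
  assumes "e \<in> E" "f \<in> E" "e \<noteq> f" "edges_cross e f"
  shows "endpoints e \<inter> endpoints f = {}"
proof (rule ccontr)
  assume "endpoints e \<inter> endpoints f \<noteq> {}"
  then obtain z where z: "z \<in> endpoints e" "z \<in> endpoints f" by auto
  obtain p where p: "p \<in> path_image e" "p \<in> path_image f" "p \<notin> endpoints e"
    using assms(4) by (auto simp: edges_cross_def arc_interior_def)
  have "z \<in> path_image e" "z \<in> path_image f" using z by (auto simp: endpoints_def)
  then have "z = p" using edges_meet_once[OF assms(1-3)] p(1,2) by blast
  then show False using z p(3) by simp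
qed

text \<open>Crossing edges are encoded injectively by their start and finish. Edges at
  \<open>a\<close> may be stored in either direction, whence \<open>2 * card A\<close>; the others
  share no end with \<open>xy\<close> and land in \<open>B\<close>.\<close>

lemma crossings_of_edge:
  assumes "a \<in> V" "x \<in> V - {a}" "y \<in> V - {a}" "x \<noteq> y"
  defines "U \<equiv> V - {a}"
  defines "A \<equiv> {u \<in> U. u \<noteq> x \<and> u \<noteq> y \<and> complete_drawing.c (oriented_edge E) a u x y}"
  defines "B \<equiv> {(u, v). u \<in> U \<and> v \<in> U \<and> distinct [u, v, x, y] \<and> complete_drawing.cr (oriented_edge E) u v x y}"
  shows "num_edges_crossing E (edge_between E x y) \<le> 2 * card A + card B"
proof -
  interpret D: complete_drawing V "oriented_edge E" a using assms(1) by (rule complete_drawing_oriented_edge)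
  have fin: "finite A" "finite B"
  proof -
    show "finite A" using finite_vertices by (simp add: A_def U_def)
    have "B \<subseteq> V \<times> V" by (auto simp: B_def U_def)
    then show "finite B" using finite_vertices by (meson finite_SigmaI finite_subset)
  qed
  define e where "e = edge_between E x y"
  have xy: "x \<in> V" "y \<in> V" "x \<noteq> a" "y \<noteq> a" using assms by auto
  have e: "e \<in> E" "endpoints e = {x, y}" using edge_between[OF xy(1,2) assms(4)] by (auto simp: e_def)
  define F where "F = {f \<in> E. f \<noteq> e \<and> edges_cross e f}"
  define \<phi> :: "plane_arc \<Rightarrow> complex \<times> complex" where "\<phi> f = (pathstart f, pathfinish f)" for f
  have "inj_on \<phi> F"
  proof (rule inj_onI)
    fix f g assume "f \<in> F" "g \<in> F" "\<phi> f = \<phi> g"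
    then show "f = g" by (intro edge_eqI) (auto simp: F_def \<phi>_def endpoints_def)
  qed
  then have "card F = card (\<phi> ` F)" by (simp add: card_image)
  also have "\<dots> \<le> card ({a} \<times> A \<union> A \<times> {a} \<union> B)"
  proof (rule card_mono)
    show "finite ({a} \<times> A \<union> A \<times> {a} \<union> B)" using fin by simp
    show "\<phi> ` F \<subseteq> {a} \<times> A \<union> A \<times> {a} \<union> B"
    proof
      fix w assume "w \<in> \<phi> ` F"
      then obtain f where f: "f \<in> E" "f \<noteq> e" "edges_cross e f" "w = \<phi> f" by (auto simp: F_def)
      define u v where "u = pathstart f" and "v = pathfinish f"
      have uv: "u \<in> V" "v \<in> V" "u \<noteq> v" using edge_facts(5-7)[OF f(1)] by (auto simp: u_def v_def)
      have fe: "endpoints f = {u, v}" by (simp add: endpoints_def u_def v_def)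
      have "endpoints e \<inter> endpoints f = {}" using crossing_edges_disjoint[OF e(1) f(1) f(2)[symmetric] f(3)] .
      then have d: "u \<noteq> x" "u \<noteq> y" "v \<noteq> x" "v \<noteq> y" using fe e(2) by auto
      have "edge_between E u v = f"
        using edge_between[OF uv] f(1) fe by (intro edge_eqI) auto
      then have P: "D.P u v = path_image f" "D.P v u = path_image f" "D.P x y = path_image e"
        by (auto simp: path_image_oriented_edge e_def edge_between_commute)
      have X: "path_image e \<inter> path_image f \<noteq> {}"
        using f(3) by (auto simp: edges_cross_def arc_interior_def)
      consider "u = a" | "v = a" | "u \<noteq> a" "v \<noteq> a" by blast
      then show "w \<in> {a} \<times> A \<union> A \<times> {a} \<union> B"
      proof cases
        case 1
        then have "v \<in> A" using uv d P X by (auto simp: A_def U_def D.c_def)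
        then show ?thesis using 1 f(4) by (simp add: \<phi>_def u_def v_def)
      next
        case 2
        then have "u \<in> A" using uv d P X by (auto simp: A_def U_def D.c_def)
        then show ?thesis using 2 f(4) by (simp add: \<phi>_def u_def v_def)
      next
        case 3
        then have "(u, v) \<in> B" using uv d P X assms(4) by (auto simp: B_def U_def D.cr_def)
        then show ?thesis using f(4) by (simp add: \<phi>_def u_def v_def)
      qed
    qed
  qed
  also have "\<dots> \<le> card ({a} \<times> A) + card (A \<times> {a}) + card B"
    using card_Un_le[of "{a} \<times> A \<union> A \<times> {a}" B] card_Un_le[of "{a} \<times> A" "A \<times> {a}"] by linarith
  also have "\<dots> = 2 * card A + card B" by (simp add: card_cartesian_product)
  finally show ?thesis by (simp add: num_edges_crossing_def F_def e_def)
qed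

lemma exists_lightly_crossed_edge:
  assumes "card V \<ge> 5"
  shows "\<exists>e\<in>E. real (num_edges_crossing E e) \<le> 2 * light_const * real (card V) powr (7/4)"
proof -
  obtain a where a: "a \<in> V" using assms by fastforce
  interpret D: complete_drawing V "oriented_edge E" a using a by (rule complete_drawing_oriented_edge)
  have cU: "card D.U = card V - 1" using a finite_vertices by (simp add: D.U_def)
  then have "card D.U \<ge> 4" using assms by simp
  from D.exists_light_edge[OF this] obtain x y where xy: "x \<in> D.U" "y \<in> D.U" "x \<noteq> y"
    "real (card {u \<in> D.U. u \<noteq> x \<and> u \<noteq> y \<and> D.c u x y}) +
     real (card {(u, v). u \<in> D.U \<and> v \<in> D.U \<and> distinct [u, v, x, y] \<and> D.cr u v x y})
       \<le> light_const * real (card D.U) powr (7/4)" (is "real ?A + real ?B \<le> _") by blast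
  have "num_edges_crossing E (edge_between E x y) \<le> 2 * ?A + ?B"
    using crossings_of_edge[OF a, of x y] xy(1-3) unfolding D.U_def by blast
  then have "real (num_edges_crossing E (edge_between E x y)) \<le> real (2 * ?A + ?B)"
    by (simp only: of_nat_le_iff)
  also have "\<dots> \<le> 2 * (real ?A + real ?B)" by simp
  also have "\<dots> \<le> 2 * (light_const * real (card D.U) powr (7/4))"
    using xy(4) by (rule mult_left_mono) simp
  also have "\<dots> \<le> 2 * (light_const * real (card V) powr (7/4))"
    using light_const_pos cU by (intro mult_left_mono powr_mono2) auto
  finally have "real (num_edges_crossing E (edge_between E x y)) \<le> 2 * light_const * real (card V) powr (7/4)"
    by simp
  moreover have "edge_between E x y \<in> E" using edge_between(1)[of x y] xy(1-3) by (simp add: D.U_def)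
  ultimately show ?thesis by blast
qed

end

lemma h_le_powr:
  assumes "n \<ge> 5"
  shows "real (h n) \<le> 2 * light_const * real n powr (7/4)"
proof -
  define k where "k = nat \<lfloor>2 * light_const * real n powr (7/4)\<rfloor>"
  have "light_edge_bound n k"
    unfolding light_edge_bound_def
  proof (intro allI impI, elim conjE)
    fix V E assume "complete_topological_graph V E" "simple_topological_graph V E" "card V = n"
    then interpret complete_simple_graph V E by unfold_locales
    obtain e where "e \<in> E" "real (num_edges_crossing E e) \<le> 2 * light_const * real n powr (7/4)"
      using exists_lightly_crossed_edge assms \<open>card V = n\<close> by auto
    then show "\<exists>e\<in>E. num_edges_crossing E e \<le> k" unfolding k_def by (metis le_nat_floor)
  qed
  then have "h n \<le> k" unfolding h_def by (rule Least_le)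
  moreover have "real k \<le> 2 * light_const * real n powr (7/4)"
    unfolding k_def using light_const_pos by (intro of_nat_floor) simp
  ultimately show ?thesis by linarith
qed

theorem theorem1p1:
  "\<exists>C::real. C > 0 \<and> (\<forall>n::nat. n \<ge> 2 \<longrightarrow> real (h n) \<le> C * real n powr (7/4))"
proof (intro exI conjI allI impI)
  \<comment> \<open>For \<open>n\<close> below 5 the star has fewer than four rays; these three
    values are absorbed into the constant.\<close>
  let ?C = "2 * light_const + real (h 2) + real (h 3) + real (h 4)"
  show C: "?C > 0" using light_const_pos by linarith
  fix n :: nat assume n: "n \<ge> 2"
  show "real (h n) \<le> ?C * real n powr (7/4)"
  proof (cases "n \<ge> 5")
    case True
    have "2 * light_const * real n powr (7/4) \<le> ?C * real n powr (7/4)"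
      by (intro mult_right_mono) auto
    then show ?thesis using h_le_powr[OF True] by linarith
  next
    case False
    then have "n \<in> {2, 3, 4}" using n by auto
    then have "real (h n) \<le> ?C * 1" using light_const_pos by auto
    also have "\<dots> \<le> ?C * real n powr (7/4)"
      using C n by (intro mult_left_mono ge_one_powr_ge_zero) auto
    finally show ?thesis .
  qed
qed

end
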